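(* Let $\mathscr{L}(S^1)=\{L(P): P\in S^1\setminus\mathbb{Q}^2,\ L(P)<\infty\}$ be the Lagrange spectrum of intrinsic Diophantine approximation on the unit circle $S^1\subset\mathbb{R}^2$. Then \[ \mathscr{L}(S^1)\cap[0,2)=\left\{\sqrt{4-\tfrac1{x^2}} : x\in\mathcal{M}_x\right\}\cup\left\{\sqrt{4-\tfrac2{y^2}} : y\in\mathcal{M}_y\right\}. \]
   Context: $S^1=\{(x,y)\in\mathbb{R}^2: x^2+y^2=1\}$. Every rational point $Z\in S^1\cap\mathbb{Q}^2$ can be written uniquely as $Z=(a/c,b/c)$ with integers $a,b,c$, $c>0$, $\gcd(a,b,c)=1$; its height is $H(Z)=c$. For $P\in S^1\setminus\mathbb{Q}^2$, the Lagrange number is $L(P)=\limsup_{Z}\frac{1}{H(Z)\,|P-Z|}$, where $|\cdot|$ is the Euclidean distance and the limit superior is taken over $Z\in S^1\cap\mathbb{Q}^2$ as $H(Z)\to\infty$. A Markoff triple $(x;y_1,y_2)$ is a triple of positive integers satisfying $2x^2+y_1^2+y_2^2=4xy_1y_2$. Define $\mathcal{M}_x=\{x : (x;y_1,y_2)\text{ is a Markoff triple}\}$ and $\mathcal{M}_y=\{\max\{y_1,y_2\} : (x;y_1,y_2)\text{ is a Markoff triple}\}$ (the triple $(1;1,1)$ is included, so $1\in\mathcal{M}_x$ and $1\in\mathcal{M}_y$). *)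

theory Defs
  imports "HOL-Analysis.Analysis"
begin

text \<open>The plane is \<^typ>\<open>real \<times> real\<close>, whose \<^const>\<open>dist\<close> is the Euclidean distance.\<close>

definition unit_circle :: "(real \<times> real) set" where
  "unit_circle = {(x, y). x\<^sup>2 + y\<^sup>2 = 1}"

definition rational_plane :: "(real \<times> real) set" where
  "rational_plane = \<rat> \<times> \<rat>"

definition reduced_form :: "real \<times> real \<Rightarrow> int \<Rightarrow> int \<Rightarrow> int \<Rightarrow> bool" where
  "reduced_form Z a b c \<longleftrightarrow>
     Z = (of_int a / of_int c, of_int b / of_int c) \<and> c > 0 \<and> Gcd {a, b, c} = 1"

lemma Gcd_triple_mult:
  fixes g a b c :: int
  assumes "g > 0"
  shows "Gcd {g * a, g * b, g * c} = g * Gcd {a, b, c}"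
proof -
  have "Gcd ((*) g ` {a, b, c}) = normalize (g * Gcd {a, b, c})" by (rule Gcd_mult)
  then show ?thesis using assms by (simp add: abs_mult)
qed

lemma reduced_form_exists:
  assumes "Z \<in> rational_plane"
  shows "\<exists>a b c. reduced_form Z a b c"
proof -
  obtain p q where Z: "Z = (p, q)" "p \<in> \<rat>" "q \<in> \<rat>"
    using assms by (auto simp: rational_plane_def)
  obtain k :: int and m :: int where p: "m > 0" "p = of_int k / of_int m"
    using Z(2) by (metis Rats_cases')
  obtain l :: int and n :: int where q: "n > 0" "q = of_int l / of_int n"
    using Z(3) by (metis Rats_cases')
  define g where "g = Gcd {k * n, l * m, m * n}"
  have mn: "m * n > 0" using p q by simp
  have g: "g > 0"
  proof -
    have "g dvd m * n" unfolding g_def by (rule Gcd_dvd) simp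
    then have "g \<noteq> 0" using mn by auto
    moreover have "g \<ge> 0" unfolding g_def by simp
    ultimately show ?thesis by simp
  qed
  have D: "g dvd k * n" "g dvd l * m" "g dvd m * n"
    unfolding g_def by (auto intro!: Gcd_dvd simp del: Gcd_insert)
  obtain a where a: "k * n = g * a" using D by (blast elim: dvdE)
  obtain b where b: "l * m = g * b" using D by (blast elim: dvdE)
  obtain c where c: "m * n = g * c" using D by (blast elim: dvdE)
  have c0: "c > 0" using mn g c by (simp add: zero_less_mult_iff)
  have "g = Gcd {g * a, g * b, g * c}" by (simp only: a[symmetric] b[symmetric] c[symmetric] g_def[symmetric])
  also have "\<dots> = g * Gcd {a, b, c}" by (rule Gcd_triple_mult[OF g])
  finally have G: "Gcd {a, b, c} = 1" using g by simp
  have "p = of_int (k * n) / of_int (m * n)" "q = of_int (l * m) / of_int (m * n)"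
    using p q by simp_all
  then have pq: "p = of_int a / of_int c" "q = of_int b / of_int c"
    using a b c g by simp_all
  have "reduced_form Z a b c" using pq Z(1) c0 G by (simp add: reduced_form_def)
  then show ?thesis by blast
qed

lemma reduced_form_unique:
  assumes r: "reduced_form Z a b c" and r': "reduced_form Z a' b' c'"
  shows "a' = a \<and> b' = b \<and> c' = c"
proof -
  have c0: "c > 0" and G: "Gcd {a, b, c} = 1" and c0': "c' > 0" and G': "Gcd {a', b', c'} = 1"
    using r r' unfolding reduced_form_def by blast+
  have "real_of_int a' / of_int c' = of_int a / of_int c"
    "real_of_int b' / of_int c' = of_int b / of_int c"
    using r r' unfolding reduced_form_def by (metis prod.inject)+
  then have "real_of_int (a' * c) = of_int (a * c')" "real_of_int (b' * c) = of_int (b * c')"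
    using c0 c0' by (simp_all add: field_simps)
  then have e: "a' * c = a * c'" "b' * c = b * c'" by (simp_all only: of_int_eq_iff)
  have e': "c * a' = c' * a" "c * b' = c' * b" "c * c' = c' * c"
    using e by (simp_all add: mult.commute)
  have "c = Gcd {c * a', c * b', c * c'}"
    by (simp only: Gcd_triple_mult[OF c0] G' mult_1_right)
  also have "\<dots> = c'"
    by (simp only: e' Gcd_triple_mult[OF c0'] G mult_1_right)
  finally have "c = c'" .
  then show ?thesis using e c0 by simp
qed

definition height :: "real \<times> real \<Rightarrow> int" where
  "height Z = (THE c. \<exists>a b. reduced_form Z a b c)"

lemma height_eq:
  assumes "reduced_form Z a b c"
  shows "height Z = c"
  unfolding height_def
proof (rule the_equality)
  show "\<exists>a b. reduced_form Z a b c" using assms by blast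
next
  fix c' assume "\<exists>a b. reduced_form Z a b c'"
  then show "c' = c" using reduced_form_unique[OF assms] by blast
qed

text \<open>The filter describes rational points \<open>Z\<close> of the circle with \<open>height Z\<close> tending to infinity;
  the limit superior is taken in the extended reals because it may be infinite.\<close>

definition lagrange_number :: "real \<times> real \<Rightarrow> ereal" where
  "lagrange_number P =
     Limsup (inf (filtercomap height at_top) (principal (unit_circle \<inter> rational_plane)))
       (\<lambda>Z. ereal (1 / (of_int (height Z) * dist P Z)))"

definition lagrange_spectrum :: "real set" where
  "lagrange_spectrum =
     {real_of_ereal (lagrange_number P) | P.
        P \<in> unit_circle - rational_plane \<and> lagrange_number P < \<infinity>}"

definition markoff_triple :: "int \<Rightarrow> int \<Rightarrow> int \<Rightarrow> bool" where
  "markoff_triple x y1 y2 \<longleftrightarrow>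
     x > 0 \<and> y1 > 0 \<and> y2 > 0 \<and> 2 * x\<^sup>2 + y1\<^sup>2 + y2\<^sup>2 = 4 * x * y1 * y2"

definition markoff_x :: "int set" where
  "markoff_x = {x. \<exists>y1 y2. markoff_triple x y1 y2}"

definition markoff_y :: "int set" where
  "markoff_y = {max y1 y2 | x y1 y2. markoff_triple x y1 y2}"

end

theory Submission
  imports Defs "HOL-Library.Stream"
begin

text \<open>Stereographic projection identifies the rational points of the circle with the cusps of the
  Hecke group \<open>G4\<close> generated by \<open>x \<mapsto> x + \<surd>2\<close> and \<open>x \<mapsto> -1/x\<close>, and the height with the squared denominator of
  a cusp, so the Lagrange number becomes the approximation constant of a real \<open>z\<close> by cusps. A path
  of edges of the tessellation by ideal squares runs down to \<open>z\<close>; crossing a square means turning left, turning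
  right or going straight, and these steps \<open>1\<close>, \<open>-1\<close>, \<open>0\<close> add up to a level \<open>h n\<close>. As in Markoff's original argument, a step of
  the level is a seam at which the past of the path, read backwards, is compared with its future: the
  constant of the cusp at the seam lies below 2 exactly if the first difference has the right sign. Hence
  a constant below 2 forces the level to take two adjacent values eventually, and the path becomes a binary
  word without bad factors. Desubstituting such words repeatedly leads to the powers of
  a Christoffel word \<open>c\<close>, so \<open>z\<close> is fixed by a conjugate of the matrix of \<open>c\<close>. The trace of this matrix is
  \<open>2\<surd>2 m\<close>; the Fricke identity turns the values \<open>m\<close> along the Christoffel tree into Markoff triples. The quadratic form of the
  matrix has discriminant \<open>8 m^2 - 4\<close> and takes the value \<open>m\<close> at a cusp, and as its values at cusps are
  discrete, a constant of at most 2 must be \<open>\<surd>(4 - 2 / m^2)\<close>.\<close>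

section \<open>Binary words without bad factors\<close>

text \<open>After a step up, \<open>B i = B (Suc i) + sqrt 2\<close>, so \<open>A i + B i\<close>
  exceeds \<open>2 * sqrt 2\<close> by \<open>A i - (sqrt 2 - B (Suc i))\<close>. The reflection at
  \<open>sqrt 2\<close> turns the expansion of the future into one by the same kind of turns that
  expand the past. The three turns map the positive half-line onto disjoint intervals, ordered as
  their steps are; hence the first difference decides the sign, and after \<open>k\<close> equal
  turns the excess is at most \<open>1 / k\<close> in absolute value. Strictness enters through this
  estimate: a constant that stays below 2 by a fixed gap bounds the length of undecided factors, and
  that bound makes the desubstitution end. In the other direction, the absence of bad factors only
  keeps the vertices of the path within constant 2. Cusps off the path still have to be compared
  with vertices of the squares that the path crosses, and the exact value comes from the quadratic
  form alone; it is never computed from the letters of a word.\<close>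

definition factors :: "'a stream \<Rightarrow> 'a list set" where
  "factors w = {l. \<exists>u r. w = u @- l @- r}"

lemma factors_shift: "factors r \<subseteq> factors (u @- r)"
  unfolding factors_def by (auto simp del: shift_append) (metis shift_append)

lemma factors_mid: "a @ l @ b \<in> factors w \<Longrightarrow> l \<in> factors w"
  unfolding factors_def by (auto simp flip: shift_append) (metis shift_append)

lemma factors_extend: assumes "l \<in> factors w" shows "\<exists>a. l @ [a] \<in> factors w"
proof -
  obtain u r where "w = u @- l @- r" using assms by (auto simp: factors_def)
  then have "w = u @- (l @ [shd r]) @- stl r" by simp
  then show ?thesis unfolding factors_def by blast
qed

abbreviation img :: "('a \<Rightarrow> 'b list) \<Rightarrow> 'a list \<Rightarrow> 'b list" where
  "img f l \<equiv> concat (map f l)"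

text \<open>An image under \<open>sub1\<close> begins with its only \<open>True\<close>, an image
  under \<open>sub2\<close> ends with its only \<open>False\<close>. These letters mark the cuts
  when a stream is parsed; they are also the extra \<open>True\<close> behind, or
  \<open>False\<close> before, the images of factors below.\<close>

fun sub1 :: "bool \<Rightarrow> bool list" where
  "sub1 True = [True]" | "sub1 False = [True, False]"
fun sub2 :: "bool \<Rightarrow> bool list" where
  "sub2 True = [True, False]" | "sub2 False = [False]"

text \<open>The pair \<open>[s, \<not> s]\<close> is a seam. In a bad word the past of the seam, read backwards, and its future first
  differ with the wrong sign; in an undecided word they agree on \<open>K\<close> letters.\<close>

definition bad :: "bool list \<Rightarrow> bool" where
  "bad l \<longleftrightarrow> (\<exists>s u. l = s # rev u @ [s, \<not> s] @ u @ [\<not> s])"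

definition undecided :: "nat \<Rightarrow> bool list \<Rightarrow> bool" where
  "undecided K l \<longleftrightarrow> (\<exists>s u. length u \<ge> K \<and> l = rev u @ [s, \<not> s] @ u)"

text \<open>Stated for a set of words and not for a stream, because the symmetry \<open>flip\<close>
  reverses words and has no counterpart on streams.\<close>

definition markoff_set :: "nat \<Rightarrow> bool list set \<Rightarrow> bool" where
  "markoff_set K F \<longleftrightarrow> (\<forall>l \<in> F. \<not> bad l \<and> \<not> undecided K l)"

definition factorial_set :: "'a list set \<Rightarrow> bool" where
  "factorial_set F \<longleftrightarrow> (\<forall>a l b. a @ l @ b \<in> F \<longrightarrow> l \<in> F)"

lemma factorial_setD: "factorial_set F \<Longrightarrow> a @ l @ b \<in> F \<Longrightarrow> l \<in> F"
  unfolding factorial_set_def by blast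

lemma factorial_factors: "factorial_set (factors w)"
  unfolding factorial_set_def using factors_mid by blast

text \<open>Reversal commutes with \<open>sub1\<close> up to conjugation by \<open>True\<close>, the
  letter with which every image begins.\<close>

lemma img_sub1_rev: "img sub1 (rev u) @ [True] = True # rev (img sub1 u)"
proof (induction u)
  case (Cons a u) then show ?case by (cases a) auto
qed simp

lemma img_sub1_rev': "img sub1 (rev u) @ True # l = True # rev (img sub1 u) @ l"
  using arg_cong[OF img_sub1_rev, of "\<lambda>x. x @ l"] by simp

text \<open>Complementing the letters changes the direction of a seam and reversing the word
  restores it. So \<open>flip\<close> keeps bad and undecided words, and it exchanges the two
  substitutions; everything about \<open>sub2\<close> follows from \<open>sub1\<close>.\<close>

abbreviation flip :: "bool list \<Rightarrow> bool list" where
  "flip l \<equiv> rev (map Not l)"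

lemma flip_flip [simp]: "flip (flip l) = l"
  by (induction l) auto

lemma flip_img_sub1: "flip (img sub1 l) = img sub2 (flip l)"
proof (induction l)
  case (Cons a l) then show ?case by (cases a) auto
qed simp

lemma bad_flip: "bad l \<Longrightarrow> bad (flip l)"
  unfolding bad_def
proof (elim exE)
  fix s u assume "l = s # rev u @ [s, \<not> s] @ u @ [\<not> s]"
  then have "flip l = s # rev (map Not u) @ [s, \<not> s] @ map Not u @ [\<not> s]" by (simp add: rev_map)
  then show "\<exists>s u. flip l = s # rev u @ [s, \<not> s] @ u @ [\<not> s]" by blast
qed

lemma undecided_flip: "undecided K l \<Longrightarrow> undecided K (flip l)"
  unfolding undecided_def
proof (elim exE conjE)
  fix s u assume "l = rev u @ [s, \<not> s] @ u" "K \<le> length u"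
  then have "flip l = rev (map Not u) @ [s, \<not> s] @ map Not u \<and> length (map Not u) \<ge> K"
    by (simp add: rev_map)
  then show "\<exists>s u. K \<le> length u \<and> flip l = rev u @ [s, \<not> s] @ u" by blast
qed

lemma markoff_set_flip: "markoff_set K F \<Longrightarrow> markoff_set K (flip -` F)"
  unfolding markoff_set_def using bad_flip undecided_flip by fastforce

lemma factorial_set_flip: "factorial_set F \<Longrightarrow> factorial_set (flip -` F)"
  unfolding factorial_set_def by (simp add: rev_map) metis

text \<open>A seam with common part \<open>u\<close> in \<open>l\<close> becomes a seam with common
  part \<open>U\<close> in the image of \<open>l\<close>, since \<open>True\<close> conjugates
  images of reversed words. The final \<open>True\<close> makes \<open>U\<close> longer than
  \<open>u\<close>, which is why \<open>Suc K\<close> drops to \<open>K\<close>.\<close>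

lemma markoff_set_desubstitute1:
  assumes F: "factorial_set F" and enc: "\<And>l. l \<in> F' \<Longrightarrow> img sub1 l @ [True] \<in> F"
    and m: "markoff_set (Suc K) F"
  shows "markoff_set K F'"
  unfolding markoff_set_def
proof (intro ballI conjI notI)
  fix l assume l: "l \<in> F'" and "bad l"
  then obtain s u where lu: "l = s # rev u @ [s, \<not> s] @ u @ [\<not> s]" by (auto simp: bad_def)
  define U where "U = img sub1 u @ [True]"
  have "\<exists>a b. img sub1 l @ [True] = a @ (s # rev U @ [s, \<not> s] @ U @ [\<not> s]) @ b"
  proof (cases s)
    case True
    then have "img sub1 l @ [True] = [] @ (s # rev U @ [s, \<not> s] @ U @ [\<not> s]) @ [True]"
      by (simp add: lu U_def img_sub1_rev')
    then show ?thesis by blast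
  next
    case False
    then have "img sub1 l @ [True] = [True] @ (s # rev U @ [s, \<not> s] @ U @ [\<not> s]) @ []"
      by (simp add: lu U_def img_sub1_rev')
    then show ?thesis by blast
  qed
  then have "s # rev U @ [s, \<not> s] @ U @ [\<not> s] \<in> F"
    using enc[OF l] factorial_setD[OF F] by metis
  then show False using m unfolding markoff_set_def bad_def by blast
next
  fix l assume l: "l \<in> F'" and "undecided K l"
  then obtain s u where lu: "l = rev u @ [s, \<not> s] @ u" "K \<le> length u" by (auto simp: undecided_def)
  define U where "U = img sub1 u @ [True]"
  have len: "length u \<le> length (img sub1 u)" for u
  proof (induction u)
    case (Cons a u) then show ?case by (cases a) auto
  qed simp
  have "Suc K \<le> length U" using lu len[of u] by (simp add: U_def)
  moreover have "img sub1 l @ [True] = rev U @ [s, \<not> s] @ U"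
    by (cases s) (simp_all add: lu U_def img_sub1_rev')
  ultimately show False using enc[OF l] m unfolding markoff_set_def undecided_def by metis
qed

lemma markoff_set_desubstitute2:
  assumes F: "factorial_set F" and enc: "\<And>l. l \<in> F' \<Longrightarrow> False # img sub2 l \<in> F"
    and m: "markoff_set (Suc K) F"
  shows "markoff_set K F'"
proof -
  have "markoff_set K (flip -` F')"
  proof (rule markoff_set_desubstitute1[OF factorial_set_flip[OF F] _ markoff_set_flip[OF m]])
    fix l assume "l \<in> flip -` F'"
    then have "False # img sub2 (flip l) \<in> F" using enc by auto
    then show "img sub1 l @ [True] \<in> flip -` F" using flip_img_sub1[of l] by simp
  qed
  from markoff_set_flip[OF this] show ?thesis by (simp add: vimage_def)
qed

lemma img_sub1_surj:
  assumes "\<And>a b. v \<noteq> a @ [False, False] @ b" "v = [] \<or> hd v"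
  shows "\<exists>u. v = img sub1 u"
  using assms
proof (induction v rule: length_induct)
  case (1 v)
  show ?case
  proof (cases v)
    case Nil then have "v = img sub1 []" by simp then show ?thesis by blast
  next
    case (Cons a v1)
    then have a: "a" using 1 by auto
    show ?thesis
    proof (cases "v1 = [] \<or> hd v1")
      case True
      have "\<exists>u. v1 = img sub1 u" using 1 True Cons by (metis append_Cons length_Cons lessI)
      then obtain u where "v1 = img sub1 u" by blast
      then have "v = img sub1 (True # u)" using Cons a by simp
      then show ?thesis by blast
    next
      case False
      then obtain v2 where v2: "v1 = False # v2" by (metis (full_types) list.sel(1) neq_Nil_conv)
      have "v2 = [] \<or> hd v2" using 1(2)[of "[True]"] Cons v2 a by (cases v2) auto
      moreover have "\<And>a b. v2 \<noteq> a @ [False, False] @ b"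
        using 1(2) Cons v2 by (metis append_Cons)
      ultimately obtain u where "v2 = img sub1 u"
        using 1(1)[rule_format, of v2] Cons v2 by auto
      then have "v = img sub1 (False # u)" using Cons a v2 by simp
      then show ?thesis by blast
    qed
  qed
qed

text \<open>Without \<open>[False, False]\<close> the common part \<open>u\<close> of a bad word
  begins and ends with \<open>True\<close>, hence is an image followed by \<open>True\<close>. One
  more letter, on the right for \<open>s = True\<close> and on the left for
  \<open>s = False\<close>, is forced to be \<open>True\<close> and completes the image of a shorter
  bad word.\<close>

lemma no_bad_substitute1:
  assumes F: "factorial_set F" and no: "[False, False] \<notin> F"
    and ext: "\<And>l. l \<in> F \<Longrightarrow> \<exists>a. l @ [a] \<in> F" "\<And>l. l \<in> F \<Longrightarrow> \<exists>a. a # l \<in> F"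
    and dec: "\<And>l. img sub1 l @ [True] \<in> F \<Longrightarrow> l \<in> F'"
    and bad: "\<And>l. l \<in> F' \<Longrightarrow> \<not> bad l"
    and l: "l \<in> F"
  shows "\<not> bad l"
proof
  assume "bad l"
  then obtain s u where lu: "l = s # rev u @ [s, \<not> s] @ u @ [\<not> s]" by (auto simp: bad_def)
  have noff: "l \<noteq> a @ [False, False] @ b" for a b using no l factorial_setD[OF F] by metis
  have une: "u \<noteq> []" using noff[of "[]"] noff[of "[True, True]" "[]"] lu by (cases s) auto
  have hdu: "hd u"
  proof (rule ccontr)
    assume "\<not> hd u"
    then obtain u1 where u1: "u = False # u1" using une by (metis (full_types) list.exhaust_sel)
    show False
    proof (cases s)
      case True then show False using noff[of "s # rev u @ [s]" "u1 @ [\<not> s]"] lu u1 by simp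
    next
      case False then show False using noff[of "s # rev u1" "[\<not> s] @ u @ [\<not> s]"] lu u1 by simp
    qed
  qed
  have lastu: "last u"
  proof (rule ccontr)
    assume "\<not> last u"
    then obtain u1 where u1: "u = u1 @ [False]" using une by (metis (full_types) append_butlast_last_id)
    show False
    proof (cases s)
      case True then show False using noff[of "s # rev u @ [s, \<not>s] @ u1" "[]"] lu u1 by simp
    next
      case False then show False using noff[of "[]" "rev u1 @ [s, \<not> s] @ u @ [\<not> s]"] lu u1 by simp
    qed
  qed
  obtain v where v: "u = v @ [True]" using lastu une by (metis (full_types) append_butlast_last_id)
  have "\<exists>u'. v = img sub1 u'"
  proof (rule img_sub1_surj)
    fix a b show "v \<noteq> a @ [False, False] @ b"
      using noff[of "s # rev u @ [s, \<not> s] @ a" "b @ [True, \<not> s]"] lu v by auto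
    show "v = [] \<or> hd v" using hdu v by (cases v) auto
  qed
  then obtain u' where u': "v = img sub1 u'" by blast
  define l' where "l' = s # rev u' @ [s, \<not> s] @ u' @ [\<not> s]"
  have "img sub1 l' @ [True] \<in> F"
  proof (cases s)
    case True
    obtain a where a: "l @ [a] \<in> F" using ext l by blast
    have "a"
    proof (rule ccontr)
      assume "\<not> a"
      then have "(s # rev u @ [s, \<not> s] @ u) @ [False, False] @ [] \<in> F" using a lu True by simp
      then show False using no factorial_setD[OF F] by blast
    qed
    moreover have "img sub1 l' = l" using True u' v lu by (simp add: l'_def img_sub1_rev')
    ultimately show ?thesis using a by simp
  next
    case False
    obtain a where a: "a # l \<in> F" using ext l by blast
    have "a"
    proof (rule ccontr)
      assume "\<not> a"
      then have "[] @ [False, False] @ (rev u @ [s, \<not> s] @ u @ [\<not> s]) \<in> F" using a lu False by simp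
      then show False using no factorial_setD[OF F] by blast
    qed
    moreover have "img sub1 l' @ [True] = True # l" using False u' v lu by (simp add: l'_def img_sub1_rev')
    ultimately show ?thesis using a by simp
  qed
  from dec[OF this] bad show False unfolding l'_def bad_def by blast
qed

lemma no_bad_substitute2:
  assumes F: "factorial_set F" and no: "[True, True] \<notin> F"
    and ext: "\<And>l. l \<in> F \<Longrightarrow> \<exists>a. l @ [a] \<in> F" "\<And>l. l \<in> F \<Longrightarrow> \<exists>a. a # l \<in> F"
    and dec: "\<And>l. False # img sub2 l \<in> F \<Longrightarrow> l \<in> F'"
    and bad: "\<And>l. l \<in> F' \<Longrightarrow> \<not> bad l"
    and l: "l \<in> F"
  shows "\<not> bad l"
proof -
  have "\<not> bad (flip l)"
  proof (rule no_bad_substitute1[OF factorial_set_flip[OF F], of "flip -` F'"])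
    show "[False, False] \<notin> flip -` F" using no by simp
    fix l assume "l \<in> flip -` F"
    then have l: "flip l \<in> F" by simp
    obtain a where "a # flip l \<in> F" using ext(2)[OF l] by blast
    then have "l @ [\<not> a] \<in> flip -` F" by simp
    then show "\<exists>a. l @ [a] \<in> flip -` F" by blast
    obtain a where "flip l @ [a] \<in> F" using ext(1)[OF l] by blast
    then have "(\<not> a) # l \<in> flip -` F" by simp
    then show "\<exists>a. a # l \<in> flip -` F" by blast
  next
    fix l assume "img sub1 l @ [True] \<in> flip -` F"
    then have "False # img sub2 (flip l) \<in> F" using flip_img_sub1[of l] by simp
    then show "l \<in> flip -` F'" using dec by simp
  next
    fix l assume "l \<in> flip -` F'" then show "\<not> bad l" using bad[of "flip l"] bad_flip by auto
  next
    show "flip l \<in> flip -` F" using l by (simp only: vimage_eq flip_flip)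
  qed
  then show ?thesis using bad_flip by blast
qed

section \<open>Doubled letters of both kinds\<close>

definition alternating_block :: "bool \<Rightarrow> nat \<Rightarrow> bool list" where
  "alternating_block s k = concat (replicate k [s, \<not> s])"

lemma alternating_block_0 [simp]: "alternating_block s 0 = []"
  by (simp add: alternating_block_def)

lemma alternating_block_Suc: "alternating_block s (Suc k) = s # (\<not> s) # alternating_block s k"
  by (simp add: alternating_block_def)

lemma alternating_block_Suc2: "alternating_block s (Suc k) = alternating_block s k @ [s, \<not> s]"
  by (induction k) (simp_all add: alternating_block_Suc)

lemma alternating_block_shift: "s # alternating_block (\<not> s) k = alternating_block s k @ [s]"
  by (induction k) (simp_all add: alternating_block_Suc)

lemma alternating_block_shift': "s # alternating_block (\<not> s) k @ l = alternating_block s k @ s # l"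
  by (induction k) (simp_all add: alternating_block_Suc)

lemma rev_alternating_block: "rev (alternating_block s k) = alternating_block (\<not> s) k"
proof (induction k)
  case (Suc k)
  have "rev (alternating_block s (Suc k)) = rev (alternating_block s k) @ [\<not> s, s]"
    by (simp add: alternating_block_Suc)
  also have "\<dots> = alternating_block (\<not> s) (Suc k)"
    by (simp only: Suc.IH alternating_block_Suc2 not_not)
  finally show ?case .
qed simp

definition clash :: "bool \<Rightarrow> nat \<Rightarrow> bool list" where
  "clash s k = [s, s] @ alternating_block (\<not> s) k @ [\<not> s, \<not> s]"

text \<open>For \<open>k = 0\<close> a clash is itself bad. For larger \<open>k\<close> the letters
  that follow a clash are forced: a wrong one completes either a bad word or a clash of the opposite
  kind with a smaller parameter. At \<open>D k\<close> both letters are wrong.\<close>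

lemma clash_free:
  assumes F: "factorial_set F" and ext: "\<And>l. l \<in> F \<Longrightarrow> \<exists>a. l @ [a] \<in> F"
    and bad: "\<And>l. l \<in> F \<Longrightarrow> \<not> bad l"
  shows "clash s k \<notin> F"
proof (induction k arbitrary: s rule: less_induct)
  case (less k)
  define t where "t = (\<not> s)"
  have st: "(\<not> s) = t" "(\<not> t) = s" by (auto simp: t_def)
  note Fac = factorial_setD[OF F]
  have bads: "p @ (s # rev u @ [s, t] @ u @ [t]) @ r \<notin> F" for p u r
    using Fac[of p "s # rev u @ [s, t] @ u @ [t]" r] bad unfolding bad_def st(1)[symmetric] by blast
  have IH: "a @ ([t, t] @ alternating_block s j @ [s, s]) @ b \<notin> F" if "j < k" for j a b
    using Fac[of a "clash t j" b] less[OF that, of t] by (auto simp: clash_def st)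
  show ?case
  proof
    assume mem: "clash s k \<in> F"
    show False
    proof (cases k)
      case 0
      then show False using mem bads[of "[]" "[]" "[]"] by (simp add: clash_def st)
    next
      case (Suc k')
      \<comment> \<open>The seam is the \<open>[s, t]\<close> in the middle. By \<open>rD\<close>
        the past of this seam, read backwards, is \<open>alternating_block t k @ [s]\<close>, and
        the forced future is a copy of it.\<close>
      define D where "D j = [s, s] @ alternating_block t k' @ [t] @ [s, t] @ alternating_block t j" for j
      have rD: "[s, s] @ alternating_block t k' @ [t] = rev (alternating_block t k @ [s])"
        using alternating_block_shift[of s k'] by (simp add: rev_alternating_block st Suc alternating_block_Suc)
      have ck: "clash s k = [s, s] @ alternating_block t k' @ [t] @ [s, t] @ [t]"
        by (simp add: clash_def st Suc alternating_block_Suc2)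
      have step: "D (Suc j) \<in> F" if "j < k" and m: "[s, s] @ alternating_block t k' @ [t] @ [s, t] @ alternating_block t j @ [t] \<in> F" for j
      proof -
        obtain b where b: "([s, s] @ alternating_block t k' @ [t] @ [s, t] @ alternating_block t j @ [t]) @ [b] \<in> F"
          using ext[OF m] by blast
        have "b = s"
        proof (rule ccontr)
          assume "b \<noteq> s"
          then have bt: "b = t" by (auto simp: t_def)
          obtain i where i: "k = Suc j + i" using less_imp_Suc_add[OF \<open>j < k\<close>] by auto
          define u where "u = alternating_block t j @ [t]"
          have "alternating_block t k = u @ s # alternating_block t i"
            unfolding i u_def
            by (induction j) (simp_all add: alternating_block_Suc st)
          then have e: "[s, s] @ alternating_block t k' @ [t] = rev (alternating_block t i @ [s]) @ s # rev u"
            using rD by simp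
          then have "rev (alternating_block t i @ [s]) @ (s # rev u @ [s, t] @ u @ [t]) @ [] \<in> F"
          proof -
            have "([s, s] @ alternating_block t k' @ [t]) @ [s, t] @ u @ [t] \<in> F"
              using b by (simp add: bt u_def)
            then show ?thesis unfolding e by simp
          qed
          then show False using bads by blast
        qed
        then show ?thesis using b by (simp add: D_def alternating_block_Suc2 st)
      qed
      have D: "D (Suc j) \<in> F" if "j < k" for j
        using that
      proof (induction j)
        case 0 then show ?case using step[of 0] mem ck by simp
      next
        case (Suc j)
        then have m: "D (Suc j) \<in> F" by simp
        obtain a where a: "D (Suc j) @ [a] \<in> F" using ext[OF m] by blast
        have "a = t"
        proof (rule ccontr)
          assume "a \<noteq> t"
          then have "a = s" by (auto simp: t_def)
          then have "([s, s] @ alternating_block t k' @ [t] @ [s]) @ ([t, t] @ alternating_block s j @ [s, s]) @ [] \<in> F"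
            unfolding alternating_block_shift'[of s j "[s]", unfolded st, symmetric]
            using a by (simp add: D_def alternating_block_Suc st)
          then show False using IH[of j] Suc by (meson Suc_lessD)
        qed
        then show ?case using step[of "Suc j"] Suc a by (simp add: D_def)
      qed
      then have Dk: "D k \<in> F" using Suc by blast
      obtain a where a: "D k @ [a] \<in> F" using ext[OF Dk] by blast
      show False
      proof (cases "a = s")
        case True
        then have "([s, s] @ alternating_block t k' @ [t] @ [s]) @ ([t, t] @ alternating_block s k' @ [s, s]) @ [] \<in> F"
          unfolding alternating_block_shift'[of s k' "[s]", unfolded st, symmetric]
          using a by (simp add: D_def Suc alternating_block_Suc st)
        then show False using IH[of k'] Suc by blast
      next
        case False
        then have "a = t" by (auto simp: t_def)
        then have "D k @ [t] = [] @ (s # rev (alternating_block t k) @ [s, t] @ alternating_block t k @ [t]) @ []"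
          using rD by (simp add: D_def)
        moreover have "D k @ [t] \<in> F" using a \<open>a = t\<close> by simp
        ultimately show False using bads[of "[]" "alternating_block t k" "[]"] by (simp only: simp_thms)
      qed
    qed
  qed
qed

text \<open>From the last \<open>s s\<close> up to the next doubled letter of the other kind the
  word alternates. The induction scans \<open>m\<close>; \<open>j\<close> counts the alternations
  since the last \<open>s s\<close>.\<close>

lemma clash_between:
  assumes F: "factorial_set F" and mem: "[s, s] @ alternating_block (\<not> s) j @ m @ [\<not> s, \<not> s] \<in> F"
  shows "\<exists>k. clash s k \<in> F"
  using mem
proof (induction m arbitrary: j rule: length_induct)
  case (1 m)
  note Fac = factorial_setD[OF F]
  define t where "t = (\<not> s)"
  have st: "(\<not> s) = t" "(\<not> t) = s" by (auto simp: t_def)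
  have base: "\<exists>k. clash s k \<in> F" if "([s, s] @ alternating_block t i @ [t, t]) @ r \<in> F" for i r
    using Fac[of "[]" "clash s i" r] that by (auto simp: clash_def st)
  note mem = 1(2)[unfolded st]
  show ?case
  proof (cases m)
    case Nil then show ?thesis using base[of j "[]"] mem by simp
  next
    case (Cons a m1)
    show ?thesis
    proof (cases "a = s")
      case True
      have eq: "([s, s] @ alternating_block t j) @ [s] @ m1 @ [t, t] = (s # alternating_block s j) @ ([s, s] @ m1 @ [t, t]) @ []"
        using alternating_block_shift'[of s j "s # m1 @ [t, t]", unfolded st] by simp
      then have "(s # alternating_block s j) @ ([s, s] @ m1 @ [t, t]) @ [] \<in> F"
        unfolding eq[symmetric] using mem Cons True by simp
      then have "[s, s] @ m1 @ [t, t] \<in> F" using Fac by blast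
      then show ?thesis using 1(1)[rule_format, of m1 0] Cons by (simp add: st)
    next
      case False
      then have at: "a = t" by (auto simp: t_def)
      show ?thesis
      proof (cases m1)
        case Nil then show ?thesis using base[of j "[t]"] mem Cons at by simp
      next
        case (Cons b m2)
        note m1 = \<open>m = a # m1\<close> Cons
        show ?thesis
        proof (cases "b = s")
          case True
          then have "[s, s] @ alternating_block t (Suc j) @ m2 @ [t, t] \<in> F"
            using mem m1 at by (simp add: alternating_block_Suc2 st)
          then show ?thesis using 1(1)[rule_format, of m2 "Suc j"] m1 by (simp add: st)
        next
          case False
          then have "b = t" by (auto simp: t_def)
          then show ?thesis using base[of j "m2 @ [t, t]"] mem m1 at by simp
        qed
      qed
    qed
  qed
qed

text \<open>If both squares occurred in every tail, some \<open>[True, True]\<close> would be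
  followed by \<open>[False, False]\<close>, and a clash would lie between. Hence one letter is
  eventually isolated, and the tail can be cut into images under one of the two
  substitutions.\<close>

lemma eventually_no_square:
  assumes bad: "\<And>l. l \<in> factors w \<Longrightarrow> \<not> bad l"
  shows "\<exists>n s. [s, s] \<notin> factors (sdrop n w)"
proof (rule ccontr)
  assume "\<not> ?thesis"
  then have all: "[s, s] \<in> factors (sdrop n w)" for n s by blast
  obtain u r where 1: "w = u @- [True, True] @- r"
    using all[of True 0] by (auto simp: factors_def)
  define v where "v = u @ [True, True]"
  have "r = sdrop (length v) w" by (simp add: 1 v_def numeral_2_eq_2 sdrop_shift)
  then obtain m r' where "r = m @- [False, False] @- r'" using all[of False "length v"] by (auto simp: factors_def)
  then have "w = u @- ([True, True] @ alternating_block (\<not> True) 0 @ m @ [\<not> True, \<not> True]) @- r'" using 1 by simp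
  then have "[True, True] @ alternating_block (\<not> True) 0 @ m @ [\<not> True, \<not> True] \<in> factors w"
    unfolding factors_def by blast
  from clash_between[OF factorial_factors this] show False
    using clash_free[OF factorial_factors factors_extend bad] by blast
qed

section \<open>Parsing streams into images of letters\<close>

lemma stream_eqI_prefixes:
  assumes "\<And>n. \<exists>l r r'. length l \<ge> n \<and> s = l @- r \<and> s' = l @- r'"
  shows "s = s'"
proof -
  have "s !! n = s' !! n" for n
  proof -
    obtain l r r' where "length l \<ge> Suc n" "s = l @- r" "s' = l @- r'" using assms by blast
    then show ?thesis by simp
  qed
  then have "snth s = snth s'" by blast
  then show ?thesis by (metis stream_smap_nats)
qed

abbreviation simg :: "('a \<Rightarrow> 'b list) \<Rightarrow> 'a stream \<Rightarrow> 'b stream" where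
  "simg f w \<equiv> flat (smap f w)"

lemma simg_shift:
  assumes "\<And>a. f a \<noteq> []"
  shows "simg f (l @- w) = img f l @- simg f w"
  by (induction l) (simp_all add: assms)

lemma length_img_ge:
  assumes "\<And>a. f a \<noteq> []"
  shows "length (img f l) \<ge> length l"
proof (induction l)
  case (Cons a l) then show ?case using assms[of a] by (cases "f a") auto
qed simp

lemma ex_simg:
  assumes ne: "\<And>a. f a \<noteq> []"
    and step: "\<And>w. P w \<Longrightarrow> \<exists>a w'. w = f a @- w' \<and> P w'" and w: "P w"
  shows "\<exists>w'. w = simg f w'"
proof -
  obtain A N where AN: "\<And>w. P w \<Longrightarrow> w = f (A w) @- N w \<and> P (N w)" using step by metis
  define v where "v = smap A (siterate N w)"
  have P: "P ((N ^^ n) w)" for n by (induction n) (simp_all add: w AN)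
  have pre: "w = img f (stake n v) @- (N ^^ n) w" for n
  proof (induction n)
    case (Suc n)
    have "(N ^^ n) w = f (A ((N ^^ n) w)) @- (N ^^ Suc n) w" using AN[OF P[of n]] by simp
    moreover have "v !! n = A ((N ^^ n) w)" by (simp add: v_def)
    ultimately show ?case using Suc by (simp add: stake_Suc del: stake.simps(2) funpow.simps)
  qed simp
  have "w = simg f v"
  proof (rule stream_eqI_prefixes)
    fix n
    have "simg f v = img f (stake n v) @- simg f (sdrop n v)"
      using simg_shift[of f "stake n v" "sdrop n v", OF ne] by (simp only: stake_sdrop)
    moreover have "n \<le> length (img f (stake n v))" using length_img_ge[of f "stake n v", OF ne] by simp
    ultimately show "\<exists>l r r'. length l \<ge> n \<and> w = l @- r \<and> simg f v = l @- r'" using pre by blast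
  qed
  then show ?thesis by blast
qed

lemma sub1_ne [simp]: "sub1 a \<noteq> []" by (cases a) auto
lemma sub2_ne [simp]: "sub2 a \<noteq> []" by (cases a) auto

lemma simg_sub1_shd: "shd (simg sub1 w)"
proof -
  obtain a v where "w = a ## v" by (cases w)
  then show ?thesis by (cases a) simp_all
qed

lemma cycle_eqI:
  assumes "c \<noteq> []" "w = c @- w"
  shows "w = cycle c"
proof (rule stream_eqI_prefixes)
  fix n
  have rep: "w = concat (replicate n c) @- w" for n
  proof (induction n)
    case (Suc n)
    have "concat (replicate (Suc n) c) @- w = c @- concat (replicate n c) @- w" by simp
    then show ?case using Suc assms(2) by metis
  qed simp
  have rep': "cycle c = concat (replicate n c) @- cycle c" for n
  proof (induction n)
    case (Suc n)
    have "concat (replicate (Suc n) c) @- cycle c = c @- concat (replicate n c) @- cycle c" by simp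
    then show ?case using Suc cycle_decomp[OF assms(1)] by metis
  qed simp
  have "n \<le> length (concat (replicate n c))" using assms(1) by (cases c) (simp_all add: length_concat sum_list_replicate)
  then show "\<exists>l r r'. length l \<ge> n \<and> w = l @- r \<and> cycle c = l @- r'" using rep rep' by blast
qed

lemma simg_cycle:
  assumes "\<And>a. f a \<noteq> []" "c \<noteq> []"
  shows "simg f (cycle c) = cycle (img f c)"
proof (rule cycle_eqI)
  show "img f c \<noteq> []" using assms by (cases c) auto
  show "simg f (cycle c) = img f c @- simg f (cycle c)"
    using simg_shift[of f c "cycle c", OF assms(1)] cycle_decomp[OF assms(2)] by simp
qed

text \<open>The additional \<open>True\<close> is the first letter of whatever image comes
  next.\<close>

lemma factors_sub1:
  assumes "l \<in> factors w" shows "img sub1 l @ [True] \<in> factors (simg sub1 w)"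
proof -
  obtain u r where w: "w = u @- l @- r" using assms by (auto simp: factors_def)
  obtain r' where r': "simg sub1 r = True ## r'" using simg_sub1_shd[of r] by (metis (full_types) stream.collapse)
  then have "simg sub1 w = img sub1 u @- (img sub1 l @ [True]) @- r'"
    unfolding w simg_shift[OF sub1_ne] r' by simp
  then show ?thesis unfolding factors_def by blast
qed

text \<open>The additional \<open>False\<close> is the last letter of the image before; the stream
  receives a leading \<open>False\<close> for the factors at its very beginning.\<close>

lemma factors_sub2:
  assumes "l \<in> factors w" shows "False # img sub2 l \<in> factors (False ## simg sub2 w)"
proof -
  obtain u r where w: "w = u @- l @- r" using assms by (auto simp: factors_def)
  define v where "v = False # img sub2 u"
  have "last v = False" unfolding v_def
  proof (induction u rule: rev_induct)
    case (snoc a u) then show ?case by (cases a) auto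
  qed simp
  then have v: "v = butlast v @ [False]" unfolding v_def by (metis append_butlast_last_id list.distinct(1))
  have "False ## simg sub2 w = v @- img sub2 l @- simg sub2 r"
    unfolding w v_def simg_shift[OF sub2_ne] by simp
  also have "\<dots> = butlast v @- (False # img sub2 l) @- simg sub2 r"
    by (subst v) simp
  finally show ?thesis unfolding factors_def by blast
qed

lemma parse_sub1:
  assumes "simg sub1 w = u @- True ## r"
  shows "\<exists>u' w'. w = u' @- w' \<and> u = img sub1 u' \<and> True ## r = simg sub1 w'"
  using assms
proof (induction u arbitrary: w rule: length_induct)
  case (1 u)
  show ?case
  proof (cases u)
    case Nil
    then have "w = [] @- w \<and> u = img sub1 [] \<and> True ## r = simg sub1 w" using 1 by simp
    then show ?thesis by blast
  next
    case (Cons a u1)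
    obtain b w1 where w: "w = b ## w1" by (cases w)
    show ?thesis
    proof (cases b)
      case True
      then have "simg sub1 w1 = u1 @- True ## r" and a: "a" using 1(2) Cons w by simp_all
      then obtain u' w' where "w1 = u' @- w' \<and> u1 = img sub1 u' \<and> True ## r = simg sub1 w'"
        using 1(1) Cons by (metis length_Cons lessI)
      then have "w = (True # u') @- w' \<and> u = img sub1 (True # u') \<and> True ## r = simg sub1 w'"
        using w True Cons a by simp
      then show ?thesis by blast
    next
      case False
      then have e: "True ## False ## simg sub1 w1 = a ## u1 @- True ## r" using 1(2) Cons w by simp
      then obtain u2 where u2: "u1 = False # u2" by (cases u1) auto
      then have "simg sub1 w1 = u2 @- True ## r" using e by simp
      then obtain u' w' where "w1 = u' @- w' \<and> u2 = img sub1 u' \<and> True ## r = simg sub1 w'"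
        using 1(1) Cons u2 by (metis length_Cons lessI less_SucI)
      then have "w = (False # u') @- w' \<and> u = img sub1 (False # u') \<and> True ## r = simg sub1 w'"
        using w False Cons u2 e by simp
      then show ?thesis by blast
    qed
  qed
qed

lemma img_sub1_inj:
  assumes "img sub1 l @- True ## r = simg sub1 w"
  shows "\<exists>w'. w = l @- w'"
  using assms
proof (induction l arbitrary: w)
  case (Cons a l)
  obtain b w1 where w: "w = b ## w1" by (cases w)
  have hd: "img sub1 l @- True ## r = True ## stl (img sub1 l @- True ## r)"
  proof (cases l)
    case (Cons a l') then show ?thesis by (cases a) auto
  qed simp
  have "a = b \<and> img sub1 l @- True ## r = simg sub1 w1"
  proof (cases a; cases b)
    assume "a" "\<not> b"
    then have "img sub1 l @- True ## r = False ## simg sub1 w1" using Cons(2) w by simp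
    then show ?thesis using hd by (metis stream.sel(1))
  next
    assume "\<not> a" "b"
    then have "False ## img sub1 l @- True ## r = simg sub1 w1" using Cons(2) w by simp
    then show ?thesis using simg_sub1_shd[of w1] by (metis stream.sel(1))
  qed (use Cons(2) w in simp_all)
  then show ?case using Cons.IH w by fastforce
qed simp

lemma factors_sub1_iff:
  assumes "img sub1 l @ [True] \<in> factors (simg sub1 w)" shows "l \<in> factors w"
proof -
  obtain u r where e: "simg sub1 w = u @- (img sub1 l @ [True]) @- r" using assms by (auto simp: factors_def)
  have "\<exists>s. img sub1 l @- True ## r = True ## s"
  proof (cases l)
    case (Cons a l') then show ?thesis by (cases a) auto
  qed simp
  then obtain s where s: "img sub1 l @- True ## r = True ## s" by blast
  then have "simg sub1 w = u @- True ## s" using e by simp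
  from parse_sub1[OF this] obtain u' w' where 1: "w = u' @- w'" "True ## s = simg sub1 w'" by blast
  then obtain w'' where "w' = l @- w''" using img_sub1_inj[of l r w'] s by metis
  then show ?thesis using 1 unfolding factors_def by blast
qed

lemma parse_sub2:
  assumes "simg sub2 w = u @- False ## r"
  shows "\<exists>u' w'. w = u' @- w' \<and> u @ [False] = img sub2 u' \<and> r = simg sub2 w'"
  using assms
proof (induction u arbitrary: w rule: length_induct)
  case (1 u)
  obtain b w1 where w: "w = b ## w1" by (cases w)
  show ?case
  proof (cases b)
    case False
    then have e: "False ## simg sub2 w1 = u @- False ## r" using 1(2) w by simp
    show ?thesis
    proof (cases u)
      case Nil
      then have "w = [False] @- w1 \<and> u @ [False] = img sub2 [False] \<and> r = simg sub2 w1" using e w False by simp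
      then show ?thesis by blast
    next
      case (Cons a u1)
      then have "simg sub2 w1 = u1 @- False ## r" using e by simp
      then obtain u' w' where "w1 = u' @- w' \<and> u1 @ [False] = img sub2 u' \<and> r = simg sub2 w'"
        using 1(1) Cons by (metis length_Cons lessI)
      then have "w = (False # u') @- w' \<and> u @ [False] = img sub2 (False # u') \<and> r = simg sub2 w'"
        using w False Cons e by simp
      then show ?thesis by blast
    qed
  next
    case True
    then have e: "True ## False ## simg sub2 w1 = u @- False ## r" using 1(2) w by simp
    then obtain u1 where u1: "u = True # u1" by (cases u) auto
    show ?thesis
    proof (cases u1)
      case Nil
      then have "w = [True] @- w1 \<and> u @ [False] = img sub2 [True] \<and> r = simg sub2 w1" using e u1 w True by simp
      then show ?thesis by blast
    next
      case (Cons a u2)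
      then have "simg sub2 w1 = u2 @- False ## r" using e u1 by simp
      then obtain u' w' where "w1 = u' @- w' \<and> u2 @ [False] = img sub2 u' \<and> r = simg sub2 w'"
        using 1(1) Cons u1 by (metis length_Cons lessI less_SucI)
      then have "w = (True # u') @- w' \<and> u @ [False] = img sub2 (True # u') \<and> r = simg sub2 w'"
        using w True Cons e u1 by simp
      then show ?thesis by blast
    qed
  qed
qed

lemma img_sub2_inj:
  assumes "img sub2 l @- r = simg sub2 w"
  shows "\<exists>w'. w = l @- w'"
  using assms
proof (induction l arbitrary: w)
  case (Cons a l)
  obtain b w1 where w: "w = b ## w1" by (cases w)
  have "a = b \<and> img sub2 l @- r = simg sub2 w1"
    using Cons(2) w by (cases a; cases b) simp_all
  then show ?case using Cons.IH w by fastforce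
qed simp

lemma factors_sub2_iff:
  assumes "False # img sub2 l \<in> factors (simg sub2 w)" shows "l \<in> factors w"
proof -
  obtain u r where "simg sub2 w = u @- (False # img sub2 l) @- r" using assms by (auto simp: factors_def)
  then have "simg sub2 w = u @- False ## (img sub2 l @- r)" by simp
  from parse_sub2[OF this] obtain u' w' where 1: "w = u' @- w'" "img sub2 l @- r = simg sub2 w'" by blast
  then obtain w'' where "w' = l @- w''" using img_sub2_inj[of l r w'] by metis
  then show ?thesis using 1 unfolding factors_def by blast
qed

section \<open>Christoffel words\<close>

inductive_set christoffel :: "(bool list \<times> bool list) set" where
  base: "([True], [False]) \<in> christoffel"
| left: "(u, v) \<in> christoffel \<Longrightarrow> (u, u @ v) \<in> christoffel"
| right: "(u, v) \<in> christoffel \<Longrightarrow> (u @ v, v) \<in> christoffel"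

lemma christoffel_ne: "(u, v) \<in> christoffel \<Longrightarrow> u \<noteq> [] \<and> v \<noteq> []"
  by (induction rule: christoffel.induct) auto

lemma christoffel_sub1: "(u, v) \<in> christoffel \<Longrightarrow> (img sub1 u, img sub1 v) \<in> christoffel"
proof (induction rule: christoffel.induct)
  case base then show ?case using christoffel.left[OF christoffel.base] by simp
qed (auto intro: christoffel.intros)

lemma christoffel_sub2: "(u, v) \<in> christoffel \<Longrightarrow> (img sub2 u, img sub2 v) \<in> christoffel"
proof (induction rule: christoffel.induct)
  case base then show ?case using christoffel.right[OF christoffel.base] by simp
qed (auto intro: christoffel.intros)

text \<open>The same tree grown by substituting in both components instead of concatenating them.
  Concatenation suits the recurrences of traces, substitution suits the induction on bad
  factors.\<close>

inductive_set substitution_pairs :: "(bool list \<times> bool list) set" where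
  base: "([True], [False]) \<in> substitution_pairs"
| sub1: "(u, v) \<in> substitution_pairs \<Longrightarrow> (img sub1 u, img sub1 v) \<in> substitution_pairs"
| sub2: "(u, v) \<in> substitution_pairs \<Longrightarrow> (img sub2 u, img sub2 v) \<in> substitution_pairs"

lemma substitution_pairs_left: "(u, v) \<in> substitution_pairs \<Longrightarrow> (u, u @ v) \<in> substitution_pairs"
proof (induction rule: substitution_pairs.induct)
  case base then show ?case using substitution_pairs.sub1[OF substitution_pairs.base] by simp
next
  case (sub1 u v) then show ?case using substitution_pairs.sub1 by fastforce
next
  case (sub2 u v) then show ?case using substitution_pairs.sub2 by fastforce
qed

lemma substitution_pairs_right: "(u, v) \<in> substitution_pairs \<Longrightarrow> (u @ v, v) \<in> substitution_pairs"
proof (induction rule: substitution_pairs.induct)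
  case base then show ?case using substitution_pairs.sub2[OF substitution_pairs.base] by simp
next
  case (sub1 u v) then show ?case using substitution_pairs.sub1 by fastforce
next
  case (sub2 u v) then show ?case using substitution_pairs.sub2 by fastforce
qed

lemma christoffel_substitution: "(u, v) \<in> christoffel \<Longrightarrow> (u, v) \<in> substitution_pairs"
  by (induction rule: christoffel.induct)
    (auto intro: substitution_pairs.base substitution_pairs_left substitution_pairs_right)

definition christoffel_word :: "bool list \<Rightarrow> bool" where
  "christoffel_word c \<longleftrightarrow> (\<exists>u v. (u, v) \<in> christoffel \<and> c \<in> {u, v})"

lemma christoffel_word_ne: "christoffel_word c \<Longrightarrow> c \<noteq> []"
  unfolding christoffel_word_def using christoffel_ne by blast

lemma christoffel_word_sub1: "christoffel_word c \<Longrightarrow> christoffel_word (img sub1 c)"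
  unfolding christoffel_word_def using christoffel_sub1 by blast

lemma christoffel_word_sub2: "christoffel_word c \<Longrightarrow> christoffel_word (img sub2 c)"
  unfolding christoffel_word_def using christoffel_sub2 by blast

lemma christoffel_word_single: "christoffel_word [a]"
  unfolding christoffel_word_def using christoffel.base by (cases a) blast+

lemma markoff_set_sdrop: "markoff_set K (factors w) \<Longrightarrow> markoff_set K (factors (sdrop n w))"
  using factors_shift[of "sdrop n w" "stake n w"] unfolding markoff_set_def stake_sdrop by blast

lemma sdrop_two: "sdrop n w = [w !! n, w !! Suc n] @- sdrop (Suc (Suc n)) w"
  by (metis sdrop_simps shift.simps stream.collapse)

lemma two_factors: "[w !! n, w !! Suc n] \<in> factors (sdrop n w)"
proof -
  have "sdrop n w = [] @- [w !! n, w !! Suc n] @- sdrop (Suc (Suc n)) w" using sdrop_two[of n w] by simp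
  then show ?thesis unfolding factors_def by blast
qed

lemma factors_sdrop: "factors (sdrop n w) \<subseteq> factors w"
  using factors_shift[of "sdrop n w" "stake n w"] unfolding stake_sdrop .

text \<open>Desubstitution shortens undecided factors, which makes \<open>K\<close> an induction parameter.\<close>

lemma markoff_stream_periodic:
  assumes "markoff_set K (factors w)"
  shows "\<exists>p c. christoffel_word c \<and> w = p @- cycle c"
  using assms
proof (induction K arbitrary: w)
  case 0
  \<comment> \<open>For \<open>K = 0\<close> every seam is undecided with empty common part, so the
    stream has no seam and is constant.\<close>
  have no: "[s, \<not> s] \<notin> factors w" for s
  proof
    assume "[s, \<not> s] \<in> factors w"
    moreover have "undecided 0 [s, \<not> s]" unfolding undecided_def by (rule exI[of _ s], rule exI[of _ "[]"]) simp
    ultimately show False using 0 unfolding markoff_set_def by blast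
  qed
  have "w !! Suc n = w !! n" for n
  proof (rule ccontr)
    assume ne: "w !! Suc n \<noteq> w !! n"
    have "[w !! n, w !! Suc n] \<in> factors w" using two_factors factors_sdrop by blast
    then show False using no[of "w !! n"] ne by (cases "w !! n"; cases "w !! Suc n") auto
  qed
  then have c: "w !! n = shd w" for n by (induction n) (simp_all del: snth.simps(2))
  have "([shd w] @- w) !! n = shd w" for n
  proof (cases n)
    case (Suc k) then show ?thesis using c[of k] by simp
  qed simp
  then have "snth w = snth ([shd w] @- w)" using c by presburger
  then have "w = [shd w] @- w" by (metis stream_smap_nats)
  then have "w = [] @- cycle [shd w]" using cycle_eqI[of "[shd w]" w] by simp
  then show ?case using christoffel_word_single by blast
next
  case (Suc K)
  obtain n s where ns: "[s, s] \<notin> factors (sdrop n w)"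
    using eventually_no_square[of w] Suc.prems by (auto simp: markoff_set_def)
  have ntail: "[s, s] \<notin> factors (sdrop m w)" if "m \<ge> n" for m
  proof -
    have "sdrop m w = sdrop (m - n) (sdrop n w)" using that by simp
    then have "factors (sdrop m w) \<subseteq> factors (sdrop n w)"
      using factors_sdrop[of "m - n" "sdrop n w"] by (simp only:)
    then show ?thesis using ns by blast
  qed
  have "\<exists>m\<ge>n. w !! m = (\<not> s)"
  proof (rule ccontr)
    assume "\<not> ?thesis"
    then have "w !! n = s" "w !! Suc n = s" by (auto simp del: snth.simps(2))
    then show False using ns two_factors[of w n] by simp
  qed
  \<comment> \<open>The letter \<open>\<not> s\<close> marks a cut: for \<open>s = False\<close> an
    image starts at \<open>m\<close>, for \<open>s = True\<close> one ends there and the parse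
    begins at \<open>Suc m\<close>.\<close>
  then obtain m where m: "m \<ge> n" "w !! m = (\<not> s)" by blast
  show ?case
  proof (cases s)
    case False
    define P where "P v \<longleftrightarrow> shd v \<and> [False, False] \<notin> factors v" for v
    have "\<exists>v. sdrop m w = simg sub1 v"
    proof (rule ex_simg[of sub1 P])
      show "P (sdrop m w)" using m ntail[of m] False by (simp add: P_def)
      fix v assume P: "P v"
      then obtain b v' where v: "v = True ## b ## v'" unfolding P_def by (metis (full_types) stream.collapse)
      have sub: "[False, False] \<notin> factors (b ## v')" "[False, False] \<notin> factors v'"
        using P factors_shift[of "b ## v'" "[True]"] factors_shift[of v' "[True, b]"] by (auto simp: P_def v)
      show "\<exists>a w'. v = sub1 a @- w' \<and> P w'"
      proof (cases b)
        case True
        then have "v = sub1 True @- (b ## v') \<and> P (b ## v')" using v sub by (simp add: P_def)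
        then show ?thesis by blast
      next
        case False
        have "shd v'"
        proof (rule ccontr)
          assume "\<not> shd v'"
          then have "v = [True] @- [False, False] @- stl v'" using v False by (metis (full_types) shift.simps stream.collapse)
          then show False using P unfolding P_def factors_def by blast
        qed
        then have "v = sub1 False @- v' \<and> P v'" using v sub False by (simp add: P_def)
        then show ?thesis by blast
      qed
    qed simp
    then obtain v where v: "sdrop m w = simg sub1 v" by blast
    have "markoff_set K (factors v)"
      using markoff_set_desubstitute1[OF factorial_factors factors_sub1] markoff_set_sdrop[OF Suc.prems, of m] v by metis
    then obtain p c where c: "christoffel_word c" "v = p @- cycle c" using Suc.IH by blast
    have "sdrop m w = img sub1 p @- cycle (img sub1 c)"
      unfolding v c(2) using simg_shift[of sub1 p "cycle c"] simg_cycle[of sub1 c] christoffel_word_ne[OF c(1)] by simp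
    then have "w = (stake m w @ img sub1 p) @- cycle (img sub1 c)" by (metis shift_append stake_sdrop)
    then show ?thesis using christoffel_word_sub1[OF c(1)] by blast
  next
    case True
    define P where "P v \<longleftrightarrow> [True, True] \<notin> factors v" for v
    have "\<exists>v. sdrop (Suc m) w = simg sub2 v"
    proof (rule ex_simg[of sub2 P])
      show "P (sdrop (Suc m) w)" using m ntail[of "Suc m"] True by (simp add: P_def)
      fix v assume P: "P v"
      obtain a b v' where v: "v = a ## b ## v'" by (metis stream.collapse)
      have sub: "[True, True] \<notin> factors (b ## v')" "[True, True] \<notin> factors v'"
        using P factors_shift[of "b ## v'" "[a]"] factors_shift[of v' "[a, b]"] by (auto simp: P_def v)
      show "\<exists>a w'. v = sub2 a @- w' \<and> P w'"
      proof (cases a)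
        case False
        then have "v = sub2 False @- (b ## v') \<and> P (b ## v')" using v sub by (simp add: P_def)
        then show ?thesis by blast
      next
        case True
        have "\<not> b"
        proof
          assume b then have "v = [] @- [True, True] @- v'" using v True by simp
          then show False using P unfolding P_def factors_def by blast
        qed
        then have "v = sub2 True @- v' \<and> P v'" using v sub True by (simp add: P_def)
        then show ?thesis by blast
      qed
    qed simp
    then obtain v where v: "sdrop (Suc m) w = simg sub2 v" by blast
    have e: "sdrop m w = False ## simg sub2 v" using v m True by (metis (full_types) sdrop_simps stream.collapse)
    have "markoff_set K (factors v)"
    proof (rule markoff_set_desubstitute2[OF factorial_factors factors_sub2])
      show "markoff_set (Suc K) (factors (False ## simg sub2 v))" using markoff_set_sdrop[OF Suc.prems, of m] e by simp
    qed
    then obtain p c where c: "christoffel_word c" "v = p @- cycle c" using Suc.IH by blast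
    have "sdrop (Suc m) w = img sub2 p @- cycle (img sub2 c)"
      unfolding v c(2) using simg_shift[of sub2 p "cycle c"] simg_cycle[of sub2 c] christoffel_word_ne[OF c(1)] by simp
    then have "w = (stake (Suc m) w @ img sub2 p) @- cycle (img sub2 c)" by (metis shift_append stake_sdrop)
    then show ?thesis using christoffel_word_sub2[OF c(1)] by blast
  qed
qed

section \<open>Periodic Christoffel streams have no bad factors\<close>

lemma factors_cycle_Cons:
  assumes "c \<noteq> []" "l \<in> factors (cycle c)"
  shows "\<exists>a. a # l \<in> factors (cycle c)"
proof -
  obtain u r where "cycle c = u @- l @- r" using assms by (auto simp: factors_def)
  then have "cycle c = (c @ u) @- l @- r" using cycle_decomp[OF assms(1)] by simp
  moreover have "c @ u = butlast (c @ u) @ [last (c @ u)]" using assms(1) by (metis append_butlast_last_id append_is_Nil_conv)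
  ultimately have "cycle c = butlast (c @ u) @- (last (c @ u) # l) @- r"
    by (metis append_Cons append_Nil append_assoc shift_append)
  then show ?thesis unfolding factors_def by blast
qed

lemma simg_sub1_False:
  assumes "simg sub1 w = u @- False ## r" shows "shd r"
  using assms
proof (induction u arbitrary: w rule: length_induct)
  case (1 u)
  obtain b w1 where w: "w = b ## w1" by (cases w)
  show ?case
  proof (cases b)
    case True
    then have "True ## simg sub1 w1 = u @- False ## r" using 1(2) w by simp
    then obtain u1 where "u = True # u1" "simg sub1 w1 = u1 @- False ## r" by (cases u) auto
    then show ?thesis using 1(1) by auto
  next
    case False
    then have e: "True ## False ## simg sub1 w1 = u @- False ## r" using 1(2) w by simp
    then obtain u1 where u1: "u = True # u1" "False ## simg sub1 w1 = u1 @- False ## r" by (cases u) auto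
    show ?thesis
    proof (cases u1)
      case Nil then show ?thesis using u1 simg_sub1_shd[of w1] by simp
    next
      case (Cons a u2)
      then have "simg sub1 w1 = u2 @- False ## r" "length u2 < length u" using u1 by auto
      then show ?thesis using 1(1) by blast
    qed
  qed
qed

lemma simg_sub2_True:
  assumes "simg sub2 w = u @- True ## r" shows "\<not> shd r"
  using assms
proof (induction u arbitrary: w rule: length_induct)
  case (1 u)
  obtain b w1 where w: "w = b ## w1" by (cases w)
  show ?case
  proof (cases b)
    case False
    then have "False ## simg sub2 w1 = u @- True ## r" using 1(2) w by simp
    then obtain u1 where "u = False # u1" "simg sub2 w1 = u1 @- True ## r" by (cases u) auto
    then show ?thesis using 1(1) by auto
  next
    case True
    then have e: "True ## False ## simg sub2 w1 = u @- True ## r" using 1(2) w by simp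
    show ?thesis
    proof (cases u)
      case Nil then have "r = False ## simg sub2 w1" using e by simp
      then show ?thesis by simp
    next
      case (Cons a u1)
      then obtain u2 where u2: "u1 = False # u2" "simg sub2 w1 = u2 @- True ## r" using e by (cases u1) auto
      then have "length u2 < length u" using Cons by simp
      then show ?thesis using 1(1) u2 by blast
    qed
  qed
qed

lemma no_bad_cycle_sub1:
  assumes c: "c \<noteq> []" and bad: "\<And>l. l \<in> factors (cycle c) \<Longrightarrow> \<not> bad l"
    and l: "l \<in> factors (cycle (img sub1 c))"
  shows "\<not> bad l"
proof -
  have e: "cycle (img sub1 c) = simg sub1 (cycle c)" using simg_cycle[OF sub1_ne c] by simp
  have ne: "img sub1 c \<noteq> []" using c by (cases c) auto
  show ?thesis
  proof (rule no_bad_substitute1[OF factorial_factors _ factors_extend factors_cycle_Cons[OF ne] _ bad l])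
    show "[False, False] \<notin> factors (cycle (img sub1 c))"
    proof
      assume "[False, False] \<in> factors (cycle (img sub1 c))"
      then obtain u r where "simg sub1 (cycle c) = u @- False ## False ## r" unfolding e by (auto simp: factors_def)
      from simg_sub1_False[OF this] show False by simp
    qed
    show "l' \<in> factors (cycle c)" if "img sub1 l' @ [True] \<in> factors (cycle (img sub1 c))" for l'
      using factors_sub1_iff that e by metis
  qed
qed

lemma no_bad_cycle_sub2:
  assumes c: "c \<noteq> []" and bad: "\<And>l. l \<in> factors (cycle c) \<Longrightarrow> \<not> bad l"
    and l: "l \<in> factors (cycle (img sub2 c))"
  shows "\<not> bad l"
proof -
  have e: "cycle (img sub2 c) = simg sub2 (cycle c)" using simg_cycle[OF sub2_ne c] by simp
  have ne: "img sub2 c \<noteq> []" using c by (cases c) auto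
  show ?thesis
  proof (rule no_bad_substitute2[OF factorial_factors _ factors_extend factors_cycle_Cons[OF ne] _ bad l])
    show "[True, True] \<notin> factors (cycle (img sub2 c))"
    proof
      assume "[True, True] \<in> factors (cycle (img sub2 c))"
      then obtain u r where "simg sub2 (cycle c) = u @- True ## True ## r" unfolding e by (auto simp: factors_def)
      from simg_sub2_True[OF this] show False by simp
    qed
    show "l' \<in> factors (cycle c)" if "False # img sub2 l' \<in> factors (cycle (img sub2 c))" for l'
      using factors_sub2_iff that e by metis
  qed
qed

lemma no_bad_cycle_single:
  assumes "l \<in> factors (cycle [a])" shows "\<not> bad l"
proof -
  obtain u r where ur: "cycle [a] = u @- l @- r" using assms by (auto simp: factors_def)
  have "sset (cycle [a]) = {a}" by simp
  then have "sset (u @- l @- r) = {a}" unfolding ur .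
  then have "set u \<union> (set l \<union> sset r) = {a}" by (simp only: sset_shift)
  then have sub: "set l \<subseteq> {a}" by blast
  show ?thesis
  proof
    assume "bad l"
    then obtain s v where "l = s # rev v @ [s, \<not> s] @ v @ [\<not> s]" unfolding bad_def by blast
    then have "s \<in> set l" "(\<not> s) \<in> set l" by simp_all
    then have "s = a" "(\<not> s) = a" using sub by blast+
    then show False by blast
  qed
qed

text \<open>Both substitutions keep a periodic stream free of bad factors, so the induction follows
  \<open>substitution_pairs\<close>, whose root consists of constant streams.\<close>

lemma no_bad_cycle:
  assumes "christoffel_word c" "l \<in> factors (cycle c)"
  shows "\<not> bad l"
proof -
  have "u \<noteq> [] \<and> v \<noteq> [] \<and> (\<forall>l \<in> factors (cycle u) \<union> factors (cycle v). \<not> bad l)"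
    if "(u, v) \<in> substitution_pairs" for u v
    using that
  proof (induction rule: substitution_pairs.induct)
    case base
    have "\<forall>l \<in> factors (cycle [a]). \<not> bad l" for a using no_bad_cycle_single by blast
    then have "\<forall>l \<in> factors (cycle [True]) \<union> factors (cycle [False]). \<not> bad l"
      unfolding ball_Un by (intro conjI)
    then show ?case by blast
  next
    case (sub1 u v)
    moreover have "img sub1 u \<noteq> []" "img sub1 v \<noteq> []" using sub1 by (auto simp: neq_Nil_conv)
    moreover have "\<forall>l \<in> factors (cycle (img sub1 u)). \<not> bad l" using no_bad_cycle_sub1[of u] sub1 by blast
    moreover have "\<forall>l \<in> factors (cycle (img sub1 v)). \<not> bad l" using no_bad_cycle_sub1[of v] sub1 by blast
    ultimately show ?case by blast
  next
    case (sub2 u v)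
    moreover have "img sub2 u \<noteq> []" "img sub2 v \<noteq> []" using sub2 by (auto simp: neq_Nil_conv)
    moreover have "\<forall>l \<in> factors (cycle (img sub2 u)). \<not> bad l" using no_bad_cycle_sub2[of u] sub2 by blast
    moreover have "\<forall>l \<in> factors (cycle (img sub2 v)). \<not> bad l" using no_bad_cycle_sub2[of v] sub2 by blast
    ultimately show ?case by blast
  qed
  moreover obtain u v where "(u, v) \<in> substitution_pairs" "c \<in> {u, v}"
    using assms(1) christoffel_substitution unfolding christoffel_word_def by blast
  ultimately show ?thesis using assms(2) by blast
qed

section \<open>The Hecke group\<close>

datatype mat2 = Mat (m11: real) (m12: real) (m21: real) (m22: real)

instantiation mat2 :: monoid_mult
begin
definition "1 = Mat 1 0 0 1"
fun times_mat2 :: "mat2 \<Rightarrow> mat2 \<Rightarrow> mat2" where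
  "Mat a b c d * Mat a' b' c' d' =
    Mat (a * a' + b * c') (a * b' + b * d') (c * a' + d * c') (c * b' + d * d')"
instance
proof
  fix a b c :: mat2
  show "a * b * c = a * (b * c)" by (cases a; cases b; cases c) (simp add: algebra_simps)
  show "1 * a = a" "a * 1 = a" by (cases a; simp add: one_mat2_def)+
qed
end

lemma mat2_sel_times [simp]:
  "m11 (g * h) = m11 g * m11 h + m12 g * m21 h"
  "m12 (g * h) = m11 g * m12 h + m12 g * m22 h"
  "m21 (g * h) = m21 g * m11 h + m22 g * m21 h"
  "m22 (g * h) = m21 g * m12 h + m22 g * m22 h"
  by (cases g; cases h; simp)+

lemma mat2_sel_one [simp]: "m11 1 = 1" "m12 1 = 0" "m21 1 = 0" "m22 1 = 1"
  by (simp_all add: one_mat2_def)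

definition det2 :: "mat2 \<Rightarrow> real" where "det2 g = m11 g * m22 g - m12 g * m21 g"
definition tr2 :: "mat2 \<Rightarrow> real" where "tr2 g = m11 g + m22 g"
definition adj :: "mat2 \<Rightarrow> mat2" where "adj g = Mat (m22 g) (- m12 g) (- m21 g) (m11 g)"
definition neg :: "mat2 \<Rightarrow> mat2" where "neg g = Mat (- m11 g) (- m12 g) (- m21 g) (- m22 g)"

lemma adj_sel [simp]: "m11 (adj g) = m22 g" "m12 (adj g) = - m12 g" "m21 (adj g) = - m21 g" "m22 (adj g) = m11 g"
  by (simp_all add: adj_def)

lemma neg_sel [simp]: "m11 (neg g) = - m11 g" "m12 (neg g) = - m12 g" "m21 (neg g) = - m21 g" "m22 (neg g) = - m22 g"
  by (simp_all add: neg_def)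

lemma det2_one [simp]: "det2 1 = 1" by (simp add: det2_def)

lemma det2_mult: "det2 (g * h) = det2 g * det2 h"
  by (simp add: det2_def algebra_simps)

lemma det2_power: "det2 (g ^ n) = det2 g ^ n"
  by (induction n) (simp_all add: det2_mult)

lemma det2_adj [simp]: "det2 (adj g) = det2 g"
  by (simp add: det2_def)

lemma adj_right: "det2 g = 1 \<Longrightarrow> g * adj g = 1"
  by (rule mat2.expand) (simp add: det2_def algebra_simps)

lemma adj_left: "det2 g = 1 \<Longrightarrow> adj g * g = 1"
  by (rule mat2.expand) (simp add: det2_def algebra_simps)

lemma adj_mult: "adj (g * h) = adj h * adj g"
  by (rule mat2.expand) (simp add: algebra_simps)

lemma adj_adj [simp]: "adj (adj g) = g"
  by (rule mat2.expand) simp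

lemma adj_cancel: "det2 g = 1 \<Longrightarrow> g * (adj g * h) = h" "det2 g = 1 \<Longrightarrow> adj g * (g * h) = h"
  using adj_right[of g] adj_left[of g] by (simp_all flip: mult.assoc)

lemma tr2_commute: "tr2 (g * h) = tr2 (h * g)"
  by (simp add: tr2_def algebra_simps)

lemma tr2_conj: "det2 g = 1 \<Longrightarrow> tr2 (g * h * adj g) = tr2 h"
  by (metis adj_left mult.assoc mult.left_neutral tr2_commute)

text \<open>\<open>G0\<close> and \<open>G1\<close> are the two cosets of the even subgroup; the cusps \<open>m11 g / m21 g\<close> of \<open>G4\<close> are
  \<open>\<infinity>\<close> and the rational multiples of \<open>\<surd>2\<close>.\<close>

definition G0 :: "mat2 set" where
  "G0 = {g. det2 g = 1 \<and> (\<exists>a b c d :: int. g = Mat (of_int a) (of_int b * sqrt 2) (of_int c * sqrt 2) (of_int d))}"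
definition G1 :: "mat2 set" where
  "G1 = {g. det2 g = 1 \<and> (\<exists>a b c d :: int. g = Mat (of_int a * sqrt 2) (of_int b) (of_int c) (of_int d * sqrt 2))}"
definition G4 :: "mat2 set" where "G4 = G0 \<union> G1"

lemma sqrt2_mult: "sqrt 2 * sqrt 2 = (2::real)" "sqrt 2 * (sqrt 2 * x) = 2 * x"
proof -
  show "sqrt 2 * sqrt 2 = (2::real)" by simp
  then show "sqrt 2 * (sqrt 2 * x) = 2 * x" by (metis mult.assoc)
qed

lemma mult_sqrt2: "x * sqrt 2 * (y * sqrt 2) = (2::real) * (x * y)"
  using sqrt2_mult(1) by (metis (no_types, opaque_lifting) mult.assoc mult.commute)

lemma G_det: "g \<in> G0 \<Longrightarrow> det2 g = 1" "g \<in> G1 \<Longrightarrow> det2 g = 1" "g \<in> G4 \<Longrightarrow> det2 g = 1"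
  by (auto simp: G0_def G1_def G4_def)

lemma G_times:
  "g \<in> G0 \<Longrightarrow> h \<in> G0 \<Longrightarrow> g * h \<in> G0"
  "g \<in> G0 \<Longrightarrow> h \<in> G1 \<Longrightarrow> g * h \<in> G1"
  "g \<in> G1 \<Longrightarrow> h \<in> G0 \<Longrightarrow> g * h \<in> G1"
  "g \<in> G1 \<Longrightarrow> h \<in> G1 \<Longrightarrow> g * h \<in> G0"
proof -
  assume g: "g \<in> G0"
  then obtain a b c d :: int where ge: "g = Mat a (b * sqrt 2) (c * sqrt 2) d" by (auto simp: G0_def)
  show "g * h \<in> G0" if h: "h \<in> G0"
  proof -
    obtain a' b' c' d' :: int where "h = Mat a' (b' * sqrt 2) (c' * sqrt 2) d'" using h by (auto simp: G0_def)
    then have "g * h = Mat (of_int (a * a' + 2 * b * c')) (of_int (a * b' + b * d') * sqrt 2)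
        (of_int (c * a' + d * c') * sqrt 2) (of_int (2 * c * b' + d * d'))"
      by (simp add: ge mult_sqrt2) (simp add: algebra_simps)
    moreover have "det2 (g * h) = 1" using g h by (simp add: det2_mult G_det)
    ultimately show ?thesis unfolding G0_def by blast
  qed
  show "g * h \<in> G1" if h: "h \<in> G1"
  proof -
    obtain a' b' c' d' :: int where "h = Mat (a' * sqrt 2) b' c' (d' * sqrt 2)" using h by (auto simp: G1_def)
    then have "g * h = Mat (of_int (a * a' + b * c') * sqrt 2) (of_int (a * b' + 2 * b * d'))
        (of_int (2 * c * a' + d * c')) (of_int (c * b' + d * d') * sqrt 2)"
      by (simp add: ge mult_sqrt2) (simp add: algebra_simps)
    moreover have "det2 (g * h) = 1" using g h by (simp add: det2_mult G_det)
    ultimately show ?thesis unfolding G1_def by blast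
  qed
next
  assume g: "g \<in> G1"
  then obtain a b c d :: int where ge: "g = Mat (a * sqrt 2) b c (d * sqrt 2)" by (auto simp: G1_def)
  show "g * h \<in> G1" if h: "h \<in> G0"
  proof -
    obtain a' b' c' d' :: int where "h = Mat a' (b' * sqrt 2) (c' * sqrt 2) d'" using h by (auto simp: G0_def)
    then have "g * h = Mat (of_int (a * a' + b * c') * sqrt 2) (of_int (2 * a * b' + b * d'))
        (of_int (c * a' + 2 * d * c')) (of_int (c * b' + d * d') * sqrt 2)"
      by (simp add: ge mult_sqrt2) (simp add: algebra_simps)
    moreover have "det2 (g * h) = 1" using g h by (simp add: det2_mult G_det)
    ultimately show ?thesis unfolding G1_def by blast
  qed
  show "g * h \<in> G0" if h: "h \<in> G1"
  proof -
    obtain a' b' c' d' :: int where "h = Mat (a' * sqrt 2) b' c' (d' * sqrt 2)" using h by (auto simp: G1_def)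
    then have "g * h = Mat (of_int (2 * a * a' + b * c')) (of_int (a * b' + b * d') * sqrt 2)
        (of_int (c * a' + d * c') * sqrt 2) (of_int (c * b' + 2 * d * d'))"
      by (simp add: ge mult_sqrt2) (simp add: algebra_simps)
    moreover have "det2 (g * h) = 1" using g h by (simp add: det2_mult G_det)
    ultimately show ?thesis unfolding G0_def by blast
  qed
qed

lemma G4_times: "g \<in> G4 \<Longrightarrow> h \<in> G4 \<Longrightarrow> g * h \<in> G4"
  using G_times unfolding G4_def by blast

lemma G0_intro: "det2 g = 1 \<Longrightarrow> g = Mat (of_int a) (of_int b * sqrt 2) (of_int c * sqrt 2) (of_int d) \<Longrightarrow> g \<in> G0"
  unfolding G0_def by blast
lemma G1_intro: "det2 g = 1 \<Longrightarrow> g = Mat (of_int a * sqrt 2) (of_int b) (of_int c) (of_int d * sqrt 2) \<Longrightarrow> g \<in> G1"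
  unfolding G1_def by blast

lemma G_adj: "g \<in> G0 \<Longrightarrow> adj g \<in> G0" "g \<in> G1 \<Longrightarrow> adj g \<in> G1" "g \<in> G4 \<Longrightarrow> adj g \<in> G4"
proof -
  show 0: "adj g \<in> G0" if g: "g \<in> G0" for g
  proof -
    obtain a b c d :: int where "g = Mat a (b * sqrt 2) (c * sqrt 2) d" using g by (auto simp: G0_def)
    then have "adj g = Mat (of_int d) (of_int (- b) * sqrt 2) (of_int (- c) * sqrt 2) (of_int a)"
      by (simp add: adj_def)
    from G0_intro[OF _ this] show ?thesis using G_det(1)[OF g] by simp
  qed
  show 1: "adj g \<in> G1" if g: "g \<in> G1" for g
  proof -
    obtain a b c d :: int where "g = Mat (a * sqrt 2) b c (d * sqrt 2)" using g by (auto simp: G1_def)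
    then have "adj g = Mat (of_int d * sqrt 2) (of_int (- b)) (of_int (- c)) (of_int a * sqrt 2)"
      by (simp add: adj_def)
    from G1_intro[OF _ this] show ?thesis using G_det(2)[OF g] by simp
  qed
  show "g \<in> G4 \<Longrightarrow> adj g \<in> G4" using 0 1 by (auto simp: G4_def)
qed

lemma neg_one_G0: "neg 1 \<in> G0"
  by (rule G0_intro[of _ "-1" 0 0 "-1"]) (simp_all add: det2_def neg_def)

lemma neg_G4: "g \<in> G4 \<Longrightarrow> neg g \<in> G4"
proof -
  assume "g \<in> G4"
  then have "neg 1 * g \<in> G4" using neg_one_G0 by (intro G4_times) (simp_all add: G4_def)
  moreover have "neg 1 * g = neg g" by (rule mat2.expand) simp
  ultimately show ?thesis by simp
qed

lemma G4_one: "1 \<in> G4"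
  unfolding G4_def using G0_intro[of 1 1 0 0 1] by (simp add: one_mat2_def det2_def)

lemma G4_power: "g \<in> G4 \<Longrightarrow> g ^ n \<in> G4"
  by (induction n) (auto intro: G4_one G4_times)

lemma G0_conj: "g \<in> G4 \<Longrightarrow> h \<in> G0 \<Longrightarrow> adj g * h * g \<in> G0"
proof -
  assume "g \<in> G4" "h \<in> G0"
  then show ?thesis unfolding G4_def
    by (elim UnE) (auto intro: G_times(1)[OF G_times(1)] G_times(4)[OF G_times(3)] G_adj)
qed

lemma G1_conj: "g \<in> G4 \<Longrightarrow> h \<in> G1 \<Longrightarrow> adj g * h * g \<in> G1"
proof -
  assume "g \<in> G4" "h \<in> G1"
  then show ?thesis unfolding G4_def
    by (elim UnE) (auto intro: G_times(3)[OF G_times(2)] G_times(2)[OF G_times(4)] G_adj)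
qed

text \<open>Multiplication by \<open>Rot\<close> on the right exchanges the columns up to sign, so
  that the second end point of an edge can also be treated as the cusp of a matrix.\<close>

definition Rot :: mat2 where "Rot = Mat 0 (-1) 1 0"

lemma Rot_G4: "Rot \<in> G4"
  unfolding G4_def using G1_intro[of Rot 0 "-1" 1 0] by (simp add: Rot_def det2_def)

lemma G4_entry_cases:
  assumes "g \<in> G4" "e \<in> {m11 g, m12 g, m21 g, m22 g}"
  shows "\<exists>n :: int. e = of_int n \<or> e = of_int n * sqrt 2"
proof -
  obtain a b c d :: int where
    "g = Mat a (b * sqrt 2) (c * sqrt 2) d \<or> g = Mat (a * sqrt 2) b c (d * sqrt 2)"
    using assms(1) unfolding G4_def G0_def G1_def by blast
  then have "e \<in> of_int ` {a, b, c, d} \<or> e \<in> (\<lambda>n. of_int n * sqrt 2) ` {a, b, c, d}"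
    using assms(2) by (elim disjE) auto
  then show ?thesis by blast
qed

lemma sqrt2_gt_1: "sqrt 2 > (1::real)" by simp

lemma G4_entry_ge_1:
  assumes "g \<in> G4" "e \<in> {m11 g, m12 g, m21 g, m22 g}" "e > 0"
  shows "e \<ge> 1"
proof -
  obtain n :: int where n: "e = of_int n \<or> e = of_int n * sqrt 2" using G4_entry_cases[OF assms(1,2)] by blast
  then have "0 < n" using assms(3) by (auto simp: zero_less_mult_iff)
  then have n1: "1 \<le> real_of_int n" by linarith
  then have "1 * 1 \<le> real_of_int n * sqrt 2" by (intro mult_mono) auto
  then show ?thesis using n n1 by auto
qed

text \<open>The columns of \<open>g\<close> are the end points of an edge of the tessellation, and those of \<open>g * turn t\<close> span one of the
  three other edges of the square next to it.\<close>

definition turn :: "int \<Rightarrow> mat2" where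
  "turn t = (if t = 1 then Mat 1 (sqrt 2) 0 1 else if t = -1 then Mat 1 0 (sqrt 2) 1 else Mat (sqrt 2) 1 1 (sqrt 2))"

lemma turn_simps: "turn 1 = Mat 1 (sqrt 2) 0 1" "turn (-1) = Mat 1 0 (sqrt 2) 1" "turn 0 = Mat (sqrt 2) 1 1 (sqrt 2)"
  by (simp_all add: turn_def)

lemma turn_G4: "turn t \<in> G4"
proof -
  have "Mat 1 (sqrt 2) 0 1 \<in> G0" by (rule G0_intro[of _ 1 1 0 1]) (simp_all add: det2_def)
  moreover have "Mat 1 0 (sqrt 2) 1 \<in> G0" by (rule G0_intro[of _ 1 0 1 1]) (simp_all add: det2_def)
  moreover have "Mat (sqrt 2) 1 1 (sqrt 2) \<in> G1" by (rule G1_intro[of _ 1 1 1 1]) (simp_all add: det2_def)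
  ultimately show ?thesis unfolding turn_def G4_def by simp
qed

text \<open>When the levels of a path are coded by letters, the frames make the product of turns telescope into a
  product with one fixed matrix for each letter, see \<open>turn_frame\<close>.\<close>

definition letter :: "bool \<Rightarrow> mat2" where
  "letter b = (if b then Mat (2 * sqrt 2) 1 (-1) 0 else Mat (sqrt 2) 1 1 (sqrt 2))"

lemma letter_G1: "letter b \<in> G1"
proof -
  have "Mat (2 * sqrt 2) 1 (-1) 0 \<in> G1" by (rule G1_intro[of _ 2 1 "-1" 0]) (simp_all add: det2_def)
  moreover have "Mat (sqrt 2) 1 1 (sqrt 2) \<in> G1" by (rule G1_intro[of _ 1 1 1 1]) (simp_all add: det2_def)
  ultimately show ?thesis unfolding letter_def by simp
qed

text \<open>As long as the letter does not change the path goes straight: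
  \<open>letter False\<close> is \<open>turn 0\<close>, and \<open>letter True\<close> is its
  conjugate by \<open>kappa\<close>.\<close>

definition kappa :: mat2 where "kappa = Mat (sqrt 2) 1 (-1) 0"

lemma kappa_G4: "kappa \<in> G4"
  unfolding G4_def using G1_intro[of kappa 1 1 "-1" 0] by (simp add: kappa_def det2_def)

definition frame :: "bool \<Rightarrow> mat2" where "frame b = (if b then adj kappa else 1)"

lemma frame_G4: "frame b \<in> G4"
  by (simp add: frame_def G4_one G_adj kappa_G4)

lemma turn_frame: "turn (of_bool b' - of_bool b) * frame b' = frame b * letter b"
  by (cases b; cases b') (simp_all add: turn_def frame_def letter_def kappa_def adj_def one_mat2_def)

definition word_mat :: "bool list \<Rightarrow> mat2" where
  "word_mat c = prod_list (map letter c)"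

lemma word_mat_append: "word_mat (u @ v) = word_mat u * word_mat v"
  by (simp add: word_mat_def)

lemma G4_column_ne:
  assumes "g \<in> G4" "z / sqrt 2 \<notin> \<rat>"
  shows "m11 g - m21 g * z \<noteq> 0" "m12 g - m22 g * z \<noteq> 0"
proof -
  have r: "m11 g - m21 g * z \<noteq> 0" if g: "g \<in> G4" for g
  proof
    assume 0: "m11 g - m21 g * z = 0"
    have q: "m21 g \<noteq> 0" using 0 G_det(3)[OF g] by (auto simp: det2_def)
    have "\<exists>a c :: int. z = of_int a / of_int c * sqrt 2"
    proof -
      have z: "z = m11 g / m21 g" using 0 q by (simp add: field_simps)
      consider "g \<in> G0" | "g \<in> G1" using g by (auto simp: G4_def)
      then show ?thesis
      proof cases
        case 1
        then obtain a b c d :: int where "g = Mat a (b * sqrt 2) (c * sqrt 2) d" by (auto simp: G0_def)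
        then have "z = of_int a / (of_int c * sqrt 2)" using z by simp
        also have "\<dots> = of_int a / of_int (2 * c) * sqrt 2"
          by (cases "c = 0") (simp_all add: field_simps)
        finally have "z = of_int a / of_int (2 * c) * sqrt 2" .
        then show ?thesis by blast
      next
        case 2
        then obtain a b c d :: int where "g = Mat (a * sqrt 2) b c (d * sqrt 2)" by (auto simp: G1_def)
        then show ?thesis using z by auto
      qed
    qed
    then obtain a c :: int where "z = of_int a / of_int c * sqrt 2" by blast
    then have "z / sqrt 2 = of_int a / of_int c" by simp
    then show False using assms(2) by simp
  qed
  show "m11 g - m21 g * z \<noteq> 0" using r assms by blast
  have "m11 (g * Rot) - m21 (g * Rot) * z \<noteq> 0" using r G4_times[OF assms(1) Rot_G4] by blast
  then show "m12 g - m22 g * z \<noteq> 0" by (simp add: Rot_def)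
qed

text \<open>For a cusp \<open>p / q = m11 g / m21 g\<close> this is \<open>q\<^sup>2 \<bar>z - p / q\<bar>\<close>.\<close>

definition appr :: "real \<Rightarrow> mat2 \<Rightarrow> real" where
  "appr z g = \<bar>m21 g * (m11 g - m21 g * z)\<bar>"

text \<open>An upper bound for a limit superior over cusps with growing denominators, written out.
  The factor \<open>sqrt 2\<close> is the one that appears in \<open>height_dist\<close>; it puts
  \<open>L\<close> on the scale of the Lagrange number.\<close>

definition approx_bound :: "real \<Rightarrow> real \<Rightarrow> bool" where
  "approx_bound z L \<longleftrightarrow> (\<forall>\<epsilon>>0. \<exists>Q. \<forall>g\<in>G4. \<bar>m21 g\<bar> \<ge> Q \<longrightarrow> 1 / (sqrt 2 * appr z g) \<le> L + \<epsilon>)"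

text \<open>The value at the cusp of \<open>g\<close> of the quadratic form whose roots are the fixed points of \<open>T\<close>.\<close>

definition formval :: "mat2 \<Rightarrow> mat2 \<Rightarrow> real" where
  "formval T g = m21 (adj g * T * g)"

lemma formval_conj: "det2 h = 1 \<Longrightarrow> formval (h * T * adj h) (h * g) = formval T g"
  by (simp add: formval_def adj_mult mult.assoc adj_cancel del: mat2_sel_times adj_sel)

lemma formval_invariant: "det2 T = 1 \<Longrightarrow> formval T (T * g) = formval T g"
  by (simp add: formval_def adj_mult mult.assoc adj_cancel del: mat2_sel_times adj_sel)

lemma G4_entry_abs_ge_1:
  assumes "g \<in> G4" "e \<in> {m11 g, m12 g, m21 g, m22 g}" "e \<noteq> 0"
  shows "\<bar>e\<bar> \<ge> 1"
proof (cases "e > 0")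
  case True then show ?thesis using G4_entry_ge_1[OF assms(1,2)] by simp
next
  case False
  then have "- e \<ge> 1" using assms(2,3) by (intro G4_entry_ge_1[OF neg_G4[OF assms(1)]]) auto
  then show ?thesis by simp
qed

text \<open>If \<open>m21 T\<close> vanished, the diagonal entries would be inverse to each other
  and, being nonzero entries of an element of \<open>G4\<close>, at least 1 in absolute value. That
  leaves at most 2 for the trace. In other words, such a \<open>T\<close> does not fix
  infinity.\<close>

lemma trace_gt_2_m21:
  assumes "T \<in> G4" "\<bar>tr2 T\<bar> > 2" shows "m21 T \<noteq> 0"
proof
  assume c: "m21 T = 0"
  have det: "m11 T * m22 T = 1" using G_det(3)[OF assms(1)] c by (simp add: det2_def)
  then have "m11 T \<noteq> 0" "m22 T \<noteq> 0" by auto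
  then have 1: "\<bar>m11 T\<bar> \<ge> 1" "\<bar>m22 T\<bar> \<ge> 1" using G4_entry_abs_ge_1[OF assms(1)] by auto
  have p: "\<bar>m11 T\<bar> * \<bar>m22 T\<bar> = 1" using det by (metis abs_mult abs_one)
  have "(\<bar>m11 T\<bar> - 1) * (\<bar>m22 T\<bar> - 1) \<ge> 0" using 1 by simp
  then have "\<bar>m11 T\<bar> + \<bar>m22 T\<bar> \<le> 2" using p by (simp add: algebra_simps)
  then show False using assms(2) by (simp add: tr2_def)
qed

lemma appr_pos:
  assumes "g \<in> G4" "z / sqrt 2 \<notin> \<rat>" "m21 g \<noteq> 0" shows "appr z g > 0"
  using G4_column_ne(1)[OF assms(1,2)] assms(3) by (simp add: appr_def)

section \<open>Approximation constants of fixed points\<close>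

text \<open>Here \<open>m\<close> is at once the normalized trace of \<open>T\<close> and, up to
  sign, the value of its form at the cusp of \<open>g0\<close>. This coincidence produces the
  constant: the trace gives the discriminant, the value at the cusp the quality of the best
  approximations.\<close>

locale fixed_point =
  fixes T :: mat2 and z m :: real and g0 :: mat2
  assumes T: "T \<in> G0 \<or> T \<in> G1" and tr: "tr2 T = 2 * sqrt 2 * m" and m1: "m \<ge> 1"
    and g0: "g0 \<in> G4" "\<bar>formval T g0\<bar> = m"
    and irr: "z / sqrt 2 \<notin> \<rat>"
    and fix_z: "m21 T * z\<^sup>2 + (m22 T - m11 T) * z - m12 T = 0"
begin

definition disc_root :: real where "disc_root = sqrt (8 * m\<^sup>2 - 4)"

text \<open>The conjugate root; \<open>lin\<close> and \<open>linc\<close> are the linear factors of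
  the form, evaluated at the cusp of \<open>g\<close>.\<close>

abbreviation "zc \<equiv> (m11 T - m22 T) / m21 T - z"
abbreviation "lin g \<equiv> m11 g - m21 g * z"
abbreviation "linc g \<equiv> m11 g - m21 g * zc"

lemma TG4: "T \<in> G4" using T by (auto simp: G4_def)

lemma tr_gt: "tr2 T > 2"
proof -
  have "2 * 1 < (2 * sqrt 2) * (1::real)" by simp
  also have "\<dots> \<le> 2 * sqrt 2 * m" using m1 by (intro mult_left_mono) auto
  finally show ?thesis using tr by simp
qed

lemma c0: "m21 T \<noteq> 0" using trace_gt_2_m21[OF TG4] tr_gt by simp

lemma detT: "m11 T * m22 T - m12 T * m21 T = 1" using G_det(3)[OF TG4] by (simp add: det2_def)

lemma b_eq: "m12 T = m21 T * z\<^sup>2 + (m22 T - m11 T) * z" using fix_z by simp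

lemma form_factor: "formval T g = m21 T * (lin g * linc g)"
proof -
  have "m21 T * (lin g * linc g) = lin g * (m21 T * m11 g - m21 g * (m21 T * zc))"
    by (simp add: algebra_simps)
  also have "m21 T * zc = m11 T - m22 T - m21 T * z" using c0 by (simp add: field_simps)
  also have "lin g * (m21 T * m11 g - m21 g * (m11 T - m22 T - m21 T * z))
    = m21 T * (m11 g)\<^sup>2 + (m22 T - m11 T) * m11 g * m21 g - (m21 T * z\<^sup>2 + (m22 T - m11 T) * z) * (m21 g)\<^sup>2"
    by (simp add: algebra_simps power2_eq_square)
  also have "\<dots> = formval T g"
    unfolding b_eq[symmetric] by (simp add: formval_def algebra_simps power2_eq_square)
  finally show ?thesis by simp
qed

lemma m_sq: "8 * m\<^sup>2 - 4 \<ge> 4"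
  using mult_mono[OF m1 m1] m1 by (simp add: power2_eq_square)

lemma disc_root_pos: "disc_root > 0" unfolding disc_root_def using m_sq by (intro real_sqrt_gt_zero) linarith

text \<open>The discriminant of the form is the squared trace minus 4, which is
  \<open>8 * m\<^sup>2 - 4\<close>.\<close>

lemma disc_root_diff: "\<bar>m21 T\<bar> * \<bar>z - zc\<bar> = disc_root"
proof -
  have "m21 T * (z - zc) = 2 * m21 T * z - (m11 T - m22 T)" using c0 by (simp add: field_simps)
  then have "(m21 T * (z - zc))\<^sup>2 = (2 * m21 T * z - (m11 T - m22 T))\<^sup>2" by simp
  also have "\<dots> = (m11 T - m22 T)\<^sup>2 + 4 * m21 T * (m21 T * z\<^sup>2 + (m22 T - m11 T) * z)"
    by (simp add: algebra_simps power2_eq_square)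
  also have "\<dots> = (tr2 T)\<^sup>2 - 4 * (m11 T * m22 T - m12 T * m21 T)"
    unfolding b_eq[symmetric] by (simp add: tr2_def algebra_simps power2_eq_square)
  also have "\<dots> = 8 * m\<^sup>2 - 4" unfolding detT tr by (simp add: power2_eq_square)
  finally have "(m21 T * (z - zc))\<^sup>2 = 8 * m\<^sup>2 - 4" .
  then have "\<bar>m21 T * (z - zc)\<bar> = disc_root" unfolding disc_root_def by (metis real_sqrt_abs)
  then show ?thesis by (simp only: abs_mult)
qed

text \<open>The denominator can be read off the linear factors, as \<open>linc g - lin g\<close> is
  \<open>m21 g * (z - zc)\<close>. So once \<open>lin g\<close> is small, \<open>appr\<close> is
  governed by the value of the form.\<close>

lemma appr_eq: "appr z g = \<bar>formval T g - m21 T * (lin g)\<^sup>2\<bar> / disc_root"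
proof -
  have "formval T g - m21 T * (lin g)\<^sup>2 = m21 T * lin g * (linc g - lin g)"
    unfolding form_factor by (simp add: algebra_simps power2_eq_square)
  also have "linc g - lin g = m21 g * (z - zc)" by (simp add: algebra_simps)
  finally have "\<bar>formval T g - m21 T * (lin g)\<^sup>2\<bar> = (\<bar>m21 T\<bar> * \<bar>z - zc\<bar>) * appr z g"
    by (simp add: appr_def abs_mult)
  then show ?thesis unfolding disc_root_diff using disc_root_pos by simp
qed

abbreviation "Lval \<equiv> sqrt (4 - 2 / m\<^sup>2)"

lemma Lval_eq: "Lval = disc_root / (sqrt 2 * m)"
proof -
  have "disc_root / (sqrt 2 * m) = sqrt ((8 * m\<^sup>2 - 4) / (2 * m\<^sup>2))"
    unfolding disc_root_def using m1 by (simp add: real_sqrt_divide real_sqrt_mult)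
  also have "(8 * m\<^sup>2 - 4) / (2 * m\<^sup>2) = 4 - 2 / m\<^sup>2" using m1 by (simp add: field_simps)
  finally show ?thesis by simp
qed

lemma Lval_ge: "Lval \<ge> 1"
proof -
  have "m\<^sup>2 \<ge> 1" using m1 by simp
  then have "2 / m\<^sup>2 \<le> 2" by (simp add: divide_simps)
  then show ?thesis by (intro real_le_rsqrt) simp
qed

text \<open>The cusps of \<open>T ^ k * g0\<close> all have form value \<open>m\<close> up to sign,
  their \<open>lin\<close> tends to 0 and their denominators grow. By \<open>appr_eq\<close> their
  constants tend to \<open>Lval\<close>, so no smaller bound can hold.\<close>

lemma not_approx_bound:
  assumes mu: "\<bar>m11 T - m21 T * z\<bar> < 1" and L: "0 \<le> L" "L < Lval"
  shows "\<not> approx_bound z L"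
proof
  assume "approx_bound z L"
  define \<epsilon> where "\<epsilon> = (Lval - L) / 2"
  have \<epsilon>: "\<epsilon> > 0" "L + \<epsilon> < Lval" using L by (auto simp: \<epsilon>_def field_simps)
  then obtain Q where Q: "\<And>g. g \<in> G4 \<Longrightarrow> \<bar>m21 g\<bar> \<ge> Q \<Longrightarrow> 1 / (sqrt 2 * appr z g) \<le> L + \<epsilon>"
    using \<open>approx_bound z L\<close> unfolding approx_bound_def by blast
  \<comment> \<open>The eigenvalues \<open>mu\<close> and \<open>mu'\<close> of \<open>T\<close> are
    the factors by which \<open>T\<close> multiplies \<open>lin\<close> and
    \<open>linc\<close>.\<close>
  define mu where "mu = m11 T - m21 T * z"
  define mu' where "mu' = m11 T - m21 T * zc"
  have mu': "mu' = m22 T + m21 T * z" unfolding mu'_def using c0 by (simp add: field_simps)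
  have mm: "mu * mu' = 1"
  proof -
    have "mu * mu' = m11 T * m22 T - (m21 T * z\<^sup>2 + (m22 T - m11 T) * z) * m21 T"
      unfolding mu' mu_def by (simp add: algebra_simps power2_eq_square)
    then show ?thesis unfolding b_eq[symmetric] using detT by (simp add: mult.commute)
  qed
  have step: "lin (T * g) = mu * lin g" for g
  proof -
    have "lin (T * g) - mu * lin g = - m21 g * (m21 T * z\<^sup>2 + (m22 T - m11 T) * z - m12 T)"
      by (simp add: mu_def algebra_simps power2_eq_square)
    then show ?thesis using fix_z by simp
  qed
  have step': "linc (T * g) = mu' * linc g" for g
  proof -
    have "m21 T * linc (T * g) = m21 T * (mu' * linc g)"
    proof -
      have "mu \<noteq> 0" using mm by auto
      have e: "m21 T * (lin (T * g) * linc (T * g)) = m21 T * (lin g * linc g)"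
        using formval_invariant[OF G_det(3)[OF TG4], of g] unfolding form_factor .
      show ?thesis
      proof -
        have d: "linc h - lin h = m21 h * (z - zc)" for h by (simp add: algebra_simps)
        have zz: "m21 T * zc = m11 T - m22 T - m21 T * z" using c0 by (simp add: field_simps)
        have ring: "c * (p - q * w) = c * p - q * (c * w)" for c p q w :: real by (simp add: algebra_simps)
        have "m21 T * linc (T * g) = m21 T * m11 (T * g) - m21 (T * g) * (m21 T * zc)" by (rule ring)
        also have "\<dots> = m21 T * (m11 T * m11 g + m12 T * m21 g) - (m21 T * m11 g + m22 T * m21 g) * (m11 T - m22 T - m21 T * z)"
          unfolding zz by simp
        also have "\<dots> = (m22 T + m21 T * z) * (m21 T * m11 g - m21 g * (m11 T - m22 T - m21 T * z))
            - m21 T * m21 g * (m21 T * z\<^sup>2 + (m22 T - m11 T) * z - m12 T)"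
          by (simp add: algebra_simps power2_eq_square)
        also have "\<dots> = mu' * (m21 T * m11 g - m21 g * (m21 T * zc))" unfolding fix_z zz mu' by simp
        also have "\<dots> = mu' * (m21 T * linc g)" by (simp only: ring)
        finally show ?thesis by (simp only: mult.left_commute)
      qed
    qed
    then show ?thesis using c0 by simp
  qed
  define G where "G k = T ^ k * g0" for k
  have GSuc: "G (Suc k) = T * G k" for k by (simp add: G_def mult.assoc)
  have GG: "G k \<in> G4" for k unfolding G_def by (intro G4_times G4_power TG4 g0)
  have l: "lin (G k) = mu ^ k * lin g0" for k
    by (induction k) (simp add: G_def, simp only: GSuc step power_Suc mult.assoc)
  have l': "linc (G k) = mu' ^ k * linc g0" for k
    by (induction k) (simp add: G_def, simp only: GSuc step' power_Suc mult.assoc)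
  have F: "\<bar>formval T (G k)\<bar> = m" for k
    by (induction k) (simp add: G_def g0, simp only: GSuc formval_invariant[OF G_det(3)[OF TG4]])
  have ne: "linc g0 \<noteq> 0" using g0(2) m1 unfolding form_factor by auto
  have mu1: "\<bar>mu\<bar> < 1" using mu by (simp add: mu_def)
  have mu'1: "\<bar>mu'\<bar> > 1"
  proof (rule ccontr)
    assume "\<not> \<bar>mu'\<bar> > 1"
    then have "\<bar>mu\<bar> * \<bar>mu'\<bar> \<le> \<bar>mu\<bar> * 1" by (intro mult_left_mono) auto
    then show False using mm mu1 by (simp flip: abs_mult)
  qed
  have lim0: "(\<lambda>k. lin (G k)) \<longlonglongrightarrow> 0"
    unfolding l using LIMSEQ_abs_realpow_zero2[OF mu1] by (rule tendsto_mult_left_zero)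
  have "(\<lambda>k. disc_root / (sqrt 2 * (m + \<bar>m21 T\<bar> * (lin (G k))\<^sup>2))) \<longlonglongrightarrow> disc_root / (sqrt 2 * (m + \<bar>m21 T\<bar> * 0\<^sup>2))"
    by (intro tendsto_intros lim0) (use m1 in simp)
  then have "(\<lambda>k. disc_root / (sqrt 2 * (m + \<bar>m21 T\<bar> * (lin (G k))\<^sup>2))) \<longlonglongrightarrow> Lval" unfolding Lval_eq by simp
  then have ev1: "\<forall>\<^sub>F k in sequentially. L + \<epsilon> < disc_root / (sqrt 2 * (m + \<bar>m21 T\<bar> * (lin (G k))\<^sup>2))"
    using \<epsilon>(2) by (rule order_tendstoD(1))
  have ev2: "\<forall>\<^sub>F k in sequentially. \<bar>lin (G k)\<bar> < 1"
    using lim0 by (intro order_tendstoD(2)[of _ 0]) (auto intro: tendsto_rabs_zero)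
  \<comment> \<open>Chosen such that \<open>\<bar>mu'\<bar> ^ k > W\<close> makes
    \<open>linc (G k)\<close> large enough to push the denominator above
    \<open>\<bar>Q\<bar> + 1\<close>.\<close>
  define W where "W = (1 + (\<bar>Q\<bar> + 1) * \<bar>z - zc\<bar>) / \<bar>linc g0\<bar>"
  have "\<exists>n. W < \<bar>mu'\<bar> ^ n" using mu'1 by (rule real_arch_pow)
  then obtain n0 where n0: "W < \<bar>mu'\<bar> ^ n0" by blast
  have ev3: "\<forall>\<^sub>F k in sequentially. k \<ge> n0" by (rule eventually_ge_at_top)
  from eventually_happens[OF eventually_conj[OF ev1 eventually_conj[OF ev2 ev3]]]
  obtain k where k: "L + \<epsilon> < disc_root / (sqrt 2 * (m + \<bar>m21 T\<bar> * (lin (G k))\<^sup>2))" "\<bar>lin (G k)\<bar> < 1" "k \<ge> n0"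
    by auto
  have "\<bar>mu'\<bar> ^ n0 \<le> \<bar>mu'\<bar> ^ k" using mu'1 k(3) by (intro power_increasing) auto
  then have "W < \<bar>mu'\<bar> ^ k" using n0 by linarith
  then have "1 + (\<bar>Q\<bar> + 1) * \<bar>z - zc\<bar> < \<bar>linc (G k)\<bar>"
    unfolding W_def l' using ne by (simp add: abs_mult power_abs divide_less_eq)
  moreover have "\<bar>m21 (G k)\<bar> * \<bar>z - zc\<bar> \<ge> \<bar>linc (G k)\<bar> - \<bar>lin (G k)\<bar>"
  proof -
    have "linc (G k) - lin (G k) = m21 (G k) * (z - zc)" by (simp add: algebra_simps)
    then have "\<bar>m21 (G k)\<bar> * \<bar>z - zc\<bar> = \<bar>linc (G k) - lin (G k)\<bar>" by (simp add: abs_mult)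
    then show ?thesis by linarith
  qed
  ultimately have "(\<bar>Q\<bar> + 1) * \<bar>z - zc\<bar> < \<bar>m21 (G k)\<bar> * \<bar>z - zc\<bar>" using k(2) by linarith
  then have q: "\<bar>Q\<bar> + 1 < \<bar>m21 (G k)\<bar>" by (simp add: mult_less_cancel_right)
  then have bound: "1 / (sqrt 2 * appr z (G k)) \<le> L + \<epsilon>" using Q[OF GG] by simp
  have ap: "appr z (G k) > 0" by (rule appr_pos[OF GG irr]) (use q in auto)
  have "appr z (G k) \<le> (m + \<bar>m21 T\<bar> * (lin (G k))\<^sup>2) / disc_root"
    unfolding appr_eq
  proof (rule divide_right_mono)
    have "\<bar>formval T (G k) - m21 T * (lin (G k))\<^sup>2\<bar> \<le> \<bar>formval T (G k)\<bar> + \<bar>m21 T * (lin (G k))\<^sup>2\<bar>" by (rule abs_triangle_ineq4)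
    then show "\<bar>formval T (G k) - m21 T * (lin (G k))\<^sup>2\<bar> \<le> m + \<bar>m21 T\<bar> * (lin (G k))\<^sup>2"
      unfolding F by (simp add: abs_mult)
  qed (use disc_root_pos in simp)
  then have "sqrt 2 * appr z (G k) \<le> sqrt 2 * ((m + \<bar>m21 T\<bar> * (lin (G k))\<^sup>2) / disc_root)" by (intro mult_left_mono) auto
  then have "1 / (sqrt 2 * ((m + \<bar>m21 T\<bar> * (lin (G k))\<^sup>2) / disc_root)) \<le> 1 / (sqrt 2 * appr z (G k))"
    using ap by (intro divide_left_mono) (auto intro!: mult_pos_pos divide_pos_pos add_pos_nonneg disc_root_pos simp: m1 less_le_trans[OF zero_less_one m1])
  then show False using k(1) bound by simp
qed

text \<open>By discreteness, a value below \<open>m\<close> is so much smaller that the corresponding cusp would approximate \<open>z\<close> with a constant above 2.\<close>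

lemma unit_gap:
  obtains u where "u > 0" "8 * (m - u)\<^sup>2 < 8 * m\<^sup>2 - 4" "u \<le> m"
    "\<And>g. g \<in> G4 \<Longrightarrow> \<bar>formval T g\<bar> < m \<Longrightarrow> \<bar>formval T g\<bar> \<le> m - u"
  using T
proof
  assume T0: "T \<in> G0"
  have I: "\<exists>n :: int. \<bar>formval T g\<bar> = of_int n * sqrt 2" if g: "g \<in> G4" for g
  proof -
    have "adj g * T * g \<in> G0" by (rule G0_conj[OF g T0])
    then obtain a b n d :: int where "adj g * T * g = Mat a (b * sqrt 2) (n * sqrt 2) d" unfolding G0_def by blast
    then have "formval T g = of_int n * sqrt 2" by (simp only: formval_def mat2.sel)
    then have "\<bar>formval T g\<bar> = of_int \<bar>n\<bar> * sqrt 2" by (simp add: abs_mult)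
    then show ?thesis by blast
  qed
  obtain n0 :: int where n0: "m = of_int n0 * sqrt 2" using I[OF g0(1)] g0(2) by auto
  have "0 < n0" using n0 m1 by (smt (verit) mult_nonneg_nonneg mult_nonpos_nonneg of_int_0_less_iff of_int_le_0_iff real_sqrt_ge_zero)
  then have n1: "1 \<le> real_of_int n0" by linarith
  have mg: "sqrt 2 \<le> m" using mult_right_mono[OF n1, of "sqrt 2"] n0 by simp
  show ?thesis
  proof (rule that[of "sqrt 2"])
    have "sqrt 2 * sqrt 2 \<le> m * sqrt 2" using mg by (intro mult_right_mono) auto
    then show "8 * (m - sqrt 2)\<^sup>2 < 8 * m\<^sup>2 - 4" by (simp add: power2_eq_square algebra_simps)
    fix g assume g: "g \<in> G4" "\<bar>formval T g\<bar> < m"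
    obtain n :: int where n: "\<bar>formval T g\<bar> = of_int n * sqrt 2" using I[OF g(1)] by blast
    have "n < n0" using g(2) unfolding n n0 by (simp add: mult_less_cancel_right)
    then have "real_of_int n \<le> of_int n0 - 1" by linarith
    then have "of_int n * sqrt 2 \<le> (of_int n0 - 1) * sqrt 2" by (rule mult_right_mono) simp
    then show "\<bar>formval T g\<bar> \<le> m - sqrt 2" unfolding n n0 by (simp add: algebra_simps)
  qed (use mg in auto)
next
  assume T1: "T \<in> G1"
  have I: "\<exists>n :: int. \<bar>formval T g\<bar> = of_int n" if g: "g \<in> G4" for g
  proof -
    have "adj g * T * g \<in> G1" by (rule G1_conj[OF g T1])
    then obtain a b n d :: int where "adj g * T * g = Mat (a * sqrt 2) b n (d * sqrt 2)" unfolding G1_def by blast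
    then have "formval T g = of_int n" by (simp only: formval_def mat2.sel)
    then have "\<bar>formval T g\<bar> = of_int \<bar>n\<bar>" by simp
    then show ?thesis by blast
  qed
  obtain n0 :: int where n0: "m = of_int n0" using I[OF g0(1)] g0(2) by auto
  show ?thesis
  proof (rule that[of 1])
    show "8 * (m - 1)\<^sup>2 < 8 * m\<^sup>2 - 4" using m1 by (simp add: power2_eq_square algebra_simps)
    fix g assume g: "g \<in> G4" "\<bar>formval T g\<bar> < m"
    obtain n :: int where n: "\<bar>formval T g\<bar> = of_int n" using I[OF g(1)] by blast
    have "n < n0" using g(2) unfolding n n0 by simp
    then show "\<bar>formval T g\<bar> \<le> m - 1" unfolding n n0 by linarith
  qed (use m1 in auto)
qed

text \<open>Only cusps with \<open>appr z g < 1\<close> matter, and for large denominators the term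
  with \<open>lin\<close> is then negligible in \<open>appr_eq\<close>. The bound 2 excludes form
  values below \<open>m\<close> by \<open>unit_gap\<close>; the other cusps have constants of at
  most \<open>Lval\<close> up to an error.\<close>

lemma approx_bound_Lval:
  assumes L2: "approx_bound z 2"
  shows "approx_bound z Lval"
  unfolding approx_bound_def
proof (intro allI impI)
  fix \<epsilon> :: real assume \<epsilon>: "\<epsilon> > 0"
  obtain u where u: "u > 0" "8 * (m - u)\<^sup>2 < 8 * m\<^sup>2 - 4" "u \<le> m"
    "\<And>g. g \<in> G4 \<Longrightarrow> \<bar>formval T g\<bar> < m \<Longrightarrow> \<bar>formval T g\<bar> \<le> m - u" using unit_gap by blast
  \<comment> \<open>The value of \<open>appr\<close> for form value \<open>m - u\<close> when
    \<open>lin\<close> is neglected. The gap \<open>u\<close> yields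
    \<open>2 * (sqrt 2 * \<kappa>) < 1\<close>, that is, a constant above 2, and
    \<open>\<delta>\<close> is room for both error terms.\<close>
  define \<kappa> where "\<kappa> = (m - u) / disc_root"
  have "(2 * sqrt 2 * (m - u))\<^sup>2 < 8 * m\<^sup>2 - 4" using u(2) by (simp add: power_mult_distrib)
  then have "2 * sqrt 2 * (m - u) < disc_root" unfolding disc_root_def by (rule real_less_rsqrt)
  then have \<kappa>: "2 * (sqrt 2 * \<kappa>) < 1" unfolding \<kappa>_def using disc_root_pos by (simp add: field_simps)
  have \<kappa>0: "\<kappa> \<ge> 0" unfolding \<kappa>_def using u disc_root_pos by simp
  have "((\<lambda>\<delta>. (2 + \<delta>) * (sqrt 2 * (\<kappa> + \<delta>))) \<longlongrightarrow> (2 + 0) * (sqrt 2 * (\<kappa> + 0))) (at_right 0)"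
    by (intro tendsto_intros)
  then have "\<forall>\<^sub>F \<delta> in at_right 0. (2 + \<delta>) * (sqrt 2 * (\<kappa> + \<delta>)) < 1"
    using \<kappa> by (intro order_tendstoD(2)) auto
  moreover have "\<forall>\<^sub>F \<delta> in at_right (0::real). \<delta> > 0" by (rule eventually_at_right_less)
  ultimately have "\<exists>\<delta>>0. (2 + \<delta>) * (sqrt 2 * (\<kappa> + \<delta>)) < 1"
    using eventually_happens[OF eventually_conj] by (metis (no_types, lifting) trivial_limit_at_right_real)
  then obtain \<delta> where \<delta>: "\<delta> > 0" "(2 + \<delta>) * (sqrt 2 * (\<kappa> + \<delta>)) < 1" by blast
  obtain Q1 where Q1: "\<And>g. g \<in> G4 \<Longrightarrow> \<bar>m21 g\<bar> \<ge> Q1 \<Longrightarrow> 1 / (sqrt 2 * appr z g) \<le> 2 + \<delta>"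
    using L2 \<delta>(1) unfolding approx_bound_def by blast
  have "((\<lambda>\<xi>. disc_root / (sqrt 2 * (m - \<xi>))) \<longlongrightarrow> disc_root / (sqrt 2 * (m - 0))) (at_right 0)"
    by (intro tendsto_intros) (use m1 in simp)
  then have "\<forall>\<^sub>F \<xi> in at_right 0. disc_root / (sqrt 2 * (m - \<xi>)) < Lval + \<epsilon>"
    using \<epsilon> Lval_eq by (intro order_tendstoD(2)) auto
  moreover have "\<forall>\<^sub>F \<xi> in at_right (0::real). \<xi> < min m (disc_root * \<delta>)"
    using m1 disc_root_pos \<delta> by (intro order_tendstoD(2)[OF tendsto_ident_at]) auto
  moreover have "\<forall>\<^sub>F \<xi> in at_right (0::real). \<xi> > 0" by (rule eventually_at_right_less)
  ultimately have "\<forall>\<^sub>F \<xi> in at_right 0. disc_root / (sqrt 2 * (m - \<xi>)) < Lval + \<epsilon> \<and> \<xi> < min m (disc_root * \<delta>) \<and> \<xi> > 0"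
    by (intro eventually_conj)
  from eventually_happens[OF this]
  obtain \<xi> where \<xi>: "disc_root / (sqrt 2 * (m - \<xi>)) < Lval + \<epsilon>" "\<xi> < m" "\<xi> < disc_root * \<delta>" "\<xi> > 0"
    by auto
  \<comment> \<open>Makes the bound \<open>2 + \<delta>\<close> available and keeps
    \<open>\<bar>m21 T\<bar> * (lin g)\<^sup>2\<close> below \<open>\<xi>\<close> whenever
    \<open>appr z g < 1\<close>.\<close>
  define Q where "Q = max Q1 (max 1 (\<bar>m21 T\<bar> / \<xi>))"
  show "\<exists>Q. \<forall>g\<in>G4. \<bar>m21 g\<bar> \<ge> Q \<longrightarrow> 1 / (sqrt 2 * appr z g) \<le> Lval + \<epsilon>"
  proof (intro exI[of _ Q] ballI impI)
    fix g assume g: "g \<in> G4" and q: "\<bar>m21 g\<bar> \<ge> Q"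
    have q3: "\<bar>m21 g\<bar> \<ge> Q1" "\<bar>m21 g\<bar> \<ge> 1" "\<bar>m21 g\<bar> \<ge> \<bar>m21 T\<bar> / \<xi>" using q by (auto simp: Q_def)
    have ap: "appr z g > 0" by (rule appr_pos[OF g irr]) (use q3 in auto)
    show "1 / (sqrt 2 * appr z g) \<le> Lval + \<epsilon>"
    proof (cases "appr z g \<ge> 1")
      case True
      have "1 * 1 \<le> sqrt 2 * appr z g" using True by (intro mult_mono) auto
      then have "1 / (sqrt 2 * appr z g) \<le> 1" by simp
      then show ?thesis using Lval_ge \<epsilon> by linarith
    next
      case False
      have "\<bar>m21 g\<bar> * \<bar>lin g\<bar> < 1" using False by (simp add: appr_def abs_mult)
      then have l1: "\<bar>lin g\<bar> \<le> 1 / \<bar>m21 g\<bar>" using q3 by (simp add: field_simps)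
      have "(lin g)\<^sup>2 \<le> (1 / \<bar>m21 g\<bar>)\<^sup>2" using l1 by (metis abs_ge_zero power2_abs power_mono)
      also have "\<dots> \<le> 1 / \<bar>m21 g\<bar>"
        using mult_left_mono[of "1 / \<bar>m21 g\<bar>" 1 "1 / \<bar>m21 g\<bar>"] q3 by (simp add: power2_eq_square)
      finally have "\<bar>m21 T\<bar> * (lin g)\<^sup>2 \<le> \<bar>m21 T\<bar> * (1 / \<bar>m21 g\<bar>)" by (intro mult_left_mono) auto
      also have "\<dots> \<le> \<xi>" using q3 \<xi>(4) by (simp add: field_simps)
      finally have cl: "\<bar>m21 T * (lin g)\<^sup>2\<bar> \<le> \<xi>" by (simp add: abs_mult)
      have Fm: "\<bar>formval T g\<bar> \<ge> m"
      proof (rule ccontr)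
        assume "\<not> \<bar>formval T g\<bar> \<ge> m"
        then have "\<bar>formval T g\<bar> \<le> m - u" using u(4)[OF g] by simp
        then have "\<bar>formval T g - m21 T * (lin g)\<^sup>2\<bar> \<le> (m - u) + disc_root * \<delta>" using cl \<xi>(3) by linarith
        then have "appr z g \<le> ((m - u) + disc_root * \<delta>) / disc_root" unfolding appr_eq using disc_root_pos by (intro divide_right_mono) auto
        also have "\<dots> = \<kappa> + \<delta>" unfolding \<kappa>_def using disc_root_pos by (simp add: field_simps)
        finally have a: "sqrt 2 * appr z g \<le> sqrt 2 * (\<kappa> + \<delta>)" by (intro mult_left_mono) auto
        have "1 \<le> (2 + \<delta>) * (sqrt 2 * appr z g)" using Q1[OF g q3(1)] ap by (simp add: divide_le_eq)
        also have "\<dots> \<le> (2 + \<delta>) * (sqrt 2 * (\<kappa> + \<delta>))" using a \<delta> by (intro mult_left_mono) auto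
        finally show False using \<delta>(2) by simp
      qed
      have "(m - \<xi>) / disc_root \<le> appr z g"
        unfolding appr_eq using Fm cl disc_root_pos by (intro divide_right_mono) auto
      then have "sqrt 2 * ((m - \<xi>) / disc_root) \<le> sqrt 2 * appr z g" by (intro mult_left_mono) auto
      then have "1 / (sqrt 2 * appr z g) \<le> 1 / (sqrt 2 * ((m - \<xi>) / disc_root))"
        using \<xi> disc_root_pos ap by (intro divide_left_mono) auto
      also have "\<dots> = disc_root / (sqrt 2 * (m - \<xi>))" by simp
      finally show ?thesis using \<xi>(1) by linarith
    qed
  qed
qed

end

section \<open>Traces of Christoffel words and Markoff triples\<close>

text \<open>Normalized so that both letters get the value 1.\<close>

definition mval :: "bool list \<Rightarrow> real" where "mval c = tr2 (word_mat c) / (2 * sqrt 2)"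

text \<open>The forms of all Christoffel words take their value \<open>mval c\<close> at one and the same cusp.\<close>

definition cuspval :: "mat2 \<Rightarrow> real" where "cuspval C = m21 (letter False * C * adj (letter False))"

lemma tr2_mval: "tr2 (word_mat c) = 2 * sqrt 2 * mval c"
  by (simp add: mval_def)

lemma det2_word_mat: "det2 (word_mat c) = 1"
  unfolding word_mat_def by (induction c) (simp_all add: det2_mult G_det(2)[OF letter_G1])

text \<open>Cayley-Hamilton: the square of \<open>X\<close> is its trace times \<open>X\<close>,
  minus 1. The next two lemmas apply it to an arbitrary lower left entry, so values at a fixed cusp
  obey the recurrence of the traces.\<close>

lemma tr2_cayley_left: "det2 X = 1 \<Longrightarrow> tr2 (X * (X * Y)) = tr2 X * tr2 (X * Y) - tr2 Y"
proof -
  assume "det2 X = 1"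
  have "tr2 (X * (X * Y)) = tr2 X * tr2 (X * Y) - det2 X * tr2 Y"
    by (simp add: tr2_def det2_def algebra_simps)
  then show ?thesis using \<open>det2 X = 1\<close> by simp
qed

lemma cayley_left: "det2 X = 1 \<Longrightarrow> m21 (P * (X * (X * Y)) * R) = tr2 X * m21 (P * (X * Y) * R) - m21 (P * Y * R)"
proof -
  assume "det2 X = 1"
  have "m21 (P * (X * (X * Y)) * R) = tr2 X * m21 (P * (X * Y) * R) - det2 X * m21 (P * Y * R)"
    by (simp add: tr2_def det2_def algebra_simps)
  then show ?thesis using \<open>det2 X = 1\<close> by simp
qed

lemma cayley_right: "det2 Y = 1 \<Longrightarrow> m21 (P * (X * Y * Y) * R) = tr2 Y * m21 (P * (X * Y) * R) - m21 (P * X * R)"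
proof -
  assume "det2 Y = 1"
  have "m21 (P * (X * Y * Y) * R) = tr2 Y * m21 (P * (X * Y) * R) - det2 Y * m21 (P * X * R)"
    by (simp add: tr2_def det2_def algebra_simps)
  then show ?thesis using \<open>det2 Y = 1\<close> by simp
qed

lemma mval_left: "mval (u @ u @ v) = 2 * sqrt 2 * mval u * mval (u @ v) - mval v"
proof -
  have "tr2 (word_mat (u @ u @ v)) = tr2 (word_mat u) * tr2 (word_mat (u @ v)) - tr2 (word_mat v)"
    using tr2_cayley_left[OF det2_word_mat[of u], of "word_mat v"] by (simp only: word_mat_append)
  then have "2 * sqrt 2 * mval (u @ u @ v) = 2 * sqrt 2 * mval u * (2 * sqrt 2 * mval (u @ v)) - 2 * sqrt 2 * mval v"
    unfolding tr2_mval .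
  also have "\<dots> = 2 * sqrt 2 * (2 * sqrt 2 * mval u * mval (u @ v) - mval v)" by algebra
  finally show ?thesis by (simp only: mult_cancel_left) simp
qed

lemma mval_commute: "mval (u @ v) = mval (v @ u)"
  unfolding mval_def word_mat_append by (simp only: tr2_commute)

lemma mval_right: "mval ((u @ v) @ v) = 2 * sqrt 2 * mval v * mval (u @ v) - mval u"
  using mval_left[of v u] by (metis append.assoc mval_commute)

lemma mval_base: "mval [True] = 1" "mval [False] = 1" "mval [True, False] = sqrt 2"
proof -
  show "mval [True] = 1" "mval [False] = 1" by (simp_all add: mval_def word_mat_def letter_def tr2_def)
  have "tr2 (word_mat [True, False]) = 4" by (simp add: word_mat_def letter_def tr2_def)
  then show "mval [True, False] = sqrt 2" by (simp add: mval_def real_div_sqrt)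
qed

text \<open>Trace and cusp value agree at the three words of the root and satisfy the same
  recurrence, hence agree on the whole tree.\<close>

definition cusp_ok :: "bool list \<Rightarrow> bool" where
  "cusp_ok c \<longleftrightarrow> cuspval (word_mat c) = mval c"

lemma cusp_ok_left:
  assumes "cusp_ok v" "cusp_ok (u @ v)" shows "cusp_ok (u @ u @ v)"
  using cayley_left[OF det2_word_mat[of u], of "letter False" "word_mat v" "adj (letter False)"] assms
  unfolding cusp_ok_def cuspval_def mval_left word_mat_append by (simp only: tr2_mval mult.assoc)

lemma cusp_ok_right:
  assumes "cusp_ok u" "cusp_ok (u @ v)" shows "cusp_ok ((u @ v) @ v)"
  using cayley_right[OF det2_word_mat[of v], of "letter False" "word_mat u" "adj (letter False)"] assms
  unfolding cusp_ok_def cuspval_def mval_right word_mat_append by (simp only: tr2_mval mult.assoc)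

lemma cusp_ok_base: "cusp_ok [True]" "cusp_ok [False]" "cusp_ok [True, False]"
  unfolding cusp_ok_def mval_base
  by (simp_all add: cuspval_def word_mat_def letter_def adj_def one_mat2_def algebra_simps)

lemma word_mat_parity: "word_mat c \<in> (if even (length c) then G0 else G1)"
proof (induction c)
  case Nil
  have "1 \<in> G0" by (rule G0_intro[of _ 1 0 0 1, OF det2_one]) (simp add: one_mat2_def)
  then show ?case by (simp add: word_mat_def)
next
  case (Cons a c)
  have "word_mat (a # c) = letter a * word_mat c" by (simp add: word_mat_def)
  then show ?case using Cons letter_G1[of a] G_times(3,4)[of "letter a" "word_mat c"] by (auto split: if_splits)
qed

text \<open>Going to a child replaces one of the three values by the other root of the equation,
  viewed as a quadratic one in that value; the new value is the largest again. By the last clause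
  exactly one of \<open>u\<close>, \<open>v\<close>, \<open>u @ v\<close> has even length, and its
  value becomes the entry \<open>x * sqrt 2\<close> of a triple.\<close>

lemma christoffel_invariant:
  "(u, v) \<in> christoffel \<Longrightarrow> cusp_ok u \<and> cusp_ok v \<and> cusp_ok (u @ v) \<and>
    mval u \<ge> 1 \<and> mval v \<ge> 1 \<and> mval u \<le> mval (u @ v) \<and> mval v \<le> mval (u @ v) \<and>
    (mval u)\<^sup>2 + (mval v)\<^sup>2 + (mval (u @ v))\<^sup>2 = 2 * sqrt 2 * mval u * mval v * mval (u @ v) \<and>
    \<not> (even (length u) \<and> even (length v))"
proof (induction rule: christoffel.induct)
  case base
  have "sqrt 2 * sqrt 2 = (2::real)" by simp
  then show ?case using cusp_ok_base mval_base by (simp add: power2_eq_square)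
next
  case (left u v)
  define a b c where "a = mval u" "b = mval v" "c = mval (u @ v)"
  have I: "a \<ge> 1" "b \<ge> 1" "a \<le> c" "b \<le> c" "a\<^sup>2 + b\<^sup>2 + c\<^sup>2 = 2 * sqrt 2 * a * b * c"
    using left.IH by (auto simp: a_b_c_def)
  have m: "mval (u @ u @ v) = 2 * sqrt 2 * a * c - b" using mval_left[of u v] by (simp add: a_b_c_def)
  have "2 * 1 \<le> 2 * sqrt 2 * a" using I by (intro mult_mono) auto
  then have ge: "2 * c \<le> 2 * sqrt 2 * a * c" using I by (intro mult_right_mono) auto
  have "a\<^sup>2 + c\<^sup>2 + (2 * sqrt 2 * a * c - b)\<^sup>2 = (a\<^sup>2 + b\<^sup>2 + c\<^sup>2) + (2 * sqrt 2 * a * c) * (2 * sqrt 2 * a * c - 2 * b)"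
    by (simp add: algebra_simps power2_eq_square)
  also have "\<dots> = 2 * sqrt 2 * a * c * (2 * sqrt 2 * a * c - b)" unfolding I(5) by (simp add: algebra_simps)
  finally have "a\<^sup>2 + c\<^sup>2 + (2 * sqrt 2 * a * c - b)\<^sup>2 = 2 * sqrt 2 * a * c * (2 * sqrt 2 * a * c - b)" .
  moreover have "a \<le> 2 * sqrt 2 * a * c - b" "c \<le> 2 * sqrt 2 * a * c - b" "c \<ge> 1" using ge I by linarith+
  moreover have "cusp_ok (u @ u @ v)" using left.IH cusp_ok_left by blast
  ultimately show ?case using left.IH I m by (auto simp: a_b_c_def)
next
  case (right u v)
  define a b c where "a = mval u" "b = mval v" "c = mval (u @ v)"
  have I: "a \<ge> 1" "b \<ge> 1" "a \<le> c" "b \<le> c" "a\<^sup>2 + b\<^sup>2 + c\<^sup>2 = 2 * sqrt 2 * a * b * c"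
    using right.IH by (auto simp: a_b_c_def)
  have m: "mval ((u @ v) @ v) = 2 * sqrt 2 * b * c - a" using mval_right[of u v] by (simp add: a_b_c_def)
  have "2 * 1 \<le> 2 * sqrt 2 * b" using I by (intro mult_mono) auto
  then have ge: "2 * c \<le> 2 * sqrt 2 * b * c" using I by (intro mult_right_mono) auto
  have "c\<^sup>2 + b\<^sup>2 + (2 * sqrt 2 * b * c - a)\<^sup>2 = (a\<^sup>2 + b\<^sup>2 + c\<^sup>2) + (2 * sqrt 2 * b * c) * (2 * sqrt 2 * b * c - 2 * a)"
    by (simp add: algebra_simps power2_eq_square)
  also have "\<dots> = 2 * sqrt 2 * c * b * (2 * sqrt 2 * b * c - a)" unfolding I(5) by (simp add: algebra_simps)
  finally have "c\<^sup>2 + b\<^sup>2 + (2 * sqrt 2 * b * c - a)\<^sup>2 = 2 * sqrt 2 * c * b * (2 * sqrt 2 * b * c - a)" .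
  moreover have "b \<le> 2 * sqrt 2 * b * c - a" "c \<le> 2 * sqrt 2 * b * c - a" "c \<ge> 1" using ge I by linarith+
  moreover have "cusp_ok ((u @ v) @ v)" using right.IH cusp_ok_right by blast
  ultimately show ?case using right.IH I m by (auto simp: a_b_c_def)
qed

text \<open>The trace alone would leave a question of divisibility. But by \<open>cusp_ok\<close>
  the value is an entry of a conjugate of \<open>word_mat c\<close>, and the coset of that matrix
  decides between integers and multiples of \<open>sqrt 2\<close>.\<close>

lemma mval_G0: assumes "cusp_ok c" "even (length c)" shows "\<exists>n :: int. mval c = of_int n * sqrt 2"
proof -
  have "word_mat c \<in> G0" using word_mat_parity[of c] assms by simp
  then have "adj (adj (letter False)) * word_mat c * adj (letter False) \<in> G0"
    using letter_G1[of False] by (intro G0_conj) (auto simp: G4_def intro: G_adj)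
  then obtain a b n d :: int where "letter False * word_mat c * adj (letter False) = Mat a (b * sqrt 2) (n * sqrt 2) d"
    unfolding G0_def adj_adj by blast
  then have "cuspval (word_mat c) = of_int n * sqrt 2" by (simp only: cuspval_def mat2.sel)
  then show ?thesis using assms unfolding cusp_ok_def by metis
qed

lemma mval_G1: assumes "cusp_ok c" "odd (length c)" shows "\<exists>n :: int. mval c = of_int n"
proof -
  have "word_mat c \<in> G1" using word_mat_parity[of c] assms by simp
  then have "adj (adj (letter False)) * word_mat c * adj (letter False) \<in> G1"
    using letter_G1[of False] by (intro G1_conj) (auto simp: G4_def intro: G_adj)
  then obtain a b n d :: int where "letter False * word_mat c * adj (letter False) = Mat (a * sqrt 2) b n (d * sqrt 2)"
    unfolding G1_def adj_adj by blast
  then have "cuspval (word_mat c) = of_int n" by (simp only: cuspval_def mat2.sel)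
  then show ?thesis using assms unfolding cusp_ok_def by metis
qed

text \<open>Scaling \<open>x\<close> by \<open>\<surd>2\<close> makes the Markoff equation symmetric: \<open>a\<^sup>2 + b\<^sup>2 + c\<^sup>2 = 2 \<surd>2 a b c\<close>.\<close>

definition weighted_triple :: "real \<Rightarrow> real \<Rightarrow> real \<Rightarrow> bool" where
  "weighted_triple a b c \<longleftrightarrow> (\<exists>x y1 y2. markoff_triple x y1 y2 \<and> a = of_int x * sqrt 2 \<and> b = of_int y1 \<and> c = of_int y2)"

lemma weighted_tripleI:
  assumes r: "a\<^sup>2 + b\<^sup>2 + c\<^sup>2 = 2 * sqrt 2 * a * b * c" and pos: "a > 0" "b > 0" "c > 0"
    and e: "a = of_int x * sqrt 2" "b = of_int y1" "c = of_int y2"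
  shows "markoff_triple x y1 y2"
proof -
  have "real_of_int (2 * x\<^sup>2 + y1\<^sup>2 + y2\<^sup>2) = a\<^sup>2 + b\<^sup>2 + c\<^sup>2" by (simp add: e power_mult_distrib)
  also have "\<dots> = 2 * sqrt 2 * a * b * c" by (rule r)
  also have "\<dots> = (sqrt 2 * sqrt 2) * (2 * of_int x * of_int y1 * of_int y2)" unfolding e by (simp only: ac_simps)
  also have "\<dots> = real_of_int (4 * x * y1 * y2)" by simp
  finally have "2 * x\<^sup>2 + y1\<^sup>2 + y2\<^sup>2 = 4 * x * y1 * y2" by (simp only: of_int_eq_iff)
  moreover have "x > 0" "y1 > 0" "y2 > 0" using pos e by (auto simp: zero_less_mult_iff)
  ultimately show ?thesis by (simp add: markoff_triple_def)
qed

text \<open>Words of odd length are treated only as products \<open>u @ v\<close>, since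
  \<open>markoff_y\<close> records the larger of the two entries and the product has the largest
  value of the three.\<close>

lemma christoffel_pair_markoff:
  assumes "(u, v) \<in> christoffel"
  shows "c \<in> {u, v, u @ v} \<Longrightarrow> even (length c) \<Longrightarrow> \<exists>x \<in> markoff_x. mval c = of_int x * sqrt 2"
    and "odd (length (u @ v)) \<Longrightarrow> \<exists>y \<in> markoff_y. mval (u @ v) = of_int y"
proof -
  note I = christoffel_invariant[OF assms]
  define a b d where "a = mval u" "b = mval v" "d = mval (u @ v)"
  have r: "a\<^sup>2 + b\<^sup>2 + d\<^sup>2 = 2 * sqrt 2 * a * b * d" using I by (simp add: a_b_d_def)
  have pos: "a > 0" "b > 0" "d > 0" "a \<le> d" "b \<le> d" using I by (simp_all add: a_b_d_def)
  have r': "d\<^sup>2 + a\<^sup>2 + b\<^sup>2 = 2 * sqrt 2 * d * a * b" "b\<^sup>2 + a\<^sup>2 + d\<^sup>2 = 2 * sqrt 2 * b * a * d"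
    using r by (simp_all add: ac_simps)
  have "(\<exists>x y1 y2. markoff_triple x y1 y2 \<and> mval u = of_int x * sqrt 2 \<and> mval v = of_int y1 \<and> mval (u @ v) = of_int y2 \<and>
      even (length u) \<and> odd (length v) \<and> odd (length (u @ v))) \<or>
    (\<exists>x y1 y2. markoff_triple x y1 y2 \<and> mval v = of_int x * sqrt 2 \<and> mval u = of_int y1 \<and> mval (u @ v) = of_int y2 \<and>
      odd (length u) \<and> even (length v) \<and> odd (length (u @ v))) \<or>
    (\<exists>x y1 y2. markoff_triple x y1 y2 \<and> mval (u @ v) = of_int x * sqrt 2 \<and> mval u = of_int y1 \<and> mval v = of_int y2 \<and>
      odd (length u) \<and> odd (length v) \<and> even (length (u @ v)))" (is "?E \<or> ?O1 \<or> ?O2")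
  proof -
    consider "even (length u)" "odd (length v)" | "odd (length u)" "even (length v)" | "odd (length u)" "odd (length v)"
      using I by blast
    then show ?thesis
    proof cases
      case 1
      then have l: "odd (length (u @ v))" by simp
      obtain x y1 y2 where e: "mval u = of_int x * sqrt 2" "mval v = of_int y1" "mval (u @ v) = of_int y2"
        using mval_G0[of u] mval_G1[of v] mval_G1[of "u @ v"] I 1 l by blast
      then have "markoff_triple x y1 y2" using weighted_tripleI[OF r pos(1,2,3)] by (simp add: a_b_d_def)
      then show ?thesis using e 1 l by blast
    next
      case 2
      then have l: "odd (length (u @ v))" by simp
      obtain x y1 y2 where e: "mval v = of_int x * sqrt 2" "mval u = of_int y1" "mval (u @ v) = of_int y2"
        using mval_G0[of v] mval_G1[of u] mval_G1[of "u @ v"] I 2 l by blast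
      then have "markoff_triple x y1 y2" using weighted_tripleI[OF r'(2) pos(2,1,3)] by (simp add: a_b_d_def)
      then show ?thesis using e 2 l by blast
    next
      case 3
      then have l: "even (length (u @ v))" by simp
      obtain x y1 y2 where e: "mval (u @ v) = of_int x * sqrt 2" "mval u = of_int y1" "mval v = of_int y2"
        using mval_G0[of "u @ v"] mval_G1[of u] mval_G1[of v] I 3 l by blast
      then have "markoff_triple x y1 y2" using weighted_tripleI[OF r'(1) pos(3,1,2)] by (simp add: a_b_d_def)
      then show ?thesis using e 3 l by blast
    qed
  qed
  then consider (E) ?E | (O1) ?O1 | (O2) ?O2 by blast
  note cases = this
  show "\<exists>x \<in> markoff_x. mval c = of_int x * sqrt 2" if c: "c \<in> {u, v, u @ v}" "even (length c)"
    using cases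
  proof cases
    case E
    then obtain x y1 y2 where "markoff_triple x y1 y2" "mval u = of_int x * sqrt 2" "odd (length v)" "odd (length (u @ v))" by blast
    moreover from this have "c = u" using c by blast
    ultimately show ?thesis unfolding markoff_x_def by blast
  next
    case O1
    then obtain x y1 y2 where "markoff_triple x y1 y2" "mval v = of_int x * sqrt 2" "odd (length u)" "odd (length (u @ v))" by blast
    moreover from this have "c = v" using c by blast
    ultimately show ?thesis unfolding markoff_x_def by blast
  next
    case O2
    then obtain x y1 y2 where "markoff_triple x y1 y2" "mval (u @ v) = of_int x * sqrt 2" "odd (length u)" "odd (length v)" by blast
    moreover from this have "c = u @ v" using c by blast
    ultimately show ?thesis unfolding markoff_x_def by blast
  qed
  show "\<exists>y \<in> markoff_y. mval (u @ v) = of_int y" if c: "odd (length (u @ v))"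
  proof -
    have fin: ?thesis if 1: "markoff_triple x y1 y2" "mval (u @ v) = of_int y2" "of_int y1 \<in> {mval u, mval v}" for x y1 y2
    proof -
      have "real_of_int y1 \<le> of_int y2" using 1(2,3) pos(4,5) by (auto simp: a_b_d_def)
      then have "y2 = max y1 y2" by simp
      then have "y2 \<in> markoff_y" using 1(1) unfolding markoff_y_def by blast
      then show ?thesis using 1(2) by blast
    qed
    show ?thesis
      using cases
    proof cases
      case E
      then obtain x y1 y2 where "markoff_triple x y1 y2" "mval v = of_int y1" "mval (u @ v) = of_int y2" by blast
      then show ?thesis using fin[of x y1 y2] by simp
    next
      case O1
      then obtain x y1 y2 where "markoff_triple x y1 y2" "mval u = of_int y1" "mval (u @ v) = of_int y2" by blast
      then show ?thesis using fin[of x y1 y2] by simp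
    next
      case O2 then show ?thesis using c by blast
    qed
  qed
qed

text \<open>Shows that the restriction to products in \<open>christoffel_pair_markoff\<close> leaves
  out only the two letters, whose value 1 comes from the triple \<open>(1; 1, 1)\<close>.\<close>

lemma christoffel_word_product:
  assumes "christoffel_word c"
  shows "c = [True] \<or> c = [False] \<or> (\<exists>u v. (u, v) \<in> christoffel \<and> c = u @ v)"
proof -
  have "\<forall>c \<in> {u, v}. c = [True] \<or> c = [False] \<or> (\<exists>u v. (u, v) \<in> christoffel \<and> c = u @ v)"
    if "(u, v) \<in> christoffel" for u v
    using that
  proof (induction rule: christoffel.induct)
    case (left u v) then show ?case by blast
  next
    case (right u v) then show ?case by blast
  qed simp
  then show ?thesis using assms unfolding christoffel_word_def by blast
qed

lemma christoffel_word_props: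
  assumes "christoffel_word c"
  shows "cusp_ok c" "mval c \<ge> 1"
    "(\<exists>x \<in> markoff_x. mval c = of_int x * sqrt 2) \<or> (\<exists>y \<in> markoff_y. mval c = of_int y)"
proof -
  obtain u v where uv: "(u, v) \<in> christoffel" "c \<in> {u, v}" using assms unfolding christoffel_word_def by blast
  show "cusp_ok c" "mval c \<ge> 1" using christoffel_invariant[OF uv(1)] uv(2) by blast+
  show "(\<exists>x \<in> markoff_x. mval c = of_int x * sqrt 2) \<or> (\<exists>y \<in> markoff_y. mval c = of_int y)"
  proof (cases "even (length c)")
    case True then show ?thesis using christoffel_pair_markoff(1)[OF uv(1), of c] uv(2) by blast
  next
    case False
    have "markoff_triple 1 1 1" by (simp add: markoff_triple_def)
    then have "max 1 1 \<in> markoff_y" unfolding markoff_y_def by blast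
    then have one: "1 \<in> markoff_y" by simp
    show ?thesis using christoffel_word_product[OF assms] False christoffel_pair_markoff(2) mval_base one
      by (metis of_int_1)
  qed
qed

section \<open>Every Markoff triple occurs in the Christoffel tree\<close>

definition some_triple :: "real \<Rightarrow> real \<Rightarrow> real \<Rightarrow> bool" where
  "some_triple a b c \<longleftrightarrow> weighted_triple a b c \<or> weighted_triple b a c \<or> weighted_triple c a b"

lemma weighted_swap: "weighted_triple a b c \<Longrightarrow> weighted_triple a c b"
  unfolding weighted_triple_def markoff_triple_def
  by (elim exE) (rule exI, rule exI, rule exI, auto simp: ac_simps)

lemma some_triple_swap: "some_triple a b c \<Longrightarrow> some_triple b a c" "some_triple a b c \<Longrightarrow> some_triple a c b"
  unfolding some_triple_def using weighted_swap by blast+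

lemma weighted_props:
  assumes "weighted_triple a b c"
  shows "a\<^sup>2 + b\<^sup>2 + c\<^sup>2 = 2 * sqrt 2 * a * b * c" "a \<ge> 1" "b \<ge> 1" "c \<ge> 1" "b \<noteq> 1 \<Longrightarrow> b \<ge> 2" "a \<ge> sqrt 2"
    "c \<noteq> 1 \<Longrightarrow> c \<ge> 2" "\<exists>n :: int. a\<^sup>2 + b\<^sup>2 + c\<^sup>2 = of_int n"
proof -
  obtain x y1 y2 where t: "markoff_triple x y1 y2" and e: "a = of_int x * sqrt 2" "b = of_int y1" "c = of_int y2"
    using assms unfolding weighted_triple_def by blast
  have pos: "x \<ge> 1" "y1 \<ge> 1" "y2 \<ge> 1" and r: "2 * x\<^sup>2 + y1\<^sup>2 + y2\<^sup>2 = 4 * x * y1 * y2"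
    using t unfolding markoff_triple_def by auto
  have s: "a\<^sup>2 + b\<^sup>2 + c\<^sup>2 = real_of_int (2 * x\<^sup>2 + y1\<^sup>2 + y2\<^sup>2)" by (simp add: e power_mult_distrib)
  then show "\<exists>n :: int. a\<^sup>2 + b\<^sup>2 + c\<^sup>2 = of_int n" by blast
  have "real_of_int (4 * x * y1 * y2) = (sqrt 2 * sqrt 2) * (2 * of_int x * of_int y1 * of_int y2)" by simp
  also have "\<dots> = 2 * sqrt 2 * a * b * c" unfolding e by (simp only: ac_simps)
  finally show "a\<^sup>2 + b\<^sup>2 + c\<^sup>2 = 2 * sqrt 2 * a * b * c" unfolding s r .
  have "1 * sqrt 2 \<le> of_int x * sqrt 2" using pos by (intro mult_right_mono) auto
  then show "a \<ge> sqrt 2" unfolding e by simp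
  then show "a \<ge> 1" using sqrt2_gt_1 by linarith
  show "b \<ge> 1" "c \<ge> 1" "b \<noteq> 1 \<Longrightarrow> b \<ge> 2" "c \<noteq> 1 \<Longrightarrow> c \<ge> 2" using pos e by auto
qed

lemma weighted_vieta:
  assumes "weighted_triple a b c"
  shows "weighted_triple a b (2 * sqrt 2 * a * b - c)" "weighted_triple (2 * sqrt 2 * b * c - a) b c"
proof -
  obtain x y1 y2 where t: "markoff_triple x y1 y2" and e: "a = of_int x * sqrt 2" "b = of_int y1" "c = of_int y2"
    using assms unfolding weighted_triple_def by blast
  note p = weighted_props[OF assms]
  have c': "2 * sqrt 2 * a * b - c = of_int (4 * x * y1 - y2)" unfolding e by simp
  have "(2 * sqrt 2 * a * b - c) * c = a\<^sup>2 + b\<^sup>2" using p(1) by (simp add: algebra_simps power2_eq_square)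
  moreover have "a\<^sup>2 + b\<^sup>2 > 0" using p(2) by (intro add_pos_nonneg) auto
  ultimately have pc: "2 * sqrt 2 * a * b - c > 0" using p(4) by (metis less_eq_real_def order_less_le_trans zero_less_mult_pos2 zero_less_one)
  have "a\<^sup>2 + b\<^sup>2 + (2 * sqrt 2 * a * b - c)\<^sup>2 = (a\<^sup>2 + b\<^sup>2 + c\<^sup>2) + (2 * sqrt 2 * a * b) * (2 * sqrt 2 * a * b - 2 * c)"
    by (simp add: algebra_simps power2_eq_square)
  also have "\<dots> = 2 * sqrt 2 * a * b * (2 * sqrt 2 * a * b - c)" unfolding p(1) by (simp add: algebra_simps)
  finally have "markoff_triple x y1 (4 * x * y1 - y2)"
    by (rule weighted_tripleI) (use p pc e c' in auto)
  then show "weighted_triple a b (2 * sqrt 2 * a * b - c)" unfolding weighted_triple_def using e c' by blast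
  have a': "2 * sqrt 2 * b * c - a = of_int (2 * y1 * y2 - x) * sqrt 2" unfolding e by (simp add: algebra_simps)
  have "(2 * sqrt 2 * b * c - a) * a = b\<^sup>2 + c\<^sup>2" using p(1) by (simp add: algebra_simps power2_eq_square)
  moreover have "b\<^sup>2 + c\<^sup>2 > 0" using p(3) by (intro add_pos_nonneg) auto
  ultimately have pa: "2 * sqrt 2 * b * c - a > 0" using p(2) by (metis less_eq_real_def order_less_le_trans zero_less_mult_pos2 zero_less_one)
  have "(2 * sqrt 2 * b * c - a)\<^sup>2 + b\<^sup>2 + c\<^sup>2 = (a\<^sup>2 + b\<^sup>2 + c\<^sup>2) + (2 * sqrt 2 * b * c) * (2 * sqrt 2 * b * c - 2 * a)"
    by (simp add: algebra_simps power2_eq_square)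
  also have "\<dots> = 2 * sqrt 2 * (2 * sqrt 2 * b * c - a) * b * c" unfolding p(1) by (simp add: algebra_simps)
  finally have "markoff_triple (2 * y1 * y2 - x) y1 y2"
    by (rule weighted_tripleI) (use p pa e a' in auto)
  then show "weighted_triple (2 * sqrt 2 * b * c - a) b c" unfolding weighted_triple_def using e a' by blast
qed

lemma some_triple_props:
  assumes "some_triple a b c"
  shows "a\<^sup>2 + b\<^sup>2 + c\<^sup>2 = 2 * sqrt 2 * a * b * c" "a \<ge> 1" "b \<ge> 1" "c \<ge> 1" "b \<noteq> 1 \<Longrightarrow> b \<ge> sqrt 2" "a \<noteq> 1 \<Longrightarrow> a \<ge> sqrt 2"
    "\<exists>n :: int. a\<^sup>2 + b\<^sup>2 + c\<^sup>2 = of_int n" "some_triple a b (2 * sqrt 2 * a * b - c)"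
proof -
  have s: "sqrt 2 \<le> (2::real)" by (rule real_le_lsqrt) auto
  have r: "2 * sqrt 2 * b * a * c = 2 * sqrt 2 * a * b * c" "2 * sqrt 2 * c * a * b = 2 * sqrt 2 * a * b * c"
    "2 * sqrt 2 * b * a = 2 * sqrt 2 * a * b" by (simp_all add: ac_simps)
  have q: "b\<^sup>2 + a\<^sup>2 + c\<^sup>2 = a\<^sup>2 + b\<^sup>2 + c\<^sup>2" "c\<^sup>2 + a\<^sup>2 + b\<^sup>2 = a\<^sup>2 + b\<^sup>2 + c\<^sup>2" by simp_all
  have "a\<^sup>2 + b\<^sup>2 + c\<^sup>2 = 2 * sqrt 2 * a * b * c \<and> a \<ge> 1 \<and> b \<ge> 1 \<and> c \<ge> 1 \<and> (b \<noteq> 1 \<longrightarrow> b \<ge> sqrt 2) \<and> (a \<noteq> 1 \<longrightarrow> a \<ge> sqrt 2) \<and>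
    (\<exists>n :: int. a\<^sup>2 + b\<^sup>2 + c\<^sup>2 = of_int n) \<and> some_triple a b (2 * sqrt 2 * a * b - c)"
    using assms[unfolded some_triple_def]
  proof (elim disjE)
    assume t: "weighted_triple a b c"
    note p = weighted_props[OF t]
    have "(b \<noteq> 1 \<longrightarrow> b \<ge> sqrt 2)" using p(5) s by fastforce
    then show ?thesis using p weighted_vieta(1)[OF t] unfolding some_triple_def by blast
  next
    assume t: "weighted_triple b a c"
    note p = weighted_props[OF t, unfolded r q]
    have "(a \<noteq> 1 \<longrightarrow> a \<ge> sqrt 2)" using p(5) s by fastforce
    then show ?thesis using p weighted_vieta(1)[OF t, unfolded r] unfolding some_triple_def by blast
  next
    assume t: "weighted_triple c a b"
    note p = weighted_props[OF t, unfolded r q]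
    have "(b \<noteq> 1 \<longrightarrow> b \<ge> sqrt 2)" "(a \<noteq> 1 \<longrightarrow> a \<ge> sqrt 2)" using p(5,7) s by fastforce+
    then show ?thesis using p weighted_vieta(2)[OF t] unfolding some_triple_def by blast
  qed
  then show "a\<^sup>2 + b\<^sup>2 + c\<^sup>2 = 2 * sqrt 2 * a * b * c" "a \<ge> 1" "b \<ge> 1" "c \<ge> 1" "b \<noteq> 1 \<Longrightarrow> b \<ge> sqrt 2" "a \<noteq> 1 \<Longrightarrow> a \<ge> sqrt 2"
    "\<exists>n :: int. a\<^sup>2 + b\<^sup>2 + c\<^sup>2 = of_int n" "some_triple a b (2 * sqrt 2 * a * b - c)" by blast+
qed

text \<open>Markoff descent on the largest entry: the other root \<open>c'\<close> lies below
  \<open>b\<close>, and the sum of squares, an integer, decreases. As the largest entry need not be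
  the multiple of \<open>sqrt 2\<close>, the descent runs on \<open>some_triple\<close>, which
  leaves the position of that entry open.\<close>

lemma triple_in_tree:
  assumes "some_triple a b c" "a \<le> b" "b \<le> c"
  shows "\<exists>(u, v) \<in> christoffel. (mval u = a \<and> mval v = b \<or> mval u = b \<and> mval v = a) \<and> mval (u @ v) = c"
  using assms
proof (induction "nat \<lfloor>a\<^sup>2 + b\<^sup>2 + c\<^sup>2\<rfloor>" arbitrary: a b c rule: less_induct)
  case less
  note p = some_triple_props[OF less.prems(1)]
  have s2: "sqrt 2 * sqrt 2 = (2::real)" by simp
  show ?case
  proof (cases "b = 1")
    case True
    then have a: "a = 1" using p(2) less.prems(2) by simp
    have "(c - sqrt 2)\<^sup>2 = 0" using p(1) unfolding True a by (simp add: power2_eq_square algebra_simps)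
    then have "c = sqrt 2" by simp
    then have "([True], [False]) \<in> christoffel" "mval [True] = a" "mval [False] = b" "mval ([True] @ [False]) = c"
      using True a mval_base christoffel.base by simp_all
    then show ?thesis by blast
  next
    case False
    then have b: "b \<ge> sqrt 2" by (rule p(5))
    have bb: "b * b \<ge> 2" using mult_mono[OF b b] p(3) by simp
    define c' where "c' = 2 * sqrt 2 * a * b - c"
    have cc: "c * c' = a\<^sup>2 + b\<^sup>2" using p(1) by (simp add: c'_def algebra_simps power2_eq_square)
    \<comment> \<open>The quadratic polynomial with roots \<open>c\<close> and \<open>c'\<close> is
      negative at \<open>b\<close>, so \<open>b\<close> lies strictly between them.\<close>
    have neg: "(c - b) * (c' - b) < 0"
    proof -
      have "(c - b) * (c' - b) = c * c' - b * (c + c') + b * b" by (simp add: algebra_simps)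
      also have "c + c' = 2 * sqrt 2 * a * b" by (simp add: c'_def)
      also have "c * c' - b * (2 * sqrt 2 * a * b) + b * b = a * a + 2 * (b * b) - 2 * sqrt 2 * a * (b * b)"
        unfolding cc by (simp add: power2_eq_square algebra_simps)
      finally have e: "(c - b) * (c' - b) = a * a + 2 * (b * b) - 2 * sqrt 2 * a * (b * b)" .
      show ?thesis
      proof (cases "a = 1")
        case True
        \<comment> \<open>A rough bound suffices: as \<open>b * b \<ge> 2\<close>, the expression is
          at most \<open>1 - 0.8 * (b * b)\<close> and hence negative.\<close>
        have "(1.4::real) < sqrt 2" by (rule real_less_rsqrt) (simp add: power2_eq_square)
        then have "1.4 * (b * b) \<le> sqrt 2 * (b * b)" using bb by (intro mult_right_mono) auto
        then show ?thesis unfolding e True using bb by simp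
      next
        case False
        then have "a \<ge> sqrt 2" by (rule p(6))
        then have "sqrt 2 * sqrt 2 \<le> sqrt 2 * a" by (intro mult_left_mono) auto
        then have "2 * (b * b) \<le> sqrt 2 * a * (b * b)" using bb by (intro mult_right_mono) auto
        moreover have "a * a \<le> b * b" using less.prems(2) p(2) by (intro mult_mono) auto
        ultimately show ?thesis unfolding e using bb by linarith
      qed
    qed
    have c'b: "c' < b"
    proof (rule ccontr)
      assume "\<not> c' < b"
      then have "0 \<le> (c - b) * (c' - b)" using less.prems(3) by simp
      then show False using neg by simp
    qed
    have t': "some_triple a b c'" using p(8) by (simp add: c'_def)
    note p' = some_triple_props[OF t']
    have lt: "nat \<lfloor>a\<^sup>2 + b\<^sup>2 + c'\<^sup>2\<rfloor> < nat \<lfloor>a\<^sup>2 + b\<^sup>2 + c\<^sup>2\<rfloor>"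
    proof -
      obtain n n' :: int where n: "a\<^sup>2 + b\<^sup>2 + c\<^sup>2 = of_int n" "a\<^sup>2 + b\<^sup>2 + c'\<^sup>2 = of_int n'" using p(7) p'(7) by blast
      have "c'\<^sup>2 < c\<^sup>2" using c'b less.prems(3) p'(4) by (intro power_strict_mono) auto
      then have "n' < n" using n by simp
      moreover have "0 \<le> a\<^sup>2 + b\<^sup>2 + c'\<^sup>2" by simp
      then have "0 \<le> n'" unfolding n(2) by simp
      ultimately show ?thesis unfolding n by simp
    qed
    \<comment> \<open>After sorting, \<open>b\<close> is the largest entry and belongs to the
      product \<open>u @ v\<close>. The entry \<open>c\<close> returns in the left or the right
      child, according to which of the two words has the value \<open>a\<close>.\<close>
    define x y where "x = min a c'" and "y = max a c'"
    have xy: "x \<le> y" "y \<le> b" "x = a \<and> y = c' \<or> x = c' \<and> y = a"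
      using less.prems(2) c'b by (auto simp: x_def y_def)
    have tx: "some_triple x y b" using xy(3) t' some_triple_swap by blast
    have m: "x\<^sup>2 + y\<^sup>2 + b\<^sup>2 = a\<^sup>2 + b\<^sup>2 + c'\<^sup>2" using xy(3) by auto
    obtain u v where uv: "(u, v) \<in> christoffel" "(mval u = x \<and> mval v = y \<or> mval u = y \<and> mval v = x)" "mval (u @ v) = b"
      using less.hyps[OF lt[folded m] tx xy(1,2)] by blast
    then consider "mval u = a" "mval v = c'" | "mval u = c'" "mval v = a" using xy(3) by blast
    then show ?thesis
    proof cases
      case 1
      have "mval (u @ u @ v) = c" using mval_left[of u v] 1 uv(3) by (simp add: c'_def)
      then show ?thesis using christoffel.left[OF uv(1)] 1 uv(3) by blast
    next
      case 2
      have "mval ((u @ v) @ v) = c" using mval_right[of u v] 2 uv(3) by (simp add: c'_def)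
      then show ?thesis using christoffel.right[OF uv(1)] 2 uv(3) by blast
    qed
  qed
qed

lemma some_triple_word:
  assumes "some_triple a b c" "d \<in> {a, b, c}"
  shows "\<exists>w. christoffel_word w \<and> mval w = d"
proof -
  have sorted: "\<exists>w. christoffel_word w \<and> mval w = d" if s: "some_triple a b c" "a \<le> b" "b \<le> c" "d \<in> {a, b, c}" for a b c
  proof -
    obtain u v where uv: "(u, v) \<in> christoffel" "(mval u = a \<and> mval v = b \<or> mval u = b \<and> mval v = a)" "mval (u @ v) = c"
      using triple_in_tree[OF s(1-3)] by blast
    have "christoffel_word u" "christoffel_word v" "christoffel_word (u @ v)"
      unfolding christoffel_word_def using uv(1) christoffel.left[OF uv(1)] by blast+
    then show ?thesis using uv(2,3) s(4) by blast
  qed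
  have sw: "some_triple a c b" "some_triple b a c" "some_triple b c a" "some_triple c a b" "some_triple c b a"
    using assms(1) some_triple_swap by blast+
  consider "a \<le> b" "b \<le> c" | "a \<le> c" "c \<le> b" | "b \<le> a" "a \<le> c" | "b \<le> c" "c \<le> a" | "c \<le> a" "a \<le> b" | "c \<le> b" "b \<le> a"
    by linarith
  then show ?thesis
    by cases (use sorted[OF assms(1)] sorted[OF sw(1)] sorted[OF sw(2)] sorted[OF sw(3)] sorted[OF sw(4)] sorted[OF sw(5)] assms(2) in blast)+
qed

lemma markoff_x_word:
  assumes "x \<in> markoff_x" shows "\<exists>w. christoffel_word w \<and> mval w = of_int x * sqrt 2"
proof -
  obtain y1 y2 where "markoff_triple x y1 y2" using assms unfolding markoff_x_def by blast
  then have "some_triple (of_int x * sqrt 2) (of_int y1) (of_int y2)"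
    unfolding some_triple_def weighted_triple_def by blast
  then show ?thesis using some_triple_word by blast
qed

lemma markoff_y_word:
  assumes "y \<in> markoff_y" shows "\<exists>w. christoffel_word w \<and> mval w = of_int y"
proof -
  obtain x y1 y2 where t: "markoff_triple x y1 y2" "y = max y1 y2" using assms unfolding markoff_y_def by blast
  then have "some_triple (of_int x * sqrt 2) (of_int y1) (of_int y2)"
    unfolding some_triple_def weighted_triple_def by blast
  moreover have "real_of_int y \<in> {of_int x * sqrt 2, of_int y1, of_int y2}" using t(2) by (auto simp: max_def)
  ultimately show ?thesis using some_triple_word by blast
qed

section \<open>Walks of levels and heights at cusps\<close>

text \<open>The Moebius transformation given by the matrix \<open>turn t\<close>.\<close>

definition turn_act :: "int \<Rightarrow> real \<Rightarrow> real" where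
  "turn_act t x = (if t = 1 then x + sqrt 2 else if t = -1 then x / (1 + sqrt 2 * x)
     else (1 + sqrt 2 * x) / (sqrt 2 + x))"

lemma int_abs_le_1: "\<bar>t :: int\<bar> \<le> 1 \<longleftrightarrow> t = 1 \<or> t = -1 \<or> t = 0"
  by auto

lemma turn_act_pos: "x > 0 \<Longrightarrow> turn_act t x > 0"
  unfolding turn_act_def by (auto intro!: add_pos_pos divide_pos_pos mult_pos_pos)

lemma turn_act_flip: "x > 0 \<Longrightarrow> \<bar>t\<bar> \<le> 1 \<Longrightarrow> turn_act (- t) (1 / x) = 1 / turn_act t x"
proof -
  assume x: "x > 0" and t: "\<bar>t\<bar> \<le> 1"
  have "1 + sqrt 2 * (1 / x) = (x + sqrt 2) / x" "sqrt 2 + 1 / x = (sqrt 2 * x + 1) / x"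
    using x by (simp_all add: add_divide_distrib)
  then have 0: "turn_act 0 (1 / x) = 1 / turn_act 0 x" using x by (simp add: turn_act_def add.commute)
  have 1: "turn_act 1 (1 / x) = 1 / turn_act (-1) x" "turn_act (-1) (1 / x) = 1 / turn_act 1 x"
    using x by (simp_all add: turn_act_def field_simps)
  show ?thesis using t 0 1 unfolding int_abs_le_1 by auto
qed

lemma turn_act_0_bounds:
  assumes "x > 0" shows "turn_act 0 x < sqrt 2" "1 / sqrt 2 < turn_act 0 x"
proof -
  have s: "sqrt 2 * sqrt 2 = (2::real)" by simp
  have "(1 + sqrt 2 * x) < sqrt 2 * (sqrt 2 + x)" by (simp add: distrib_left)
  then show "turn_act 0 x < sqrt 2" using assms by (simp add: turn_act_def pos_divide_less_eq add_pos_pos)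
  have "sqrt 2 * (1 + sqrt 2 * x) = sqrt 2 + 2 * x" by (simp add: distrib_left flip: mult.assoc)
  then have "1 * (sqrt 2 + x) < sqrt 2 * (1 + sqrt 2 * x)" using assms by simp
  then show "1 / sqrt 2 < turn_act 0 x"
    using assms by (simp add: turn_act_def divide_simps add_pos_pos) (simp add: mult.commute)?
qed

lemma turn_act_m1_bound:
  assumes "x > 0" shows "turn_act (-1) x < 1 / sqrt 2"
  using assms by (simp add: turn_act_def divide_simps add_pos_pos)

text \<open>For the steps -1, 0, 1 the positive half-line is mapped into the intervals from 0 to
  \<open>1 / sqrt 2\<close>, from there to \<open>sqrt 2\<close>, and beyond
  \<open>sqrt 2\<close>.\<close>

lemma turn_act_strict:
  assumes "x > 0" "y > 0" "\<bar>t\<bar> \<le> 1" "\<bar>t'\<bar> \<le> 1" "t < t'"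
  shows "turn_act t x < turn_act t' y"
proof -
  have 1: "sqrt 2 < turn_act 1 y" using assms by (simp add: turn_act_def)
  have "(1::real) / sqrt 2 < sqrt 2" by (simp add: divide_simps)
  moreover have "t = -1 \<and> t' = 0 \<or> t = -1 \<and> t' = 1 \<or> t = 0 \<and> t' = 1"
    using assms(3-5) unfolding int_abs_le_1 by auto
  ultimately show ?thesis
    using 1 turn_act_0_bounds[of x] turn_act_0_bounds[of y] turn_act_m1_bound[of x] assms(1,2) by auto
qed

text \<open>The reflection at a seam. It leads back to the positive half-line only for turns other
  than 1, as those have values below \<open>sqrt 2\<close>.\<close>

lemma sqrt2_minus_turn_act:
  assumes "b > 0" "t = 0 \<or> t = -1"
  shows "sqrt 2 - turn_act t b = turn_act (- 1 - t) (1 / b)"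
proof -
  have s: "sqrt 2 * (sqrt 2 + b) - (1 + sqrt 2 * b) = 1"
    "sqrt 2 * (1 + sqrt 2 * b) - b = sqrt 2 + b" by (simp_all add: distrib_left flip: mult.assoc)
  have p: "sqrt 2 + b > 0" "1 + sqrt 2 * b > 0" using assms by (simp_all add: add_pos_pos)
  show ?thesis using assms(2)
  proof
    assume t: "t = 0"
    have "sqrt 2 - turn_act t b = (sqrt 2 * (sqrt 2 + b) - (1 + sqrt 2 * b)) / (sqrt 2 + b)"
      using p by (simp add: turn_act_def t diff_divide_distrib)
    also have "\<dots> = 1 / (sqrt 2 + b)" by (simp only: s)
    also have "\<dots> = turn_act (- 1 - t) (1 / b)" using assms p by (simp add: turn_act_def t field_simps)
    finally show ?thesis .
  next
    assume t: "t = -1"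
    have "sqrt 2 - turn_act t b = (sqrt 2 * (1 + sqrt 2 * b) - b) / (1 + sqrt 2 * b)"
      using p by (simp add: turn_act_def t diff_divide_distrib)
    also have "\<dots> = (sqrt 2 + b) / (1 + sqrt 2 * b)" by (simp only: s)
    also have "\<dots> = turn_act (- 1 - t) (1 / b)"
      using turn_act_flip[of b 0] assms by (simp add: turn_act_def t)
    finally show ?thesis .
  qed
qed

text \<open>Every further turn adds at least 1 to the sum of the lower row. A first turn 1 is
  excluded because powers of the translation have the lower row 0, 1 and do not contract.\<close>

lemma turn_act_chain:
  assumes "k \<ge> 1" "s 0 \<noteq> 1"
    and "\<And>j. j < k \<Longrightarrow> \<bar>s j\<bar> \<le> 1 \<and> x j = turn_act (s j) (x (Suc j)) \<and> y j = turn_act (s j) (y (Suc j))"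
    and "\<And>j. j \<le> k \<Longrightarrow> x j > 0 \<and> y j > 0"
  shows "\<exists>a b c d. c \<ge> 1 \<and> d \<ge> 1 \<and> c + d \<ge> real k + 1 \<and> a * d - b * c = 1 \<and>
    x 0 = (a * x k + b) / (c * x k + d) \<and> y 0 = (a * y k + b) / (c * y k + d)"
  using assms
proof (induction k)
  case (Suc k)
  have s1: "\<bar>s k\<bar> \<le> 1" "x k = turn_act (s k) (x (Suc k))" "y k = turn_act (s k) (y (Suc k))" using Suc.prems by auto
  have pos: "x (Suc k) > 0" "y (Suc k) > 0" using Suc.prems by auto
  have q: "sqrt 2 \<ge> (1::real)" by simp
  have s2: "sqrt 2 * sqrt 2 = (2::real)" by simp
  show ?case
  proof (cases "k = 0")
    case True
    then have "s 0 = 0 \<or> s 0 = -1" using Suc.prems(2) s1(1) unfolding int_abs_le_1 by auto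
    then show ?thesis
    proof
      assume "s 0 = 0"
      then show ?thesis using s1 True q
        by (intro exI[of _ "sqrt 2"] exI[of _ 1] exI[of _ 1] exI[of _ "sqrt 2"]) (simp add: turn_act_def add.commute)
    next
      assume "s 0 = -1"
      then show ?thesis using s1 True q
        by (intro exI[of _ 1] exI[of _ 0] exI[of _ "sqrt 2"] exI[of _ 1]) (simp add: turn_act_def add.commute)
    qed
  next
    case False
    then obtain a b c d where I: "c \<ge> 1" "d \<ge> 1" "c + d \<ge> real k + 1" "a * d - b * c = 1"
      "x 0 = (a * x k + b) / (c * x k + d)" "y 0 = (a * y k + b) / (c * y k + d)"
    proof -
      have "\<exists>a b c d. c \<ge> 1 \<and> d \<ge> 1 \<and> c + d \<ge> real k + 1 \<and> a * d - b * c = 1 \<and>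
        x 0 = (a * x k + b) / (c * x k + d) \<and> y 0 = (a * y k + b) / (c * y k + d)"
      proof (rule Suc.IH)
        show "1 \<le> k" "s 0 \<noteq> 1" using False Suc.prems(2) by simp_all
        show "\<bar>s j\<bar> \<le> 1 \<and> x j = turn_act (s j) (x (Suc j)) \<and> y j = turn_act (s j) (y (Suc j))" if "j < k" for j
          using Suc.prems(3)[of j] that by linarith
        show "0 < x j \<and> 0 < y j" if "j \<le> k" for j using Suc.prems(4)[of j] that by linarith
      qed
      then show thesis using that by blast
    qed
    have cq: "c \<le> sqrt 2 * c" "d \<le> sqrt 2 * d" using I q by (simp_all add: mult_le_cancel_right2)
    consider "s k = 1" | "s k = -1" | "s k = 0" using s1(1) unfolding int_abs_le_1 by auto
    then show ?thesis
    proof cases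
      case 1
      have "x 0 = (a * x (Suc k) + (sqrt 2 * a + b)) / (c * x (Suc k) + (sqrt 2 * c + d))"
        "y 0 = (a * y (Suc k) + (sqrt 2 * a + b)) / (c * y (Suc k) + (sqrt 2 * c + d))"
        unfolding I(5,6) s1(2,3) 1 by (simp_all add: turn_act_def algebra_simps)
      moreover have "c + (sqrt 2 * c + d) \<ge> real (Suc k) + 1" "sqrt 2 * c + d \<ge> 1" using I cq by linarith+
      moreover have "a * (sqrt 2 * c + d) - (sqrt 2 * a + b) * c = 1" using I(4) by (simp add: algebra_simps)
      ultimately show ?thesis using I(1)
        by (intro exI[of _ a] exI[of _ "sqrt 2 * a + b"] exI[of _ c] exI[of _ "sqrt 2 * c + d"] conjI)
    next
      case 2
      have e: "(a * (x / (1 + sqrt 2 * x)) + b) / (c * (x / (1 + sqrt 2 * x)) + d)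
          = ((a + sqrt 2 * b) * x + b) / ((c + sqrt 2 * d) * x + d)" if "x > 0" for x
      proof -
        have p: "1 + sqrt 2 * x > 0" using that by (simp add: add_pos_pos)
        have "a * (x / (1 + sqrt 2 * x)) + b = ((a + sqrt 2 * b) * x + b) / (1 + sqrt 2 * x)"
          "c * (x / (1 + sqrt 2 * x)) + d = ((c + sqrt 2 * d) * x + d) / (1 + sqrt 2 * x)"
          using p by (simp_all add: field_simps)
        then show ?thesis using p by simp
      qed
      have "x 0 = ((a + sqrt 2 * b) * x (Suc k) + b) / ((c + sqrt 2 * d) * x (Suc k) + d)"
        "y 0 = ((a + sqrt 2 * b) * y (Suc k) + b) / ((c + sqrt 2 * d) * y (Suc k) + d)"
        unfolding I(5,6) s1(2,3) 2 using e[OF pos(1)] e[OF pos(2)] by (simp_all add: turn_act_def)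
      moreover have "(c + sqrt 2 * d) + d \<ge> real (Suc k) + 1" "c + sqrt 2 * d \<ge> 1" using I cq by linarith+
      moreover have "(a + sqrt 2 * b) * d - b * (c + sqrt 2 * d) = 1" using I(4) by (simp add: algebra_simps)
      ultimately show ?thesis using I(2)
        by (intro exI[of _ "a + sqrt 2 * b"] exI[of _ b] exI[of _ "c + sqrt 2 * d"] exI[of _ d] conjI)
    next
      case 3
      have e: "(a * ((1 + sqrt 2 * x) / (sqrt 2 + x)) + b) / (c * ((1 + sqrt 2 * x) / (sqrt 2 + x)) + d)
          = ((sqrt 2 * a + b) * x + (a + sqrt 2 * b)) / ((sqrt 2 * c + d) * x + (c + sqrt 2 * d))" if "x > 0" for x
      proof -
        have p: "sqrt 2 + x > 0" using that by (simp add: add_pos_pos)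
        have "a * ((1 + sqrt 2 * x) / (sqrt 2 + x)) + b = ((sqrt 2 * a + b) * x + (a + sqrt 2 * b)) / (sqrt 2 + x)"
          "c * ((1 + sqrt 2 * x) / (sqrt 2 + x)) + d = ((sqrt 2 * c + d) * x + (c + sqrt 2 * d)) / (sqrt 2 + x)"
          using p by (simp_all add: field_simps)
        then show ?thesis using p by simp
      qed
      have "x 0 = ((sqrt 2 * a + b) * x (Suc k) + (a + sqrt 2 * b)) / ((sqrt 2 * c + d) * x (Suc k) + (c + sqrt 2 * d))"
        "y 0 = ((sqrt 2 * a + b) * y (Suc k) + (a + sqrt 2 * b)) / ((sqrt 2 * c + d) * y (Suc k) + (c + sqrt 2 * d))"
        unfolding I(5,6) s1(2,3) 3 using e[OF pos(1)] e[OF pos(2)] by (simp_all add: turn_act_def)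
      moreover have "(sqrt 2 * c + d) + (c + sqrt 2 * d) \<ge> real (Suc k) + 1"
        "sqrt 2 * c + d \<ge> 1" "c + sqrt 2 * d \<ge> 1" using I cq by linarith+
      moreover have "(sqrt 2 * a + b) * (c + sqrt 2 * d) - (a + sqrt 2 * b) * (sqrt 2 * c + d)
          = 1"
      proof -
        have "(sqrt 2 * a + b) * (c + sqrt 2 * d) - (a + sqrt 2 * b) * (sqrt 2 * c + d)
          = (sqrt 2 * sqrt 2) * (a * d - b * c) - (a * d - b * c)" by algebra
        then show ?thesis using I(4) by simp
      qed
      ultimately show ?thesis
        by (intro exI[of _ "sqrt 2 * a + b"] exI[of _ "a + sqrt 2 * b"] exI[of _ "sqrt 2 * c + d"]
          exI[of _ "c + sqrt 2 * d"] conjI)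
    qed
  qed
qed simp

text \<open>A composite of turns has determinant 1, so it is increasing with difference quotient
  \<open>1 / ((c * X + d) * (c * Y + d))\<close>. From \<open>c, d \<ge> 1\<close> and
  \<open>c + d \<ge> k + 1\<close> follows \<open>c * d \<ge> k\<close>.\<close>

lemma turn_act_chain_diff:
  assumes "k \<ge> 1" "s 0 \<noteq> 1"
    and "\<And>j. j < k \<Longrightarrow> \<bar>s j\<bar> \<le> 1 \<and> x j = turn_act (s j) (x (Suc j)) \<and> y j = turn_act (s j) (y (Suc j))"
    and "\<And>j. j \<le> k \<Longrightarrow> x j > 0 \<and> y j > 0"
  shows "x k < y k \<Longrightarrow> x 0 < y 0" "\<bar>x 0 - y 0\<bar> \<le> 1 / real k"
proof -
  obtain a b c d where I: "c \<ge> 1" "d \<ge> 1" "c + d \<ge> real k + 1" "a * d - b * c = 1"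
      "x 0 = (a * x k + b) / (c * x k + d)" "y 0 = (a * y k + b) / (c * y k + d)"
    using turn_act_chain[of k s x y, OF assms] by blast
  define X Y where "X = x k" and "Y = y k"
  have pos: "X > 0" "Y > 0" using assms(4) by (auto simp: X_def Y_def)
  have D: "c * X + d > 0" "c * Y + d > 0" using I pos by (auto intro!: add_pos_pos mult_pos_pos)
  have "x 0 - y 0 = ((a * X + b) * (c * Y + d) - (a * Y + b) * (c * X + d)) / ((c * X + d) * (c * Y + d))"
    unfolding I(5,6) X_def[symmetric] Y_def[symmetric] by (rule diff_frac_eq) (use D in simp_all)
  also have "(a * X + b) * (c * Y + d) - (a * Y + b) * (c * X + d) = (a * d - b * c) * (X - Y)"
    by (simp add: algebra_simps)
  finally have e: "x 0 - y 0 = (X - Y) / ((c * X + d) * (c * Y + d))" using I(4) by simp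
  have DD: "(c * X + d) * (c * Y + d) > 0" using D by simp
  show "x 0 < y 0" if "x k < y k"
  proof -
    have "(X - Y) / ((c * X + d) * (c * Y + d)) < 0" using that DD by (simp add: X_def Y_def divide_neg_pos)
    then show ?thesis using e by simp
  qed
  have "(c - 1) * (d - 1) \<ge> 0" using I by simp
  then have cd: "c * d \<ge> real k" using I(3) by (simp add: algebra_simps)
  have k: "real k > 0" using assms(1) by simp
  have "real k * \<bar>X - Y\<bar> \<le> (c * d) * \<bar>X - Y\<bar>" using cd by (rule mult_right_mono) simp
  also have "\<dots> \<le> (c * d) * (X + Y)" using pos I by (intro mult_left_mono) auto
  also have "\<dots> \<le> (c * X + d) * (c * Y + d)"
    using pos I mult_nonneg_nonneg[of "c * c" "X * Y"] by (simp add: algebra_simps)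
  finally have "\<bar>X - Y\<bar> * real k \<le> (c * X + d) * (c * Y + d)" by (simp add: mult.commute)
  then show "\<bar>x 0 - y 0\<bar> \<le> 1 / real k" unfolding e using DD k by (simp add: divide_simps mult.commute)
qed

text \<open>\<open>A n\<close> depends on the steps before time \<open>n\<close> and \<open>B n\<close> on those after it; \<open>A n + B n\<close> and \<open>1 / A n + 1 / B n\<close> are the
  inverses of \<open>appr\<close> at the end points of the edge at time \<open>n\<close>.\<close>

definition height_walk :: "(nat \<Rightarrow> real) \<Rightarrow> (nat \<Rightarrow> real) \<Rightarrow> (nat \<Rightarrow> int) \<Rightarrow> bool" where
  "height_walk A B h \<longleftrightarrow> (\<forall>n. A n > 0 \<and> B n > 0 \<and> \<bar>h (Suc n) - h n\<bar> \<le> 1 \<and>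
     A (Suc n) = turn_act (h (Suc n) - h n) (A n) \<and> B n = turn_act (h (Suc n) - h n) (B (Suc n)))"

lemma height_walkD:
  assumes "height_walk A B h"
  shows "A n > 0" "B n > 0" "\<bar>h (Suc n) - h n\<bar> \<le> 1"
    "A (Suc n) = turn_act (h (Suc n) - h n) (A n)" "B n = turn_act (h (Suc n) - h n) (B (Suc n))"
proof -
  note a = assms[unfolded height_walk_def, THEN spec, of n]
  show "A n > 0" by (rule a[THEN conjunct1])
  show "B n > 0" by (rule a[THEN conjunct2, THEN conjunct1])
  show "\<bar>h (Suc n) - h n\<bar> \<le> 1" by (rule a[THEN conjunct2, THEN conjunct2, THEN conjunct1])
  show "A (Suc n) = turn_act (h (Suc n) - h n) (A n)"
    by (rule a[THEN conjunct2, THEN conjunct2, THEN conjunct2, THEN conjunct1])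
  show "B n = turn_act (h (Suc n) - h n) (B (Suc n))"
    by (rule a[THEN conjunct2, THEN conjunct2, THEN conjunct2, THEN conjunct2])
qed

lemma height_walk_flip:
  assumes "height_walk A B h"
  shows "height_walk (\<lambda>n. 1 / A n) (\<lambda>n. 1 / B n) (\<lambda>n. - h n)"
  unfolding height_walk_def
proof (intro allI conjI)
  fix n
  note d = height_walkD[OF assms]
  show "1 / A n > 0" "1 / B n > 0" using d(1,2) by simp_all
  show "\<bar>- h (Suc n) - - h n\<bar> \<le> 1" using d(3)[of n] by simp
  have e: "- h (Suc n) - - h n = - (h (Suc n) - h n)" by simp
  show "1 / A (Suc n) = turn_act (- h (Suc n) - - h n) (1 / A n)"
    unfolding e using turn_act_flip[OF d(1)[of n] d(3)[of n]] d(4)[of n] by (simp only:)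
  show "1 / B n = turn_act (- h (Suc n) - - h n) (1 / B (Suc n))"
    unfolding e using turn_act_flip[OF d(2)[of "Suc n"] d(3)[of n]] d(5)[of n] by (simp only:)
qed

text \<open>The sequence \<open>x\<close> expands the past and \<open>y\<close> the reflected
  future. Equal levels give equal turns; at the first difference \<open>turn_act_strict\<close>
  orders the two, and the common turns before it preserve the order up to \<open>x 0\<close> and
  \<open>y 0\<close>.\<close>

lemma upward_seam:
  assumes height_walk: "height_walk A B h" and up: "h (Suc i) = h i + 1"
    and agree: "\<And>j. j < k \<Longrightarrow> h (i - 1 - j) = h (i + 2 + j)"
  shows "k < i \<Longrightarrow> h (i - 1 - k) > h (i + 2 + k) \<Longrightarrow> A i + B i < 2 * sqrt 2"
    and "k < i \<Longrightarrow> h (i - 1 - k) < h (i + 2 + k) \<Longrightarrow> A i + B i > 2 * sqrt 2"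
    and "1 \<le> k \<Longrightarrow> k \<le> i \<Longrightarrow> \<bar>A i + B i - 2 * sqrt 2\<bar> \<le> 1 / real k"
proof -
  note d = height_walkD[OF height_walk]
  have Bi: "B i = B (Suc i) + sqrt 2" using d(5)[of i] up by (simp add: turn_act_def)
  \<comment> \<open>\<open>F\<close> leaves out the level at \<open>Suc i\<close>: the reflection
    merges the two steps from \<open>i\<close> to \<open>i + 2\<close> into one, so that both
    sequences start at the level \<open>h i\<close> and \<open>i - 1 - j\<close> is paired with
    \<open>i + 2 + j\<close>.\<close>
  define F where "F j = (if j = 0 then h i else h (i + 1 + j))" for j
  define x where "x j = A (i - j)" for j
  define y where "y j = (if j = 0 then sqrt 2 - B (Suc i) else 1 / B (i + 1 + j))" for j
  define s where "s j = h (i - j) - h (i - Suc j)" for j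
  define s' where "s' j = F j - F (Suc j)" for j
  have x: "\<bar>s j\<bar> \<le> 1 \<and> x j = turn_act (s j) (x (Suc j))" if "j < i" for j
  proof -
    have "Suc (i - Suc j) = i - j" using that by simp
    then show ?thesis using d(3,4)[of "i - Suc j"] by (simp add: s_def x_def)
  qed
  have xpos: "x j > 0" for j using d(1) by (simp add: x_def)
  have step: "h (Suc (Suc i)) - h (Suc i) = 1 \<or> h (Suc (Suc i)) - h (Suc i) = 0 \<or> h (Suc (Suc i)) - h (Suc i) = -1"
    using d(3)[of "Suc i"] by auto
  have sum: "A i + B i = 2 * sqrt 2 + (x 0 - y 0)" using Bi by (simp add: x_def y_def)
  have PF: "h (i - j) = F j" if "j \<le> k" for j
  proof (cases j)
    case (Suc l) then show ?thesis using agree[of l] that by (simp add: F_def)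
  qed (simp add: F_def)
  have ss: "s j = s' j" if "j < k" for j
    using PF[of j] PF[of "Suc j"] that by (simp add: s_def s'_def)
  have sk: "s k - s' k = h (i + 2 + k) - h (i - 1 - k)"
    using PF[of k] by (simp add: s_def s'_def F_def)
  consider (LL) "h (Suc (Suc i)) = h i + 2" | (ok) "h (Suc (Suc i)) - h (Suc i) = 0 \<or> h (Suc (Suc i)) - h (Suc i) = -1"
    using step up by force
  then have "(k < i \<longrightarrow> h (i - 1 - k) > h (i + 2 + k) \<longrightarrow> A i + B i < 2 * sqrt 2) \<and>
    (k < i \<longrightarrow> h (i - 1 - k) < h (i + 2 + k) \<longrightarrow> A i + B i > 2 * sqrt 2) \<and>
    (1 \<le> k \<and> k \<le> i \<longrightarrow> \<bar>A i + B i - 2 * sqrt 2\<bar> \<le> 1 / real k)"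
  proof cases
    \<comment> \<open>After two steps up \<open>sqrt 2 - B (Suc i)\<close> is negative and has no
      expansion, but then the height is too large anyway.\<close>
    case LL
    have k0: "k = 0" if "1 \<le> i"
    proof (rule ccontr)
      assume "k \<noteq> 0"
      then have "h (i - 1) = h i + 2" using agree[of 0] LL by simp
      moreover have "\<bar>h i - h (i - 1)\<bar> \<le> 1" using d(3)[of "i - 1"] that by simp
      ultimately show False by simp
    qed
    have "B (Suc i) = B (Suc (Suc i)) + sqrt 2" using d(5)[of "Suc i"] up LL by (simp add: turn_act_def)
    then have "B (Suc i) > sqrt 2" using d(2) by simp
    then have big: "A i + B i > 2 * sqrt 2" using Bi d(1)[of i] by simp
    have "\<not> h (i - 1) > h (i + 2)" if "1 \<le> i"
    proof -
      have "\<bar>h i - h (i - 1)\<bar> \<le> 1" using d(3)[of "i - 1"] that by simp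
      then show ?thesis using LL by simp
    qed
    then show ?thesis using big k0 by (cases "1 \<le> i") auto
  next
    case ok
    have s'0: "s' 0 = - 1 - (h (Suc (Suc i)) - h (Suc i))" using up by (simp add: s'_def F_def)
    have y: "\<bar>s' j\<bar> \<le> 1 \<and> y j = turn_act (s' j) (y (Suc j))" for j
    proof (cases j)
      case 0
      have "\<bar>s' 0\<bar> \<le> 1" using ok s'0 by auto
      moreover have "y 0 = turn_act (s' 0) (y 1)"
        using sqrt2_minus_turn_act[OF d(2) ok, of "Suc (Suc i)"] d(5)[of "Suc i"] s'0 by (simp add: y_def)
      ultimately show ?thesis using 0 by simp
    next
      case (Suc l)
      have e: "s' j = - (h (Suc (i + 2 + l)) - h (i + 2 + l))" using Suc by (simp add: s'_def F_def)
      have "turn_act (s' j) (1 / B (Suc (i + 2 + l))) = 1 / B (i + 2 + l)"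
        unfolding e using turn_act_flip[OF d(2)[of "Suc (i + 2 + l)"] d(3)[of "i + 2 + l"]] d(5)[of "i + 2 + l"]
        by (simp only:)
      moreover have "\<bar>s' j\<bar> \<le> 1" using e d(3)[of "i + 2 + l"] by linarith
      moreover have "y j = 1 / B (i + 2 + l)" "y (Suc j) = 1 / B (Suc (i + 2 + l))"
        using Suc by (simp_all add: y_def)
      ultimately show ?thesis by simp
    qed
    have ypos: "y j > 0" for j
    proof (cases j)
      case 0
      have "y 1 > 0" using d(2) by (simp add: y_def)
      then show ?thesis using y[of 0] turn_act_pos[of "y 1"] 0 by simp
    qed (use d(2) in \<open>simp add: y_def\<close>)
    have s'01: "s' 0 \<noteq> 1" using s'0 ok by auto
    have xy: "\<bar>s' j\<bar> \<le> 1 \<and> x j = turn_act (s' j) (x (Suc j)) \<and> y j = turn_act (s' j) (y (Suc j))"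
      if "k \<le> i" "j < k" for j
    proof (intro conjI)
      show "\<bar>s' j\<bar> \<le> 1" "y j = turn_act (s' j) (y (Suc j))" using y[of j] by blast+
      have "x j = turn_act (s j) (x (Suc j))" using x[of j] that by linarith
      then show "x j = turn_act (s' j) (x (Suc j))" unfolding ss[OF that(2)] .
    qed
    have yx: "\<bar>s' j\<bar> \<le> 1 \<and> y j = turn_act (s' j) (y (Suc j)) \<and> x j = turn_act (s' j) (x (Suc j))"
      if "k \<le> i" "j < k" for j
      using xy[OF that] by blast
    have pos: "x j > 0 \<and> y j > 0" "y j > 0 \<and> x j > 0" for j using xpos ypos by blast+
    have lt: "x 0 < y 0" if "k < i" "h (i - 1 - k) > h (i + 2 + k)"
    proof -
      have "turn_act (s k) (x (Suc k)) < turn_act (s' k) (y (Suc k))"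
        using x[OF that(1)] y[of k] sk that by (intro turn_act_strict xpos ypos) auto
      then have "x k < y k" using x[OF that(1)] y[of k] by simp
      moreover have "x 0 < y 0" if "k \<ge> 1" "x k < y k"
        by (rule turn_act_chain_diff(1)[of k s' x y, OF that(1) s'01 xy[OF less_imp_le[OF \<open>k < i\<close>]] pos(1) that(2)])
      ultimately show ?thesis by (cases "k = 0") auto
    qed
    have gt: "y 0 < x 0" if "k < i" "h (i - 1 - k) < h (i + 2 + k)"
    proof -
      have "turn_act (s' k) (y (Suc k)) < turn_act (s k) (x (Suc k))"
        using x[OF that(1)] y[of k] sk that by (intro turn_act_strict xpos ypos) auto
      then have "y k < x k" using x[OF that(1)] y[of k] by simp
      moreover have "y 0 < x 0" if "k \<ge> 1" "y k < x k"
        by (rule turn_act_chain_diff(1)[of k s' y x, OF that(1) s'01 yx[OF less_imp_le[OF \<open>k < i\<close>]] pos(2) that(2)])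
      ultimately show ?thesis by (cases "k = 0") auto
    qed
    have cl: "\<bar>x 0 - y 0\<bar> \<le> 1 / real k" if "1 \<le> k" "k \<le> i"
      by (rule turn_act_chain_diff(2)[of k s' x y, OF that(1) s'01 xy[OF that(2)] pos(1)])
    show ?thesis
    proof (intro conjI impI)
      show "A i + B i < 2 * sqrt 2" if "k < i" "h (i + 2 + k) < h (i - 1 - k)"
        using lt[OF that] sum by linarith
      show "A i + B i > 2 * sqrt 2" if "k < i" "h (i - 1 - k) < h (i + 2 + k)"
        using gt[OF that] sum by linarith
      show "\<bar>A i + B i - 2 * sqrt 2\<bar> \<le> 1 / real k" if "1 \<le> k \<and> k \<le> i"
        using cl that sum by simp
    qed
  qed
  then show "k < i \<Longrightarrow> h (i - 1 - k) > h (i + 2 + k) \<Longrightarrow> A i + B i < 2 * sqrt 2"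
    and "k < i \<Longrightarrow> h (i - 1 - k) < h (i + 2 + k) \<Longrightarrow> A i + B i > 2 * sqrt 2"
    and "1 \<le> k \<Longrightarrow> k \<le> i \<Longrightarrow> \<bar>A i + B i - 2 * sqrt 2\<bar> \<le> 1 / real k" by blast+
qed

section \<open>Walks with low heights stay on two levels\<close>

definition low_heights :: "(nat \<Rightarrow> real) \<Rightarrow> (nat \<Rightarrow> real) \<Rightarrow> bool" where
  "low_heights A B \<longleftrightarrow> (\<forall>n. A n + B n \<le> 2 * sqrt 2 \<and> 1 / A n + 1 / B n \<le> 2 * sqrt 2)"

lemma low_heights_flip: "low_heights A B \<Longrightarrow> low_heights (\<lambda>n. 1 / A n) (\<lambda>n. 1 / B n)"
  unfolding low_heights_def by simp

text \<open>Consider the seam from \<open>m + 1\<close> to \<open>m + 2\<close>. Its past, read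
  backwards, stays at \<open>m + 1\<close> and then drops to \<open>m\<close>, so low heights force
  the future to drop to \<open>m\<close> no later. But that is a passage from \<open>m + 2\<close>
  down to \<open>m\<close> along a shorter plateau and, turned upside down, an instance with smaller
  \<open>e\<close>.\<close>

lemma no_pass:
  assumes "height_walk A B h" "low_heights A B" "e \<ge> 1" "e \<le> i" "h (i - e) = m"
    "\<And>j. j < e \<Longrightarrow> h (i - j) = m + 1" "h (Suc i) = m + 2"
  shows False
  using assms
proof (induction e arbitrary: A B h i m rule: less_induct)
  case (less e)
  note d = height_walkD[OF less.prems(1)]
  have hi: "h i = m + 1" using less.prems(6)[of 0] less.prems(3) by simp
  have up: "h (Suc i) = h i + 1" using hi less.prems(7) by simp
  have low_heights: "\<not> A i + B i > 2 * sqrt 2" using less.prems(2) unfolding low_heights_def by (simp add: not_less)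
  have p: "h (i - 1 - k) = (if k = e - 1 then m else m + 1)" if "k < e" for k
  proof (cases "k = e - 1")
    case True then show ?thesis using less.prems(3,5) by simp
  next
    case False then show ?thesis using less.prems(6)[of "Suc k"] that by simp
  qed
  have f0: "h (i + 2) \<ge> m + 1" using d(3)[of "Suc i"] less.prems(7) by simp
  have step: "h (i + 2 + Suc k) \<ge> h (i + 2 + k) - 1" for k using d(3)[of "i + 2 + k"] by simp
  have fin: False if "1 \<le> k" "k < e" "\<And>j. j < k \<Longrightarrow> h (i + 2 + j) = m + 1" "h (i + 2 + k) = m" for k
  proof (rule less.IH[OF that(2) height_walk_flip[OF less.prems(1)] low_heights_flip[OF less.prems(2)] that(1)])
    show "k \<le> i + 1 + k" by simp
    show "- h (i + 1 + k - k) = - m - 2" using less.prems(7) by simp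
    show "- h (i + 1 + k - j) = - m - 2 + 1" if j: "j < k" for j
    proof -
      have "i + 1 + k - j = i + 2 + (k - j - 1)" using j by simp
      then show ?thesis using that(1) \<open>\<And>j. j < k \<Longrightarrow> h (i + 2 + j) = m + 1\<close>[of "k - j - 1"] by simp
    qed
    show "- h (Suc (i + 1 + k)) = - m - 2 + 2" using that(4) by simp
  qed
  show False
  proof (cases "\<forall>k<e. h (i - 1 - k) = h (i + 2 + k)")
    case True
    have e1: "e \<noteq> 1"
    proof
      assume "e = 1"
      then have "h (i + 2) = m" using True[rule_format, of 0] p[of 0] by simp
      then show False using f0 by simp
    qed
    show False
    proof (rule fin[of "e - 1"])
      show "1 \<le> e - 1" "e - 1 < e" using e1 less.prems(3) by simp_all
      show "h (i + 2 + j) = m + 1" if "j < e - 1" for j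
        using True[rule_format, of j] p[of j] that by simp
      show "h (i + 2 + (e - 1)) = m"
        using True[rule_format, of "e - 1"] p[of "e - 1"] less.prems(3) by simp
    qed
  next
    case False
    define k where "k = (LEAST k. k < e \<and> h (i - 1 - k) \<noteq> h (i + 2 + k))"
    have k: "k < e" "h (i - 1 - k) \<noteq> h (i + 2 + k)"
      using False LeastI_ex[of "\<lambda>k. k < e \<and> h (i - 1 - k) \<noteq> h (i + 2 + k)"] unfolding k_def by blast+
    have agree: "h (i - 1 - j) = h (i + 2 + j)" if "j < k" for j
      using not_less_Least[OF that[unfolded k_def]] that k(1) by simp
    have "\<not> h (i - 1 - k) < h (i + 2 + k)"
      using upward_seam(2)[of A B h i k, OF less.prems(1) up agree] low_heights k(1) less.prems(4) by fastforce
    then have lt: "h (i + 2 + k) < h (i - 1 - k)" using k(2) by simp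
    then have k1: "k \<noteq> 0" using p[OF k(1)] f0 by (cases "k = 0") (auto split: if_splits)
    have fj: "h (i + 2 + j) = m + 1" if "j < k" for j using agree[OF that] p[of j] that k(1) by simp
    have "h (i + 2 + k) \<ge> m" using step[of "k - 1"] fj[of "k - 1"] k1 by simp
    then have "h (i + 2 + k) = m" using lt p[OF k(1)] by (auto split: if_splits)
    then show False using fin[of k] k1 k(1) fj by simp
  qed
qed

text \<open>Between the last visit to a level of at most \<open>m\<close> and a first visit to
  \<open>m + 2\<close> the walk would stay at \<open>m + 1\<close>, which is a passage in the sense
  of \<open>no_pass\<close>.\<close>

lemma stays_below:
  assumes height_walk: "height_walk A B h" and low_heights: "low_heights A B" and i0: "h i0 = m" and n: "n \<ge> i0" "\<And>j. i0 \<le> j \<Longrightarrow> j \<le> n \<Longrightarrow> h j \<le> m + 1"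
  shows "h (Suc n) \<le> m + 1"
proof (rule ccontr)
  assume c: "\<not> ?thesis"
  note d = height_walkD[OF height_walk]
  have s: "h (Suc n) = m + 2" "h n = m + 1" using c d(3)[of n] n(2)[of n] n(1) by auto
  define L where "L = (GREATEST j. j \<le> n \<and> h j \<le> m)"
  have ex: "i0 \<le> n \<and> h i0 \<le> m" using i0 n by simp
  have L: "L \<le> n \<and> h L \<le> m" unfolding L_def by (rule GreatestI_nat[where P = "\<lambda>j. j \<le> n \<and> h j \<le> m" and b = n, OF ex]) simp
  have gr: "j \<le> L" if "j \<le> n" "h j \<le> m" for j
    unfolding L_def by (rule Greatest_le_nat[where b = n]) (use that in auto)
  have Li: "i0 \<le> L" using gr[of i0] ex by simp
  have Ln: "L < n" using L s by (cases "L = n") auto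
  have gt: "h j = m + 1" if "L < j" "j \<le> n" for j
  proof -
    have "\<not> h j \<le> m" using gr[of j] that by linarith
    moreover have "h j \<le> m + 1" using n(2)[of j] that Li by linarith
    ultimately show ?thesis by linarith
  qed
  have hL: "h L = m" using gt[of "Suc L"] Ln d(3)[of L] L by simp
  show False
  proof (rule no_pass[OF height_walk low_heights, of "n - L" n m])
    show "h (n - (n - L)) = m" using Ln hL by simp
    show "h (n - j) = m + 1" if "j < n - L" for j using gt[of "n - j"] that by simp
  qed (use Ln s in simp_all)
qed

lemma two_valued:
  assumes height_walk: "height_walk A B h" and low_heights: "low_heights A B"
  shows "\<exists>m N. \<forall>n\<ge>N. h n = m \<or> h n = m + 1"
proof (cases "\<exists>i. h (Suc i) \<noteq> h i")
  case False
  then have "h n = h 0" for n by (induction n) auto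
  then show ?thesis by blast
next
  case True
  note d = height_walkD[OF height_walk]
  have main: "\<forall>n\<ge>i. h n = m \<or> h n = m + 1" if i: "{h i, h (Suc i)} = {m, m + 1}" for i m
  proof -
    obtain a b where ab: "h a = m" "h b = m + 1" "a \<in> {i, Suc i}" "b \<in> {i, Suc i}"
      using i by (metis doubleton_eq_iff insertCI)
    have "\<forall>j. i \<le> j \<and> j \<le> n \<longrightarrow> h j = m \<or> h j = m + 1" if "n \<ge> Suc i" for n
      using that
    proof (induction n rule: dec_induct)
      case base
      then show ?case using i by (metis insertCI insertE le_SucE le_antisym singletonD)
    next
      case (step n)
      have 1: "h (Suc n) \<le> m + 1"
      proof (rule stays_below[OF height_walk low_heights ab(1)])
        show "a \<le> n" using step(1) ab(3) by auto
        show "h j \<le> m + 1" if "a \<le> j" "j \<le> n" for j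
        proof -
          have "i \<le> j" using that(1) ab(3) by auto
          then show ?thesis using step(3) that(2) by force
        qed
      qed
      have 2: "- h (Suc n) \<le> - (m + 1) + 1"
      proof (rule stays_below[OF height_walk_flip[OF height_walk] low_heights_flip[OF low_heights]])
        show "- h b = - (m + 1)" using ab(2) by simp
        show "b \<le> n" using step(1) ab(4) by auto
        show "- h j \<le> - (m + 1) + 1" if "b \<le> j" "j \<le> n" for j
        proof -
          have "i \<le> j" using that(1) ab(4) by auto
          then show ?thesis using step(3) that(2) by force
        qed
      qed
      have "h (Suc n) = m \<or> h (Suc n) = m + 1" using 1 2 by linarith
      then show ?case using step(3) le_Suc_eq by blast
    qed
    then show ?thesis using le_Suc_eq by (metis le_refl nat_le_linear)
  qed
  from True obtain i where "h (Suc i) \<noteq> h i" by blast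
  then have "h (Suc i) = h i + 1 \<or> h i = h (Suc i) + 1" using d(3)[of i] by auto
  then have "{h i, h (Suc i)} = {h i, h i + 1} \<or> {h i, h (Suc i)} = {h (Suc i), h (Suc i) + 1}" by auto
  then show ?thesis using main by blast
qed

text \<open>Contraction makes expansions with equal turns agree. A single leading turn 1 can be
  stripped off first, hence the condition on the first two turns.\<close>

lemma turn_act_unique:
  assumes "\<And>j. \<bar>s j\<bar> \<le> 1 \<and> x j = turn_act (s j) (x (Suc j)) \<and> y j = turn_act (s j) (y (Suc j))"
    and "\<And>j. x j > 0 \<and> y j > 0" and "s 0 \<noteq> 1 \<or> s 1 \<noteq> 1"
  shows "x 0 = y 0"
proof -
  have main: "x 0 = y 0" if c: "s 0 \<noteq> 1"
    "\<And>j. \<bar>s j\<bar> \<le> 1 \<and> x j = turn_act (s j) (x (Suc j)) \<and> y j = turn_act (s j) (y (Suc j))"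
    "\<And>j. x j > 0 \<and> y j > 0" for x y :: "nat \<Rightarrow> real" and s :: "nat \<Rightarrow> int"
  proof (rule ccontr)
    assume "x 0 \<noteq> y 0"
    then obtain k where k: "k \<noteq> 0" "inverse (real k) < \<bar>x 0 - y 0\<bar>"
      using real_arch_inverse[of "\<bar>x 0 - y 0\<bar>"] by (auto simp: inverse_eq_divide)
    have "\<bar>x 0 - y 0\<bar> \<le> 1 / real k"
      by (rule turn_act_chain_diff(2)[of k s x y, OF _ c(1) c(2) c(3)]) (use k in simp)
    then show False using k by (simp add: inverse_eq_divide)
  qed
  show ?thesis
  proof (cases "s 0 = 1")
    case False then show ?thesis using main[of s x y] assms(1,2) by blast
  next
    case True
    have "x (Suc 0) = y (Suc 0)"
    proof (rule main[of "\<lambda>j. s (Suc j)" "\<lambda>j. x (Suc j)" "\<lambda>j. y (Suc j)"])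
      show "s (Suc 0) \<noteq> 1" using assms(3) True by simp
      show "\<bar>s (Suc j)\<bar> \<le> 1 \<and> x (Suc j) = turn_act (s (Suc j)) (x (Suc (Suc j)))
        \<and> y (Suc j) = turn_act (s (Suc j)) (y (Suc (Suc j)))" for j by (rule assms(1))
      show "0 < x (Suc j) \<and> 0 < y (Suc j)" for j by (rule assms(2))
    qed
    then show ?thesis using assms(1)[of 0] by metis
  qed
qed

section \<open>Heights of walks that are coded by words\<close>

definition codes :: "int \<Rightarrow> bool stream \<Rightarrow> (nat \<Rightarrow> int) \<Rightarrow> bool" where
  "codes m w h \<longleftrightarrow> (\<forall>n. h n = m + of_bool (w !! n))"

lemma codesD: "codes m w h \<Longrightarrow> h n = m + of_bool (w !! n)"
  unfolding codes_def by blast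

lemma codes_flip: "codes m w h \<Longrightarrow> codes (- (m + 1)) (smap Not w) (\<lambda>n. - h n)"
  unfolding codes_def by (simp add: of_bool_def)

lemma undecided_positions:
  assumes w: "w = a @- (rev u @ [s, t] @ u) @- r" and i: "i = length a + length u"
  shows "w !! i = s" "w !! Suc i = t" "\<And>j. j < length u \<Longrightarrow> w !! (i - 1 - j) = w !! (i + 2 + j)"
proof -
  define l where "l = a @ rev u @ [s, t] @ u"
  have wl: "w = l @- r" by (simp add: w l_def)
  have len: "length l = length a + 2 * length u + 2" by (simp add: l_def)
  have nth: "w !! n = l ! n" if "n < length l" for n using that unfolding wl by simp
  have e: "l = (a @ rev u) @ s # t # u" by (simp add: l_def)
  show "w !! i = s" using nth[of i] len unfolding i by (simp add: e nth_append)
  show "w !! Suc i = t" using nth[of "Suc i"] len unfolding i by (simp add: e nth_append)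
  fix j assume j: "j < length u"
  define q where "q = length u - Suc j"
  have q: "q < length u" "length u - Suc q = j" "i - 1 - j = length a + q" using j i by (auto simp: q_def)
  have "w !! (i + 2 + j) = u ! j" using nth[of "i + 2 + j"] len j unfolding i by (simp add: e nth_append)
  moreover have "w !! (i - 1 - j) = u ! j"
    using nth[of "length a + q"] len q(1,2) unfolding q(3) by (simp add: e nth_append rev_nth)
  ultimately show "w !! (i - 1 - j) = w !! (i + 2 + j)" by simp
qed

lemma codes_upward_seam:
  assumes c: "codes m w h" and s: "\<not> w !! i" "w !! Suc i"
    and ag: "\<And>j. j < k \<Longrightarrow> w !! (i - 1 - j) = w !! (i + 2 + j)"
  shows "h (Suc i) = h i + 1" "\<And>j. j < k \<Longrightarrow> h (i - 1 - j) = h (i + 2 + j)"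
proof -
  show "h (Suc i) = h i + 1" using s codesD[OF c, of i] codesD[OF c, of "Suc i"] by (simp del: snth.simps(2))
  show "h (i - 1 - j) = h (i + 2 + j)" if "j < k" for j
    using ag[OF that] codesD[OF c, of "i - 1 - j"] codesD[OF c, of "i + 2 + j"] by (simp only:)
qed

lemma not_bad_False:
  assumes height_walk: "height_walk A B h" and c: "codes m w h" and low_heights: "\<And>n. A n + B n \<le> 2 * sqrt 2"
  shows "False # rev u @ [False, True] @ u @ [True] \<notin> factors w"
proof
  assume "False # rev u @ [False, True] @ u @ [True] \<in> factors w"
  then obtain a r where "w = a @- (False # rev u @ [False, True] @ u @ [True]) @- r" by (auto simp: factors_def)
  then have w: "w = (a @ [False]) @- (rev u @ [False, True] @ u) @- (True ## r)" by simp
  define i where "i = length (a @ [False]) + length u"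
  define k where "k = length u"
  note p = undecided_positions[OF w i_def]
  have ki: "k < i" by (simp add: k_def i_def)
  have "w = a @- False ## (rev u @ [False, True] @ u @ [True]) @- r" using w by simp
  then have "w !! length a = False" by (metis shift_snth_ge diff_self_eq_0 order_refl snth.simps(1) stream.sel(1))
  then have e1: "w !! (i - 1 - k) = False" by (simp add: i_def k_def)
  define l where "l = a @ [False] @ rev u @ [False, True] @ u"
  have "w = l @- True ## r" using w by (simp add: l_def)
  then have "w !! length l = True" by (metis shift_snth_ge diff_self_eq_0 order_refl snth.simps(1) stream.sel(1))
  moreover have "length l = i + 2 + k" by (simp add: l_def i_def k_def)
  ultimately have e2: "w !! (i + 2 + k) = True" by simp
  have s: "\<not> w !! i" "w !! Suc i" using p(1,2) by (simp_all del: snth.simps(2))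
  have ag: "\<And>j. j < k \<Longrightarrow> w !! (i - 1 - j) = w !! (i + 2 + j)" using p(3) by (simp add: k_def)
  note cu = codes_upward_seam[of m w h i k, OF c s ag]
  have "h (i - 1 - k) < h (i + 2 + k)"
    using codesD[OF c, of "i - 1 - k"] codesD[OF c, of "i + 2 + k"] e1 e2 by (simp del: snth.simps(2))
  then have "A i + B i > 2 * sqrt 2" using upward_seam(2)[of A B h i k, OF height_walk cu(1) cu(2) ki] by blast
  then show False using low_heights[of i] by simp
qed

lemma not_undecided_False:
  assumes height_walk: "height_walk A B h" and c: "codes m w h" and low_heights: "\<And>n. A n + B n \<le> 2 * sqrt 2 - \<delta>"
    and u: "length u \<ge> 1" "1 / real (length u) < \<delta>"
  shows "rev u @ [False, True] @ u \<notin> factors w"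
proof
  assume "rev u @ [False, True] @ u \<in> factors w"
  then obtain a r where w: "w = a @- (rev u @ [False, True] @ u) @- r" by (auto simp: factors_def)
  define i where "i = length a + length u"
  note p = undecided_positions[OF w i_def]
  have s: "\<not> w !! i" "w !! Suc i" using p(1,2) by (simp_all del: snth.simps(2))
  note cu = codes_upward_seam[of m w h i "length u", OF c s p(3)]
  have "\<bar>A i + B i - 2 * sqrt 2\<bar> \<le> 1 / real (length u)"
    by (rule upward_seam(3)[of A B h i "length u", OF height_walk cu(1) cu(2) u(1)]) (simp_all add: i_def)
  then show False using low_heights[of i] u by linarith
qed

lemma factors_smap_Not: "l \<in> factors w \<Longrightarrow> map Not l \<in> factors (smap Not w)"
  unfolding factors_def by auto (metis smap_shift)

text \<open>At an undecided seam the height is within \<open>1 / K\<close> of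
  \<open>2 * sqrt 2\<close>, which violates the gap once \<open>1 / K < \<delta>\<close>. Seams
  downwards become seams upwards when heights are inverted and letters complemented.\<close>

lemma height_walk_markoff_set:
  assumes height_walk: "height_walk A B h" and c: "codes m w h" and \<delta>: "\<delta> > 0"
    and low_heights: "\<And>n. A n + B n \<le> 2 * sqrt 2 - \<delta>" "\<And>n. 1 / A n + 1 / B n \<le> 2 * sqrt 2 - \<delta>"
  shows "\<exists>K. markoff_set K (factors w)"
proof -
  obtain K where K: "K \<noteq> 0" "inverse (real K) < \<delta>" using real_arch_inverse[of \<delta>] \<delta> by auto
  note fl = height_walk_flip[OF height_walk] codes_flip[OF c]
  have low0: "A n + B n \<le> 2 * sqrt 2" "1 / A n + 1 / B n \<le> 2 * sqrt 2" for n using low_heights[of n] \<delta> by linarith+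
  have bad: "\<not> bad l" if l: "l \<in> factors w" for l
  proof
    assume "bad l"
    then obtain s u where lu: "l = s # rev u @ [s, \<not> s] @ u @ [\<not> s]" by (auto simp: bad_def)
    show False
    proof (cases s)
      case False then show False using not_bad_False[OF height_walk c low0(1), of u] l lu by simp
    next
      case True
      have "map Not l = False # rev (map Not u) @ [False, True] @ map Not u @ [True]"
        using True lu by (simp add: rev_map)
      then show False using not_bad_False[OF fl low0(2), of "map Not u"] factors_smap_Not[OF l] by simp
    qed
  qed
  have und: "\<not> undecided K l" if l: "l \<in> factors w" for l
  proof
    assume "undecided K l"
    then obtain s u where lu: "l = rev u @ [s, \<not> s] @ u" "K \<le> length u" by (auto simp: undecided_def)
    have u1: "length u \<ge> 1" using K lu by simp
    have "1 / real (length u) \<le> 1 / real K" by (intro frac_le) (use K lu in auto)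
    then have u2: "1 / real (length u) < \<delta>" using K by (simp add: inverse_eq_divide)
    show False
    proof (cases s)
      case False then show False using not_undecided_False[OF height_walk c low_heights(1) u1 u2] l lu by simp
    next
      case True
      have "map Not l = rev (map Not u) @ [False, True] @ map Not u"
        using True lu by (simp add: rev_map)
      then show False using not_undecided_False[OF fl low_heights(2), of "map Not u"] u1 u2 factors_smap_Not[OF l] by simp
    qed
  qed
  show ?thesis using bad und unfolding markoff_set_def by blast
qed

lemma factor_of_stream: "a + n \<le> b \<Longrightarrow> stake n (sdrop a w) \<in> factors w"
  unfolding factors_def by (auto intro!: exI[of _ "stake a w"] exI[of _ "sdrop (a + n) w"]) (metis sdrop_add stake_sdrop)

text \<open>A wrong sign at the first difference would exhibit a bad word starting at
  \<open>i - 1 - k\<close>, so there the height is below \<open>2 * sqrt 2\<close>. If the first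
  \<open>K\<close> letters show no difference, it is within \<open>1 / K\<close> of that
  value.\<close>

lemma seam_upper:
  assumes height_walk: "height_walk A B h" and c: "codes m w h" and nobad: "\<And>l. l \<in> factors w \<Longrightarrow> \<not> bad l"
    and s: "\<not> w !! i" "w !! Suc i" and K: "1 \<le> K" "K \<le> i"
  shows "A i + B i \<le> 2 * sqrt 2 + 1 / real K"
proof (cases "\<forall>j<K. w !! (i - 1 - j) = w !! (i + 2 + j)")
  case True
  note cu = codes_upward_seam[of m w h i K, OF c s True[rule_format]]
  have "\<bar>A i + B i - 2 * sqrt 2\<bar> \<le> 1 / real K"
    by (rule upward_seam(3)[of A B h i K, OF height_walk cu(1) cu(2) K])
  then show ?thesis by linarith
next
  case False
  define k where "k = (LEAST j. j < K \<and> w !! (i - 1 - j) \<noteq> w !! (i + 2 + j))"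
  have k: "k < K" "w !! (i - 1 - k) \<noteq> w !! (i + 2 + k)"
    using False LeastI_ex[of "\<lambda>j. j < K \<and> w !! (i - 1 - j) \<noteq> w !! (i + 2 + j)"] unfolding k_def by blast+
  have agree: "w !! (i - 1 - j) = w !! (i + 2 + j)" if "j < k" for j
    using not_less_Least[OF that[unfolded k_def]] that k(1) by simp
  have ki: "k < i" using k(1) K by simp
  note cu = codes_upward_seam[of m w h i k, OF c s agree]
  have "w !! (i - 1 - k)"
  proof (rule ccontr)
    assume f: "\<not> w !! (i - 1 - k)"
    define u where "u = map (\<lambda>j. w !! (i + 2 + j)) [0..<k]"
    have "stake (2 * k + 4) (sdrop (i - 1 - k) w) = False # rev u @ [False, True] @ u @ [True]"
    proof (rule nth_equalityI)
      fix n assume n: "n < length (stake (2 * k + 4) (sdrop (i - 1 - k) w))"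
      then have e: "stake (2 * k + 4) (sdrop (i - 1 - k) w) ! n = w !! (i - 1 - k + n)"
        by (simp add: stake_nth sdrop_snth)
      have len: "length u = k" by (simp add: u_def)
      consider "n = 0" | "1 \<le> n" "n \<le> k" | "n = k + 1" | "n = k + 2" | "k + 3 \<le> n" "n < 2 * k + 3" | "n = 2 * k + 3"
        using n by force
      then show "stake (2 * k + 4) (sdrop (i - 1 - k) w) ! n = (False # rev u @ [False, True] @ u @ [True]) ! n"
      proof cases
        case 1 then show ?thesis using e f by simp
      next
        case 2
        have "i - 1 - k + n = i - 1 - (k - n)" using 2 ki by simp
        then have "w !! (i - 1 - k + n) = w !! (i + 2 + (k - n))" using agree[of "k - n"] 2 by simp
        moreover have "(False # rev u @ [False, True] @ u @ [True]) ! n = u ! (k - n)"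
          using 2 len by (cases n) (simp_all add: nth_append rev_nth)
        ultimately show ?thesis using e 2 by (simp add: u_def)
      next
        case 3
        then have "i - 1 - k + n = i" using ki by simp
        then show ?thesis using e s 3 len by (simp add: nth_append)
      next
        case 4
        then have "i - 1 - k + n = Suc i" using ki by simp
        then show ?thesis using e s 4 len by (simp add: nth_append del: snth.simps(2))
      next
        case 5
        define j where "j = n - (k + 3)"
        have j: "n = k + 3 + j" "j < k" using 5 by (auto simp: j_def)
        then have "i - 1 - k + n = i + 2 + j" using ki by simp
        then show ?thesis using e j len by (simp add: nth_append u_def)
      next
        case 6
        then have "i - 1 - k + n = i + 2 + k" using ki by simp
        then have "w !! (i - 1 - k + n) = True" using k(2) f by simp
        moreover have "(False # rev u @ [False, True] @ u @ [True]) ! n = True"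
          using 6 len by (simp add: nth_append)
        ultimately show ?thesis using e by simp
      qed
    qed (simp add: u_def)
    moreover have "bad (False # rev u @ [False, True] @ u @ [True])"
      unfolding bad_def by (rule exI[of _ False], rule exI[of _ u]) simp
    ultimately show False using nobad factor_of_stream[of "i - 1 - k" "2 * k + 4" _ w] by (metis order_refl)
  qed
  then have "h (i - 1 - k) > h (i + 2 + k)"
    using codesD[OF c, of "i - 1 - k"] codesD[OF c, of "i + 2 + k"] k(2) by simp
  then have "A i + B i < 2 * sqrt 2" using upward_seam(1)[of A B h i k, OF height_walk cu(1) cu(2) ki] by blast
  moreover have "1 / real K \<ge> 0" by simp
  ultimately show ?thesis by linarith
qed

text \<open>A step up leaves \<open>A n + B n\<close> unchanged, so the time just after it reduces
  to the seam. At all remaining times neither adjacent step goes up, and \<open>A n\<close> and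
  \<open>B n\<close> are both below \<open>sqrt 2\<close>.\<close>

lemma height_walk_upper_one:
  assumes height_walk: "height_walk A B h" and c: "codes m w h" and nobad: "\<And>l. l \<in> factors w \<Longrightarrow> \<not> bad l"
    and K: "1 \<le> K" and n: "n \<ge> Suc K"
  shows "A n + B n \<le> 2 * sqrt 2 + 1 / real K"
proof -
  note d = height_walkD[OF height_walk]
  define p where "p = n - 1"
  have np: "n = Suc p" "p \<ge> K" using n by (auto simp: p_def)
  have up: "\<not> w !! i \<and> w !! Suc i" if "h (Suc i) - h i = 1" for i
    using that codesD[OF c, of i] codesD[OF c, of "Suc i"] by (cases "w !! i"; cases "w !! Suc i") (simp_all del: snth.simps(2))
  consider "h (Suc n) - h n = 1" | "h (Suc p) - h p = 1" | "h (Suc n) - h n \<noteq> 1" "h (Suc p) - h p \<noteq> 1" by blast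
  then show ?thesis
  proof cases
    case 1
    show ?thesis by (rule seam_upper[OF height_walk c nobad _ _ K]) (use up[OF 1] n in auto)
  next
    case 2
    have "A p + B p \<le> 2 * sqrt 2 + 1 / real K" by (rule seam_upper[OF height_walk c nobad _ _ K]) (use up[OF 2] np in auto)
    moreover have "A n + B n = A p + B p" using d(4)[of p] d(5)[of p] 2 np by (simp add: turn_act_def)
    ultimately show ?thesis by simp
  next
    case 3
    have small: "turn_act t x < sqrt 2" if "x > 0" "\<bar>t\<bar> \<le> 1" "t \<noteq> 1" for t x
    proof -
      have "(1::real) / sqrt 2 < sqrt 2" by (simp add: divide_simps)
      then show ?thesis using that turn_act_0_bounds[of x] turn_act_m1_bound[of x] unfolding int_abs_le_1 by auto
    qed
    have "A n < sqrt 2" using small[OF d(1)[of p] d(3)[of p] 3(2)] d(4)[of p] np by simp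
    moreover have "B n < sqrt 2" using small[OF d(2)[of "Suc n"] d(3)[of n] 3(1)] d(5)[of n] by simp
    moreover have "1 / real K \<ge> 0" by simp
    ultimately show ?thesis by linarith
  qed
qed

lemma height_walk_upper:
  assumes height_walk: "height_walk A B h" and c: "codes m w h" and nobad: "\<And>l. l \<in> factors w \<Longrightarrow> \<not> bad l"
    and K: "1 \<le> K" and n: "n \<ge> Suc K"
  shows "A n + B n \<le> 2 * sqrt 2 + 1 / real K" "1 / A n + 1 / B n \<le> 2 * sqrt 2 + 1 / real K"
proof -
  show "A n + B n \<le> 2 * sqrt 2 + 1 / real K" by (rule height_walk_upper_one[OF assms])
  show "1 / A n + 1 / B n \<le> 2 * sqrt 2 + 1 / real K"
  proof (rule height_walk_upper_one[OF height_walk_flip[OF height_walk] codes_flip[OF c] _ K n])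
    fix l assume "l \<in> factors (smap Not w)"
    then have "map Not l \<in> factors (smap Not (smap Not w))" by (rule factors_smap_Not)
    then have "map Not l \<in> factors w" by (simp add: stream.map_comp comp_def stream.map_ident)
    then have nb: "\<not> bad (map Not l)" by (rule nobad)
    show "\<not> bad l"
    proof
      assume "bad l"
      then obtain s u where "l = s # rev u @ [s, \<not> s] @ u @ [\<not> s]" by (auto simp: bad_def)
      then have "map Not l = (\<not> s) # rev (map Not u) @ [\<not> s, \<not> \<not> s] @ map Not u @ [\<not> \<not> s]" by (simp add: rev_map)
      then have "bad (map Not l)" unfolding bad_def by (intro exI[of _ "\<not> s"] exI[of _ "map Not u"])
      then show False using nb by blast
    qed
  qed
qed

section \<open>The edge path of an irrational number\<close>

text \<open>The first column of \<open>g n\<close> is a cusp to the right of \<open>z\<close>, or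
  infinity if \<open>m21 (g n) = 0\<close>; the second is a cusp to the left of \<open>z\<close>.
  Only differences of the levels are prescribed.\<close>

definition coding :: "real \<Rightarrow> (nat \<Rightarrow> mat2) \<Rightarrow> (nat \<Rightarrow> int) \<Rightarrow> bool" where
  "coding z g h \<longleftrightarrow> (\<forall>n. g n \<in> G4 \<and> \<bar>h (Suc n) - h n\<bar> \<le> 1 \<and> g (Suc n) = g n * turn (h (Suc n) - h n) \<and>
     m21 (g n) \<ge> 0 \<and> m22 (g n) > 0 \<and> m11 (g n) - m21 (g n) * z > 0 \<and> m22 (g n) * z - m12 (g n) > 0)"

lemma codingD:
  assumes "coding z g h"
  shows "g n \<in> G4" "\<bar>h (Suc n) - h n\<bar> \<le> 1" "g (Suc n) = g n * turn (h (Suc n) - h n)"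
    "m21 (g n) \<ge> 0" "m22 (g n) > 0" "m11 (g n) - m21 (g n) * z > 0" "m22 (g n) * z - m12 (g n) > 0"
proof -
  note a = assms[unfolded coding_def, THEN spec, of n]
  show "g n \<in> G4" by (rule a[THEN conjunct1])
  show "\<bar>h (Suc n) - h n\<bar> \<le> 1" by (rule a[THEN conjunct2, THEN conjunct1])
  show "g (Suc n) = g n * turn (h (Suc n) - h n)" by (rule a[THEN conjunct2, THEN conjunct2, THEN conjunct1])
  show "m21 (g n) \<ge> 0" "m22 (g n) > 0" "m11 (g n) - m21 (g n) * z > 0" "m22 (g n) * z - m12 (g n) > 0"
    using a by blast+
qed

lemma coding_exists:
  assumes irr: "z / sqrt 2 \<notin> \<rat>"
  shows "\<exists>g h. coding z g h"
proof -
  define Inv where "Inv g \<longleftrightarrow> g \<in> G4 \<and> m21 g \<ge> 0 \<and> m22 g > 0 \<and> m11 g - m21 g * z > 0 \<and> m22 g * z - m12 g > 0" for g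
  define Step where "Step p p' \<longleftrightarrow> \<bar>snd p' - snd p\<bar> \<le> 1 \<and> fst p' = fst p * turn (snd p' - snd p)" for p p' :: "mat2 \<times> int"
  have "\<exists>f. \<forall>n. Inv (fst (f n)) \<and> Step (f n) (f (Suc n))"
  proof (rule dependent_nat_choice)
    \<comment> \<open>The path starts at the edge from infinity to the last multiple of
      \<open>sqrt 2\<close> below \<open>z\<close>.\<close>
    define k where "k = \<lfloor>z / sqrt 2\<rfloor>"
    have "of_int k \<le> z / sqrt 2" by (simp add: k_def)
    moreover have "of_int k \<noteq> z / sqrt 2" using irr by (metis Rats_of_int)
    ultimately have "of_int k < z / sqrt 2" by simp
    then have "of_int k * sqrt 2 < z" by (simp add: field_simps)
    moreover have "Mat 1 (of_int k * sqrt 2) 0 1 \<in> G4"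
      unfolding G4_def by (intro UnI1 G0_intro[of _ 1 k 0 1]) (simp_all add: det2_def)
    ultimately have "Inv (fst (Mat 1 (of_int k * sqrt 2) 0 1, 0::int))" by (simp add: Inv_def)
    then show "\<exists>x. Inv (fst (x :: mat2 \<times> int))" by blast
  next
    fix p :: "mat2 \<times> int" and n :: nat
    assume I: "Inv (fst p)"
    define g where "g = fst p"
    have I: "g \<in> G4" "m21 g \<ge> 0" "m22 g > 0" "m11 g - m21 g * z > 0" "m22 g * z - m12 g > 0"
      using I by (auto simp: Inv_def g_def)
    have ex: "\<exists>y. Inv (fst y) \<and> Step p y" if "\<bar>t\<bar> \<le> 1" "Inv (g * turn t)" for t
      by (rule exI[of _ "(g * turn t, snd p + t)"]) (use that in \<open>simp add: Step_def g_def\<close>)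
    have G: "g * turn t \<in> G4" for t by (intro G4_times I turn_G4)
    note ne = G4_column_ne[OF G irr]
    define r1 r4 where "r1 = m11 g - m21 g * z" and "r4 = m22 g * z - m12 g"
    have e1: "m11 (g * turn 0) - m21 (g * turn 0) * z = sqrt 2 * r1 - r4"
      "m22 (g * turn 0) * z - m12 (g * turn 0) = sqrt 2 * r4 - r1"
      by (simp_all add: turn_simps r1_def r4_def algebra_simps)
    \<comment> \<open>The position of \<open>r4 / r1\<close> with respect to
      \<open>1 / sqrt 2\<close> and \<open>sqrt 2\<close> tells which of the three other edges of
      the square encloses \<open>z\<close>; equality would make \<open>z\<close> a cusp.\<close>
    consider "r4 > sqrt 2 * r1" | "r1 > sqrt 2 * r4" | "r4 \<le> sqrt 2 * r1" "r1 \<le> sqrt 2 * r4" by linarith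
    then show "\<exists>y. Inv (fst y) \<and> Step p y"
    proof cases
      case 1
      have "m22 (g * turn 1) * z - m12 (g * turn 1) = r4 - sqrt 2 * r1"
        by (simp add: turn_simps r1_def r4_def algebra_simps)
      then have "Inv (g * turn 1)" unfolding Inv_def using G[of 1] I 1
        by (auto simp: turn_simps intro: add_nonneg_pos)
      then show ?thesis using ex[of 1] by simp
    next
      case 2
      have "m11 (g * turn (-1)) - m21 (g * turn (-1)) * z = r1 - sqrt 2 * r4"
        by (simp add: turn_simps r1_def r4_def algebra_simps)
      then have "Inv (g * turn (-1))" unfolding Inv_def using G[of "-1"] I 2
        by (auto simp: turn_simps)
      then show ?thesis using ex[of "-1"] by simp
    next
      case 3
      have "m22 (g * turn 0) * z - m12 (g * turn 0) \<noteq> 0" using ne(2)[of 0] by simp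
      then have "sqrt 2 * r4 - r1 > 0" "sqrt 2 * r1 - r4 > 0" using 3 ne(1)[of 0] unfolding e1 by linarith+
      then have "Inv (g * turn 0)" unfolding Inv_def e1 using G[of 0] I
        by (auto simp: turn_simps intro: add_nonneg_pos)
      then show ?thesis using ex[of 0] by simp
    qed
  qed
  then obtain f where f: "\<And>n. Inv (fst (f n))" "\<And>n. Step (f n) (f (Suc n))" by blast
  have "coding z (\<lambda>n. fst (f n)) (\<lambda>n. snd (f n))"
    unfolding coding_def using f unfolding Inv_def Step_def by blast
  then show ?thesis by blast
qed

section \<open>The height walk of an edge path\<close>

locale coded =
  fixes z :: real and g :: "nat \<Rightarrow> mat2" and h :: "nat \<Rightarrow> int"
  assumes cod: "coding z g h"
begin

text \<open>For the two end points \<open>q1\<close>, \<open>q4\<close> are the denominators and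
  \<open>r1\<close>, \<open>r4\<close> the distances to \<open>z\<close> multiplied by them. The
  sign in \<open>r4\<close> is reversed because the second end point lies to the left of
  \<open>z\<close>.\<close>

definition q1 where "q1 n = m21 (g n)"
definition q4 where "q4 n = m22 (g n)"
definition r1 where "r1 n = m11 (g n) - m21 (g n) * z"
definition r4 where "r4 n = m22 (g n) * z - m12 (g n)"
definition t where "t n = h (Suc n) - h n"

lemma pos: "q1 n \<ge> 0" "q4 n > 0" "r1 n > 0" "r4 n > 0"
  using codingD(4-7)[OF cod, of n] by (simp_all add: q1_def q4_def r1_def r4_def)

lemma q4_ge: "q4 n \<ge> 1"
  using G4_entry_ge_1[OF codingD(1)[OF cod, of n], of "q4 n"] pos(2)[of n] by (simp add: q4_def)

lemma det_rel: "q4 n * r1 n + q1 n * r4 n = 1"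
proof -
  have "q4 n * r1 n + q1 n * r4 n = det2 (g n)"
    by (simp add: q1_def q4_def r1_def r4_def det2_def algebra_simps)
  then show ?thesis using G_det(3)[OF codingD(1)[OF cod, of n]] by simp
qed

lemma t_cases: "t n = 1 \<or> t n = -1 \<or> t n = 0"
  using codingD(2)[OF cod, of n] unfolding t_def int_abs_le_1 .

lemma gSuc: "g (Suc n) = g n * turn (t n)"
  using codingD(3)[OF cod, of n] by (simp add: t_def)

lemma step_L: "t n = 1 \<Longrightarrow> q1 (Suc n) = q1 n" "t n = 1 \<Longrightarrow> q4 (Suc n) = sqrt 2 * q1 n + q4 n"
   "t n = 1 \<Longrightarrow> r1 (Suc n) = r1 n" "t n = 1 \<Longrightarrow> r4 (Suc n) = r4 n - sqrt 2 * r1 n"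
  by (simp_all add: q1_def q4_def r1_def r4_def gSuc turn_simps algebra_simps)

lemma step_R: "t n = -1 \<Longrightarrow> q1 (Suc n) = q1 n + sqrt 2 * q4 n" "t n = -1 \<Longrightarrow> q4 (Suc n) = q4 n"
   "t n = -1 \<Longrightarrow> r1 (Suc n) = r1 n - sqrt 2 * r4 n" "t n = -1 \<Longrightarrow> r4 (Suc n) = r4 n"
  by (simp_all add: q1_def q4_def r1_def r4_def gSuc turn_simps algebra_simps)

lemma step_S: "t n = 0 \<Longrightarrow> q1 (Suc n) = sqrt 2 * q1 n + q4 n" "t n = 0 \<Longrightarrow> q4 (Suc n) = q1 n + sqrt 2 * q4 n"
   "t n = 0 \<Longrightarrow> r1 (Suc n) = sqrt 2 * r1 n - r4 n" "t n = 0 \<Longrightarrow> r4 (Suc n) = sqrt 2 * r4 n - r1 n"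
  by (simp_all add: q1_def q4_def r1_def r4_def gSuc turn_simps algebra_simps)

lemma sqrt2_le: "x \<ge> 0 \<Longrightarrow> x \<le> sqrt 2 * x"
  using mult_right_mono[of 1 "sqrt 2" x] by simp

lemma q1_step: "q1 n \<le> q1 (Suc n)" "t n \<noteq> 1 \<Longrightarrow> q1 n + 1 \<le> q1 (Suc n)"
proof -
  have a: "q1 n \<le> sqrt 2 * q1 n" "q4 n \<le> sqrt 2 * q4 n" using sqrt2_le pos(1,2)[of n] by simp_all
  have "q1 n \<le> q1 (Suc n) \<and> (t n \<noteq> 1 \<longrightarrow> q1 n + 1 \<le> q1 (Suc n))"
    using t_cases[of n]
  proof (elim disjE)
    assume "t n = 1" then show ?thesis using step_L(1) by simp
  next
    assume t: "t n = -1" show ?thesis unfolding step_R(1)[OF t] using a q4_ge[of n] by linarith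
  next
    assume t: "t n = 0" show ?thesis unfolding step_S(1)[OF t] using a q4_ge[of n] by linarith
  qed
  then show "q1 n \<le> q1 (Suc n)" "t n \<noteq> 1 \<Longrightarrow> q1 n + 1 \<le> q1 (Suc n)" by blast+
qed

lemma q4_step: "q4 n \<le> q4 (Suc n)" "t n \<noteq> -1 \<Longrightarrow> q1 n \<ge> 1 \<Longrightarrow> q4 n + 1 \<le> q4 (Suc n)"
proof -
  have a: "q1 n \<le> sqrt 2 * q1 n" "q4 n \<le> sqrt 2 * q4 n" using sqrt2_le pos(1,2)[of n] by simp_all
  have "q4 n \<le> q4 (Suc n) \<and> (t n \<noteq> -1 \<longrightarrow> q1 n \<ge> 1 \<longrightarrow> q4 n + 1 \<le> q4 (Suc n))"
    using t_cases[of n]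
  proof (elim disjE)
    assume t: "t n = 1" show ?thesis unfolding step_L(2)[OF t] using a pos(1)[of n] by linarith
  next
    assume "t n = -1" then show ?thesis using step_R(2) by simp
  next
    assume t: "t n = 0" show ?thesis unfolding step_S(2)[OF t] using a pos(1)[of n] by linarith
  qed
  then show "q4 n \<le> q4 (Suc n)" "t n \<noteq> -1 \<Longrightarrow> q1 n \<ge> 1 \<Longrightarrow> q4 n + 1 \<le> q4 (Suc n)" by blast+
qed

lemma q1_mono: "n \<le> k \<Longrightarrow> q1 n \<le> q1 k"
  using q1_step(1) by (rule lift_Suc_mono_le)

lemma q4_mono: "n \<le> k \<Longrightarrow> q4 n \<le> q4 k"
  using q4_step(1) by (rule lift_Suc_mono_le)

text \<open>Turning left forever would keep \<open>r1\<close> and lower \<open>r4\<close> by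
  \<open>sqrt 2 * r1\<close> each time, against positivity. The next lemma is the mirror
  image.\<close>

lemma not_all_L: "\<exists>k\<ge>n. t k \<noteq> 1"
proof (rule ccontr)
  assume "\<not> ?thesis"
  then have L: "t k = 1" if "k \<ge> n" for k using that by blast
  have "r1 (n + j) = r1 n \<and> r4 (n + j) = r4 n - real j * (sqrt 2 * r1 n)" for j
  proof (induction j)
    case (Suc j)
    have "t (n + j) = 1" using L by simp
    then show ?case using Suc step_L(3,4)[of "n + j"] by (simp add: algebra_simps)
  qed simp
  then have "real j * (sqrt 2 * r1 n) < r4 n" for j using pos(4)[of "n + j"] by simp
  moreover obtain j where "r4 n < real j * (sqrt 2 * r1 n)" using reals_Archimedean3[of "sqrt 2 * r1 n"] pos(3)[of n] by auto
  ultimately show False by (meson less_asym)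
qed

lemma not_all_R: "\<exists>k\<ge>n. t k \<noteq> -1"
proof (rule ccontr)
  assume "\<not> ?thesis"
  then have R: "t k = -1" if "k \<ge> n" for k using that by blast
  have "r4 (n + j) = r4 n \<and> r1 (n + j) = r1 n - real j * (sqrt 2 * r4 n)" for j
  proof (induction j)
    case (Suc j)
    have "t (n + j) = -1" using R by simp
    then show ?case using Suc step_R(3,4)[of "n + j"] by (simp add: algebra_simps)
  qed simp
  then have "real j * (sqrt 2 * r4 n) < r1 n" for j using pos(3)[of "n + j"] by simp
  moreover obtain j where "r1 n < real j * (sqrt 2 * r4 n)" using reals_Archimedean3[of "sqrt 2 * r4 n"] pos(4)[of n] by auto
  ultimately show False by (meson less_asym)
qed

text \<open>A turn other than left adds at least 1 to \<open>q1\<close>, and once \<open>q1\<close>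
  is at least 1, a turn other than right adds at least 1 to \<open>q4\<close>. Both kinds of turn
  recur.\<close>

lemma growth: "\<exists>N. \<forall>n\<ge>N. Q \<le> q1 n \<and> Q \<le> q4 n"
proof -
  have 1: "\<exists>n. real k \<le> q1 n" for k
  proof (induction k)
    case 0 then show ?case using pos(1) by auto
  next
    case (Suc k)
    then obtain n where n: "real k \<le> q1 n" by blast
    obtain j where j: "j \<ge> n" "t j \<noteq> 1" using not_all_L by blast
    have "real (Suc k) \<le> q1 (Suc j)" using q1_step(2)[OF j(2)] q1_mono[OF j(1)] n by simp
    then show ?case by blast
  qed
  then obtain n1 where n1: "real 1 \<le> q1 n1" by blast
  have 4: "\<exists>n. real k \<le> q4 n" for k
  proof (induction k)
    case 0 then show ?case using pos(2) by (auto intro: less_imp_le)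
  next
    case (Suc k)
    then obtain n where n: "real k \<le> q4 n" by blast
    obtain j where j: "j \<ge> max n n1" "t j \<noteq> -1" using not_all_R by blast
    have "q1 j \<ge> 1" using q1_mono[of n1 j] n1 j by simp
    then have "real (Suc k) \<le> q4 (Suc j)" using q4_step(2)[OF j(2)] q4_mono[of n j] n j(1) by simp
    then show ?case by blast
  qed
  obtain k where k: "Q \<le> real k" using real_arch_simple by blast
  obtain a b where "real k \<le> q1 a" "real k \<le> q4 b" using 1 4 by blast
  then have "Q \<le> q1 n \<and> Q \<le> q4 n" if "n \<ge> max a b" for n
    using q1_mono[of a n] q4_mono[of b n] that k by auto
  then show ?thesis by blast
qed

definition A where "A n = q4 n / q1 n"
definition B where "B n = r4 n / r1 n"

lemma A_step: assumes q: "q1 n > 0" shows "A (Suc n) = turn_act (t n) (A n)"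
proof -
  have p: "q1 n + sqrt 2 * q4 n > 0" "sqrt 2 * q1 n + q4 n > 0" using q pos(2)[of n] by (auto intro: add_pos_pos)
  consider "t n = 1" | "t n = -1" | "t n = 0" using t_cases by blast
  then show ?thesis
  proof cases
    case 1 then show ?thesis using q step_L(1,2)[OF 1] by (simp add: A_def turn_act_def field_simps)
  next
    case 2 then show ?thesis using q p step_R(1,2)[OF 2] by (simp add: A_def turn_act_def field_simps)
  next
    case 3
    have "1 + sqrt 2 * (q4 n / q1 n) = (q1 n + sqrt 2 * q4 n) / q1 n" "sqrt 2 + q4 n / q1 n = (sqrt 2 * q1 n + q4 n) / q1 n"
      using q by (simp_all add: field_simps)
    then show ?thesis using q p step_S(1,2)[OF 3] by (simp add: A_def turn_act_def 3)
  qed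
qed

lemma B_step: "B n = turn_act (t n) (B (Suc n))"
proof -
  define a b where "a = r1 (Suc n)" and "b = r4 (Suc n)"
  have ab: "a > 0" "b > 0" using pos by (simp_all add: a_def b_def)
  have p: "a + sqrt 2 * b > 0" "sqrt 2 * a + b > 0" using ab by (auto intro: add_pos_pos)
  have Bn: "B (Suc n) = b / a" by (simp add: B_def a_def b_def)
  consider "t n = 1" | "t n = -1" | "t n = 0" using t_cases by blast
  then show ?thesis
  proof cases
    case 1
    have "r1 n = a" "r4 n = b + sqrt 2 * a" using step_L(3,4)[OF 1] by (simp_all add: a_def b_def)
    then show ?thesis unfolding Bn using ab by (simp add: B_def turn_act_def 1 field_simps)
  next
    case 2
    have "r1 n = a + sqrt 2 * b" "r4 n = b" using step_R(3,4)[OF 2] by (simp_all add: a_def b_def)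
    then show ?thesis unfolding Bn using ab p by (simp add: B_def turn_act_def 2 field_simps)
  next
    case 3
    have e: "r1 n = sqrt 2 * a + b" "r4 n = a + sqrt 2 * b" 
      unfolding a_def b_def step_S(3,4)[OF 3] by (simp_all add: algebra_simps sqrt2_mult)
    have "1 + sqrt 2 * (b / a) = (a + sqrt 2 * b) / a" "sqrt 2 + b / a = (sqrt 2 * a + b) / a"
      using ab by (simp_all add: field_simps)
    then show ?thesis unfolding Bn using ab p e by (simp add: B_def turn_act_def 3)
  qed
qed

lemma height_walk_tail:
  assumes "q1 N > 0"
  shows "height_walk (\<lambda>n. A (N + n)) (\<lambda>n. B (N + n)) (\<lambda>n. h (N + n))"
  unfolding height_walk_def
proof (intro allI conjI)
  fix n
  have q: "q1 (N + n) > 0" using q1_mono[of N "N + n"] assms by simp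
  show "A (N + n) > 0" using q pos(2) by (simp add: A_def)
  show "B (N + n) > 0" using pos by (simp add: B_def)
  show "\<bar>h (N + Suc n) - h (N + n)\<bar> \<le> 1" using codingD(2)[OF cod, of "N + n"] by simp
  show "A (N + Suc n) = turn_act (h (N + Suc n) - h (N + n)) (A (N + n))" using A_step[OF q] by (simp add: t_def)
  show "B (N + n) = turn_act (h (N + Suc n) - h (N + n)) (B (N + Suc n))" using B_step[of "N + n"] by (simp add: t_def)
qed

lemma appr_v1: "appr z (g n) = q1 n * r1 n"
  using pos(1,3)[of n] by (simp add: appr_def q1_def r1_def abs_mult)

lemma appr_v4: "appr z (g n * Rot) = q4 n * r4 n"
proof -
  have "appr z (g n * Rot) = \<bar>q4 n * (- r4 n)\<bar>" by (simp add: appr_def Rot_def q4_def r4_def)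
  then show ?thesis using pos(2,4)[of n] by (simp add: abs_mult)
qed

lemma height_v1: "q1 n > 0 \<Longrightarrow> A n + B n = 1 / (q1 n * r1 n)"
proof -
  assume q: "q1 n > 0"
  have "A n + B n = (q4 n * r1 n + q1 n * r4 n) / (q1 n * r1 n)"
    using q pos(3)[of n] by (simp add: A_def B_def field_simps)
  then show ?thesis unfolding det_rel .
qed

lemma height_v4: "q1 n > 0 \<Longrightarrow> 1 / A n + 1 / B n = 1 / (q4 n * r4 n)"
proof -
  assume q: "q1 n > 0"
  have "1 / A n + 1 / B n = (q4 n * r1 n + q1 n * r4 n) / (q4 n * r4 n)"
    using q pos[of n] by (simp add: A_def B_def field_simps)
  then show ?thesis unfolding det_rel .
qed

lemma approx_bound_heights:
  assumes "approx_bound z L" "\<epsilon> > 0"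
  shows "\<exists>N. \<forall>n\<ge>N. q1 n > 0 \<and> A n + B n \<le> sqrt 2 * (L + \<epsilon>) \<and> 1 / A n + 1 / B n \<le> sqrt 2 * (L + \<epsilon>)"
proof -
  obtain Q where Q: "\<And>g. g \<in> G4 \<Longrightarrow> \<bar>m21 g\<bar> \<ge> Q \<Longrightarrow> 1 / (sqrt 2 * appr z g) \<le> L + \<epsilon>"
    using assms unfolding approx_bound_def by blast
  obtain N where N: "\<forall>n\<ge>N. max Q 1 \<le> q1 n \<and> max Q 1 \<le> q4 n" using growth by blast
  have "q1 n > 0 \<and> A n + B n \<le> sqrt 2 * (L + \<epsilon>) \<and> 1 / A n + 1 / B n \<le> sqrt 2 * (L + \<epsilon>)" if "n \<ge> N" for n
  proof -
    have q: "Q \<le> q1 n" "1 \<le> q1 n" "Q \<le> q4 n" using N that by auto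
    have G: "g n \<in> G4" "g n * Rot \<in> G4" using codingD(1)[OF cod] Rot_G4 G4_times by blast+
    have "1 / (sqrt 2 * appr z (g n)) \<le> L + \<epsilon>" by (rule Q[OF G(1)]) (use q in \<open>simp add: q1_def\<close>)
    then have "sqrt 2 * (1 / (sqrt 2 * (q1 n * r1 n))) \<le> sqrt 2 * (L + \<epsilon>)"
      unfolding appr_v1 by (intro mult_left_mono) auto
    moreover have "1 / (sqrt 2 * appr z (g n * Rot)) \<le> L + \<epsilon>" by (rule Q[OF G(2)]) (use q in \<open>simp add: q4_def Rot_def\<close>)
    then have "sqrt 2 * (1 / (sqrt 2 * (q4 n * r4 n))) \<le> sqrt 2 * (L + \<epsilon>)"
      unfolding appr_v4 by (intro mult_left_mono) auto
    ultimately show ?thesis using height_v1[of n] height_v4[of n] q(2) by simp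
  qed
  then show ?thesis by blast
qed

text \<open>Bookkeeping for \<open>descent\<close>: \<open>x'\<close> and \<open>y'\<close> are the
  contributions of a vertex with a known bound to denominator and remainder of a cusp,
  \<open>u\<close> and \<open>v\<close> those of a second vertex. The four forms cover both sides of
  \<open>z\<close> and both orders of the summands.\<close>

lemma product_lower:
  fixes x y x' y' u v \<mu> :: real
  assumes "x \<le> x'" "y \<le> y'" "0 \<le> x" "0 \<le> y" "\<mu> \<le> x * y" "0 \<le> u" "0 \<le> v"
  shows "\<mu> \<le> (x' + u) * \<bar>y' + v\<bar>" "\<mu> \<le> (x' + u) * \<bar>- (y' + v)\<bar>"
    "\<mu> \<le> (u + x') * \<bar>v + y'\<bar>" "\<mu> \<le> (u + x') * \<bar>- (v + y')\<bar>"
proof -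
  have "x * y \<le> (x' + u) * (y' + v)" using assms by (intro mult_mono) auto
  then show 1: "\<mu> \<le> (x' + u) * \<bar>y' + v\<bar>" using assms by simp
  then show "\<mu> \<le> (x' + u) * \<bar>- (y' + v)\<bar>" by (simp only: abs_minus_cancel)
  show 2: "\<mu> \<le> (u + x') * \<bar>v + y'\<bar>" using 1 by (simp only: add.commute)
  then show "\<mu> \<le> (u + x') * \<bar>- (v + y')\<bar>" by (simp only: abs_minus_cancel)
qed

text \<open>A cusp beyond the next edge has smaller coordinates with respect to that edge; any other cusp
  approximates \<open>z\<close> no better than some vertex of the square between the two edges.\<close>

lemma descent:
  assumes bound: "\<And>n. n \<ge> N \<Longrightarrow> q1 n * r1 n \<ge> \<mu> \<and> q4 n * r4 n \<ge> \<mu>"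
    and "n \<ge> N" "\<gamma> \<in> G4" "m11 (adj (g n) * \<gamma>) \<ge> 0" "m21 (adj (g n) * \<gamma>) \<ge> 0"
  shows "appr z \<gamma> \<ge> \<mu>"
  using assms(2-5)
proof (induction "nat \<lfloor>(m11 (adj (g n) * \<gamma>))\<^sup>2 + (m21 (adj (g n) * \<gamma>))\<^sup>2\<rfloor>" arbitrary: n rule: less_induct)
  case less
  \<comment> \<open>The coordinates of the cusp in the basis formed by the columns of
    \<open>g n\<close>.\<close>
  define a b where "a = m11 (adj (g n) * \<gamma>)" and "b = m21 (adj (g n) * \<gamma>)"
  have ab: "a \<ge> 0" "b \<ge> 0" using less.prems by (auto simp: a_def b_def)
  note gn = codingD(1)[OF cod, of n]
  have dG: "adj (g n) * \<gamma> \<in> G4" by (intro G4_times G_adj(3) gn less.prems(2))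
  have vec: "\<gamma> = g n * (adj (g n) * \<gamma>)" using adj_cancel(1)[OF G_det(3)[OF gn]] by simp
  have q: "m21 \<gamma> = a * q1 n + b * q4 n"
    using arg_cong[OF vec, of m21] by (simp add: a_def b_def q1_def q4_def algebra_simps del: adj_sel)
  have p: "m11 \<gamma> = a * m11 (g n) + b * m12 (g n)"
    using arg_cong[OF vec, of m11] by (simp add: a_def b_def algebra_simps del: adj_sel)
  have R: "m11 \<gamma> - m21 \<gamma> * z = a * r1 n - b * r4 n"
    unfolding q p by (simp add: q1_def q4_def r1_def r4_def algebra_simps)
  have ap1: "appr z \<gamma> = (a * q1 n + b * q4 n) * \<bar>a * r1 n - b * r4 n\<bar>"
  proof -
    have "m21 \<gamma> \<ge> 0" unfolding q using ab pos(1,2)[of n] by simp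
    then have "appr z \<gamma> = m21 \<gamma> * \<bar>m11 \<gamma> - m21 \<gamma> * z\<bar>" by (simp add: appr_def abs_mult)
    then show ?thesis unfolding R unfolding q .
  qed
  have ent: "e \<ge> 1" if "e > 0" "e \<in> {m11 \<delta>, m21 \<delta>}" "\<delta> \<in> G4" for e \<delta>
    using G4_entry_ge_1[OF that(3), of e] that by blast
  note P = pos[of n]
  note b1 = bound[OF less.prems(1)]
  have b2: "q1 (Suc n) * r1 (Suc n) \<ge> \<mu>" "q4 (Suc n) * r4 (Suc n) \<ge> \<mu>" using bound[of "Suc n"] less.prems(1) by auto
  note P' = pos[of "Suc n"]
  have sqi: "\<exists>k :: int. (m11 \<delta>)\<^sup>2 + (m21 \<delta>)\<^sup>2 = of_int k" if "\<delta> \<in> G4" for \<delta>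
  proof -
    have sq: "\<exists>k :: int. e\<^sup>2 = of_int k" if e: "e \<in> {m11 \<delta>, m12 \<delta>, m21 \<delta>, m22 \<delta>}" for e
    proof -
      obtain j :: int where "e = of_int j \<or> e = of_int j * sqrt 2" using G4_entry_cases[OF \<open>\<delta> \<in> G4\<close> e] by blast
      then have "e\<^sup>2 = of_int (j\<^sup>2) \<or> e\<^sup>2 = of_int (2 * j\<^sup>2)" by (elim disjE) (simp_all add: power_mult_distrib)
      then show ?thesis by blast
    qed
    obtain k l :: int where "(m11 \<delta>)\<^sup>2 = of_int k" "(m21 \<delta>)\<^sup>2 = of_int l"
      using sq[of "m11 \<delta>"] sq[of "m21 \<delta>"] by auto
    then have "(m11 \<delta>)\<^sup>2 + (m21 \<delta>)\<^sup>2 = of_int (k + l)" by simp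
    then show ?thesis by blast
  qed
  have next_coord: "adj (g (Suc n)) * \<gamma> = adj (turn (t n)) * (adj (g n) * \<gamma>)"
    unfolding gSuc adj_mult by (simp only: mult.assoc)
  define a' b' where "a' = m11 (adj (g (Suc n)) * \<gamma>)" and "b' = m21 (adj (g (Suc n)) * \<gamma>)"
  have rec: ?case if "a' \<ge> 0" "b' \<ge> 0" "a'\<^sup>2 + b'\<^sup>2 < a\<^sup>2 + b\<^sup>2"
  proof (rule less.hyps)
    have G': "adj (g (Suc n)) * \<gamma> \<in> G4" by (intro G4_times G_adj(3) codingD(1)[OF cod] less.prems(2))
    obtain k k' :: int where k: "a\<^sup>2 + b\<^sup>2 = of_int k" "a'\<^sup>2 + b'\<^sup>2 = of_int k'"
      using sqi[OF dG] sqi[OF G'] unfolding a_def b_def a'_def b'_def by blast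
    have "k' < k" using that(3) unfolding k by simp
    moreover have "0 \<le> k'" using k(2) by (metis add_nonneg_nonneg of_int_0_le_iff zero_le_power2)
    ultimately show "nat \<lfloor>(m11 (adj (g (Suc n)) * \<gamma>))\<^sup>2 + (m21 (adj (g (Suc n)) * \<gamma>))\<^sup>2\<rfloor>
        < nat \<lfloor>(m11 (adj (g n) * \<gamma>))\<^sup>2 + (m21 (adj (g n) * \<gamma>))\<^sup>2\<rfloor>"
      unfolding a_def[symmetric] b_def[symmetric] a'_def[symmetric] b'_def[symmetric] k by simp
    show "N \<le> Suc n" using less.prems(1) by simp
    show "\<gamma> \<in> G4" by (rule less.prems(2))
    show "0 \<le> m11 (adj (g (Suc n)) * \<gamma>)" "0 \<le> m21 (adj (g (Suc n)) * \<gamma>)" using that by (simp_all add: a'_def b'_def)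
  qed
  have det: "a * m22 (adj (g n) * \<gamma>) - m12 (adj (g n) * \<gamma>) * b = 1"
    using G_det(3)[OF dG] by (simp add: det2_def a_def b_def del: mat2_sel_times adj_sel)
  \<comment> \<open>Coordinates with respect to an edge are entries of an element of
    \<open>G4\<close>, so a nonnegative one is 0 or at least 1. The facts up to \<open>eS\<close>
    say this for the edge itself and for the other edges of the square.\<close>
  have a1: "a = 0 \<or> a \<ge> 1" using ent[of a, OF _ _ dG] ab by (fastforce simp: a_def)
  have b1': "b = 0 \<or> b \<ge> 1" using ent[of b, OF _ _ dG] ab by (fastforce simp: b_def)
  have x1: "e = 0 \<or> e \<ge> 1" if "e \<ge> 0" "e \<in> {m11 (adj (turn s) * (adj (g n) * \<gamma>)), m21 (adj (turn s) * (adj (g n) * \<gamma>))}" for e s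
    using ent[of e, OF _ that(2) G4_times[OF G_adj(3)[OF turn_G4] dG]] that(1) by fastforce
  have cL: "m11 (adj (turn 1) * (adj (g n) * \<gamma>)) = a - sqrt 2 * b" "m21 (adj (turn 1) * (adj (g n) * \<gamma>)) = b"
    unfolding mat2_sel_times(1,3)[of "adj (turn 1)" "adj (g n) * \<gamma>"] a_def[symmetric] b_def[symmetric]
    by (simp_all add: turn_simps)
  have cR: "m11 (adj (turn (-1)) * (adj (g n) * \<gamma>)) = a" "m21 (adj (turn (-1)) * (adj (g n) * \<gamma>)) = b - sqrt 2 * a"
    unfolding mat2_sel_times(1,3)[of "adj (turn (-1))" "adj (g n) * \<gamma>"] a_def[symmetric] b_def[symmetric]
    by (simp_all add: turn_simps)
  have cS: "m11 (adj (turn 0) * (adj (g n) * \<gamma>)) = sqrt 2 * a - b" "m21 (adj (turn 0) * (adj (g n) * \<gamma>)) = sqrt 2 * b - a"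
    unfolding mat2_sel_times(1,3)[of "adj (turn 0)" "adj (g n) * \<gamma>"] a_def[symmetric] b_def[symmetric]
    by (simp_all add: turn_simps)
  have eL: "a - sqrt 2 * b = 0 \<or> a - sqrt 2 * b \<ge> 1" if "a \<ge> sqrt 2 * b" using x1[of "a - sqrt 2 * b" 1] cL that by simp
  have eR: "b - sqrt 2 * a = 0 \<or> b - sqrt 2 * a \<ge> 1" if "b \<ge> sqrt 2 * a" using x1[of "b - sqrt 2 * a" "-1"] cR that by simp
  have eS: "sqrt 2 * a - b \<ge> 1" "sqrt 2 * b - a \<ge> 1" if "b < sqrt 2 * a" "a < sqrt 2 * b"
    using x1[of "sqrt 2 * a - b" 0] x1[of "sqrt 2 * b - a" 0] cS that by auto
  have ge1: "k * x \<ge> x" if "k \<ge> 1" "x \<ge> 0" for k x :: real using mult_right_mono[OF that] by simp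
  have s2: "sqrt 2 * (sqrt 2 * x) = 2 * x" for x by (rule sqrt2_mult)
  show ?case
  proof (cases "b = 0 \<or> a = 0")
    case True
    then show ?thesis
    proof
      assume b0: "b = 0"
      then have "a \<ge> 1" using a1 det by auto
      then have "a * q1 n \<ge> q1 n" "a * r1 n \<ge> r1 n" using P ge1 by simp_all
      moreover have "appr z \<gamma> = (a * q1 n) * (a * r1 n)" unfolding ap1 b0 using P ab by simp
      ultimately show ?thesis using product_lower(1)[of "q1 n" "a * q1 n" "r1 n" "a * r1 n" \<mu> 0 0] P b1 ab by simp
    next
      assume a0: "a = 0"
      then have "b \<ge> 1" using b1' det by auto
      then have "b * q4 n \<ge> q4 n" "b * r4 n \<ge> r4 n" using P ge1 by simp_all
      moreover have "appr z \<gamma> = (b * q4 n) * (b * r4 n)" unfolding ap1 a0 using P ab by simp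
      ultimately show ?thesis using product_lower(1)[of "q4 n" "b * q4 n" "r4 n" "b * r4 n" \<mu> 0 0] P b1 ab by simp
    qed
  next
    case False
    then have ab1: "a \<ge> 1" "b \<ge> 1" using a1 b1' by auto
    consider "t n = 1" | "t n = -1" | "t n = 0" using t_cases by blast
    then show ?thesis
    proof cases
      case 1
      note s = step_L[OF 1]
      have c': "a' = a - sqrt 2 * b" "b' = b" unfolding a'_def b'_def next_coord 1 cL by simp_all
      show ?thesis
      proof (cases "a \<ge> sqrt 2 * b")
        case True
        have "sqrt 2 * b > 0" using ab1 by simp
        then have "(a - sqrt 2 * b)\<^sup>2 < a\<^sup>2" using True by (intro power_strict_mono) auto
        then show ?thesis using rec True ab unfolding c' by simp
      next
        case F: False
        define r2 q2 where "r2 = r4 (Suc n)" and "q2 = q4 (Suc n)"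
        have rr: "r4 n = r2 + sqrt 2 * r1 n" using s by (simp add: r2_def)
        have qq: "q2 = sqrt 2 * q1 n + q4 n" using s by (simp add: q2_def)
        have r2: "r2 > 0" "q2 > 0" "q2 * r2 \<ge> \<mu>" using P' b2 by (auto simp: r2_def q2_def)
        have r3: "sqrt 2 * r4 n - r1 n > 0"
        proof -
          have "sqrt 2 * r4 n - r1 n = sqrt 2 * r2 + r1 n" unfolding rr by (simp add: distrib_left s2)
          then show ?thesis using r2 P by (simp add: add_pos_pos)
        qed
        show ?thesis
        proof (cases "b \<ge> sqrt 2 * a")
          case True
          define c where "c = b - sqrt 2 * a"
          have bc: "b = c + sqrt 2 * a" and c01: "c = 0 \<or> c \<ge> 1" using eR[OF True] by (auto simp: c_def)
          have ap: "appr z \<gamma> = (a * (q1 n + sqrt 2 * q4 n) + c * q4 n) * \<bar>- (a * (sqrt 2 * r4 n - r1 n) + c * r4 n)\<bar>"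
            unfolding ap1 bc by (simp add: algebra_simps)
          have c0: "c \<ge> 0" using c01 by auto
          have nn: "a * (sqrt 2 * r4 n - r1 n) \<ge> 0" "c * r4 n \<ge> 0" "a * (q1 n + sqrt 2 * q4 n) \<ge> 0" "c * q4 n \<ge> 0"
            using ab P c0 r3 by (auto intro: mult_nonneg_nonneg)
          from c01 show ?thesis
          proof
            assume "c = 0"
            have ar: "a * (sqrt 2 * r4 n - r1 n) \<ge> sqrt 2 * r4 n - r1 n" "a * (q1 n + sqrt 2 * q4 n) \<ge> q1 n + sqrt 2 * q4 n"
              using ge1[of a "sqrt 2 * r4 n - r1 n"] ge1[of a "q1 n + sqrt 2 * q4 n"] ab1 r3 P by simp_all
            \<comment> \<open>For \<open>c = 0\<close> the cusp is a multiple of the one vertex of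
              the square that is on neither of the two edges. \<open>sqrt 2\<close> times that
              vertex is the sum of its two neighbours, both of which are end points of edges of the
              path.\<close>
            have "(q1 n + sqrt 2 * q4 n) * (sqrt 2 * r4 n - r1 n) = ((sqrt 2 * q1 n + q4 n) + q4 n) * (r2 + r4 n) / 2"
              unfolding rr by (simp add: algebra_simps s2)
            also have "\<dots> = (q2 * r2 + q4 n * r4 n + (q2 * r4 n + q4 n * r2)) / 2" unfolding qq by (simp add: algebra_simps)
            also have "\<dots> \<ge> \<mu>"
            proof -
              have "q2 * r4 n \<ge> 0" "q4 n * r2 \<ge> 0" using r2 P by (auto intro!: mult_nonneg_nonneg)
              then have "2 * \<mu> \<le> q2 * r2 + q4 n * r4 n + (q2 * r4 n + q4 n * r2)" using r2(3) conjunct2[OF b1] by linarith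
              then show ?thesis by simp
            qed
            finally have m: "\<mu> \<le> (q1 n + sqrt 2 * q4 n) * (sqrt 2 * r4 n - r1 n)" .
            have "q1 n + sqrt 2 * q4 n \<ge> 0" using P by simp
            from product_lower(2)[OF ar(2,1) this less_imp_le[OF r3] m nn(4,2)] show ?thesis unfolding ap .
          next
            assume "c \<ge> 1"
            then have "c * q4 n \<ge> q4 n" "c * r4 n \<ge> r4 n" using ge1[OF \<open>c \<ge> 1\<close>] P by simp_all
            from product_lower(4)[OF this less_imp_le[OF P(2)] less_imp_le[OF P(4)] conjunct2[OF b1] nn(3,1)]
            show ?thesis unfolding ap .
          qed
        next
          case F2: False
          have e: "sqrt 2 * a - b \<ge> 1" "sqrt 2 * b - a \<ge> 1" using eS F F2 by auto
          \<comment> \<open>Coordinates with respect to the edge opposite to \<open>g n\<close>,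
            whose first end point is on the path.\<close>
          define x y where "x = sqrt 2 * a - b" and "y = sqrt 2 * b - a"
          have axy: "a = sqrt 2 * x + y" "b = x + sqrt 2 * y" by (simp_all add: x_def y_def algebra_simps s2)
          have ap: "appr z \<gamma> = (x * q2 + y * (q1 n + sqrt 2 * q4 n)) * \<bar>- (x * r2 + y * (sqrt 2 * r4 n - r1 n))\<bar>"
            unfolding ap1 axy qq rr by (simp add: algebra_simps s2)
          have "x * q2 \<ge> q2" "x * r2 \<ge> r2" by (intro ge1) (use e(1) r2 in \<open>auto simp: x_def\<close>)
          moreover have "y * (q1 n + sqrt 2 * q4 n) \<ge> 0" "y * (sqrt 2 * r4 n - r1 n) \<ge> 0"
            using e(2) r3 P by (auto simp: y_def intro!: mult_nonneg_nonneg)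
          ultimately show ?thesis unfolding ap
            by (rule product_lower(2)[OF _ _ less_imp_le[OF r2(2)] less_imp_le[OF r2(1)] r2(3)])
        qed
      qed
    next
      case 2
      \<comment> \<open>The mirror image of the left turn: the two end points exchange their
        roles.\<close>
      note s = step_R[OF 2]
      have c': "a' = a" "b' = b - sqrt 2 * a" unfolding a'_def b'_def next_coord 2 cR by simp_all
      show ?thesis
      proof (cases "b \<ge> sqrt 2 * a")
        case True
        have "sqrt 2 * a > 0" using ab1 by simp
        then have "(b - sqrt 2 * a)\<^sup>2 < b\<^sup>2" using True by (intro power_strict_mono) auto
        then show ?thesis using rec True ab unfolding c' by simp
      next
        case F: False
        define r3 q3 where "r3 = r1 (Suc n)" and "q3 = q1 (Suc n)"
        have rr: "r1 n = r3 + sqrt 2 * r4 n" using s by (simp add: r3_def)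
        have qq: "q3 = q1 n + sqrt 2 * q4 n" using s by (simp add: q3_def)
        have r3: "r3 > 0" "q3 > 0" "q3 * r3 \<ge> \<mu>" using P' b2 P by (auto simp: r3_def q3_def s intro!: add_nonneg_pos)
        have r2: "sqrt 2 * r1 n - r4 n > 0"
        proof -
          have "sqrt 2 * r1 n - r4 n = sqrt 2 * r3 + r4 n" unfolding rr by (simp add: distrib_left s2)
          then show ?thesis using r3 P by (simp add: add_pos_pos)
        qed
        show ?thesis
        proof (cases "a \<ge> sqrt 2 * b")
          case True
          define c where "c = a - sqrt 2 * b"
          have bc: "a = c + sqrt 2 * b" and c01: "c = 0 \<or> c \<ge> 1" using eL[OF True] by (auto simp: c_def)
          have ap: "appr z \<gamma> = (b * (sqrt 2 * q1 n + q4 n) + c * q1 n) * \<bar>b * (sqrt 2 * r1 n - r4 n) + c * r1 n\<bar>"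
            unfolding ap1 bc by (simp add: algebra_simps)
          have c0: "c \<ge> 0" using c01 by auto
          have nn: "b * (sqrt 2 * r1 n - r4 n) \<ge> 0" "c * r1 n \<ge> 0" "b * (sqrt 2 * q1 n + q4 n) \<ge> 0" "c * q1 n \<ge> 0"
            using ab P c0 r2 by (auto intro: mult_nonneg_nonneg)
          from c01 show ?thesis
          proof
            assume "c = 0"
            have ar: "b * (sqrt 2 * r1 n - r4 n) \<ge> sqrt 2 * r1 n - r4 n" "b * (sqrt 2 * q1 n + q4 n) \<ge> sqrt 2 * q1 n + q4 n"
              using ge1[of b "sqrt 2 * r1 n - r4 n"] ge1[of b "sqrt 2 * q1 n + q4 n"] ab1 r2 P by simp_all
            have "(sqrt 2 * q1 n + q4 n) * (sqrt 2 * r1 n - r4 n) = ((q1 n + sqrt 2 * q4 n) + q1 n) * (r3 + r1 n) / 2"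
              unfolding rr by (simp add: algebra_simps s2)
            also have "\<dots> = (q3 * r3 + q1 n * r1 n + (q3 * r1 n + q1 n * r3)) / 2" unfolding qq by (simp add: algebra_simps)
            also have "\<dots> \<ge> \<mu>"
            proof -
              have "q3 * r1 n \<ge> 0" "q1 n * r3 \<ge> 0" using r3 P by (auto intro!: mult_nonneg_nonneg)
              then have "2 * \<mu> \<le> q3 * r3 + q1 n * r1 n + (q3 * r1 n + q1 n * r3)" using r3(3) conjunct1[OF b1] by linarith
              then show ?thesis by simp
            qed
            finally have m: "\<mu> \<le> (sqrt 2 * q1 n + q4 n) * (sqrt 2 * r1 n - r4 n)" .
            have "sqrt 2 * q1 n + q4 n \<ge> 0" using P by simp
            from product_lower(1)[OF ar(2,1) this less_imp_le[OF r2] m nn(4,2)] show ?thesis unfolding ap .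
          next
            assume "c \<ge> 1"
            then have "c * q1 n \<ge> q1 n" "c * r1 n \<ge> r1 n" using ge1[OF \<open>c \<ge> 1\<close>] P by simp_all
            from product_lower(3)[OF this P(1) less_imp_le[OF P(3)] conjunct1[OF b1] nn(3,1)]
            show ?thesis unfolding ap .
          qed
        next
          case F2: False
          have e: "sqrt 2 * a - b \<ge> 1" "sqrt 2 * b - a \<ge> 1" using eS F F2 by auto
          define x y where "x = sqrt 2 * a - b" and "y = sqrt 2 * b - a"
          have axy: "a = sqrt 2 * x + y" "b = x + sqrt 2 * y" by (simp_all add: x_def y_def algebra_simps s2)
          have ap: "appr z \<gamma> = (y * q3 + x * (sqrt 2 * q1 n + q4 n)) * \<bar>y * r3 + x * (sqrt 2 * r1 n - r4 n)\<bar>"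
            unfolding ap1 axy qq rr by (simp add: algebra_simps s2)
          have "y * q3 \<ge> q3" "y * r3 \<ge> r3" by (intro ge1) (use e(2) r3 in \<open>auto simp: y_def\<close>)
          moreover have "x * (sqrt 2 * q1 n + q4 n) \<ge> 0" "x * (sqrt 2 * r1 n - r4 n) \<ge> 0"
            using e(1) r2 P by (auto simp: x_def intro!: mult_nonneg_nonneg)
          ultimately show ?thesis unfolding ap
            by (rule product_lower(1)[OF _ _ less_imp_le[OF r3(2)] less_imp_le[OF r3(1)] r3(3)])
        qed
      qed
    next
      case 3
      note s = step_S[OF 3]
      have c': "a' = sqrt 2 * a - b" "b' = sqrt 2 * b - a" unfolding a'_def b'_def next_coord 3 cS by simp_all
      have q': "q1 (Suc n) > 0" "q4 (Suc n) > 0" using P s by (auto intro: add_nonneg_pos)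
      consider "a \<ge> sqrt 2 * b" | "b \<ge> sqrt 2 * a" | "a < sqrt 2 * b" "b < sqrt 2 * a" by linarith
      then show ?thesis
      proof cases
        case T: 1
        define c where "c = a - sqrt 2 * b"
        have bc: "a = c + sqrt 2 * b" and c01: "c = 0 \<or> c \<ge> 1" using eL[OF T] by (auto simp: c_def)
        have ap: "appr z \<gamma> = (b * q1 (Suc n) + c * q1 n) * \<bar>b * r1 (Suc n) + c * r1 n\<bar>"
          unfolding ap1 bc s by (simp add: algebra_simps)
        have bb: "b * q1 (Suc n) \<ge> q1 (Suc n)" "b * r1 (Suc n) \<ge> r1 (Suc n)" by (intro ge1) (use ab1 q' P' in auto)
        from c01 show ?thesis
        proof
          assume "c = 0"
          then have "0 \<le> c * q1 n" "0 \<le> c * r1 n" by simp_all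
          from product_lower(1)[OF bb less_imp_le[OF q'(1)] less_imp_le[OF P'(3)] b2(1) this]
          show ?thesis unfolding ap .
        next
          assume "c \<ge> 1"
          then have "c * q1 n \<ge> q1 n" "c * r1 n \<ge> r1 n" using ge1[OF \<open>c \<ge> 1\<close>] P by simp_all
          moreover have "0 \<le> b * q1 (Suc n)" "0 \<le> b * r1 (Suc n)" using ab P' by simp_all
          ultimately show ?thesis unfolding ap
            by (intro product_lower(3)[OF _ _ P(1) less_imp_le[OF P(3)] conjunct1[OF b1]])
        qed
      next
        case T: 2
        define c where "c = b - sqrt 2 * a"
        have bc: "b = c + sqrt 2 * a" and c01: "c = 0 \<or> c \<ge> 1" using eR[OF T] by (auto simp: c_def)
        have ap: "appr z \<gamma> = (a * q4 (Suc n) + c * q4 n) * \<bar>- (a * r4 (Suc n) + c * r4 n)\<bar>"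
          unfolding ap1 bc s by (simp add: algebra_simps)
        have bb: "a * q4 (Suc n) \<ge> q4 (Suc n)" "a * r4 (Suc n) \<ge> r4 (Suc n)" by (intro ge1) (use ab1 q' P' in auto)
        from c01 show ?thesis
        proof
          assume "c = 0"
          then have "0 \<le> c * q4 n" "0 \<le> c * r4 n" by simp_all
          from product_lower(2)[OF bb less_imp_le[OF q'(2)] less_imp_le[OF P'(4)] b2(2) this]
          show ?thesis unfolding ap .
        next
          assume "c \<ge> 1"
          then have "c * q4 n \<ge> q4 n" "c * r4 n \<ge> r4 n" using ge1[OF \<open>c \<ge> 1\<close>] P by simp_all
          moreover have "0 \<le> a * q4 (Suc n)" "0 \<le> a * r4 (Suc n)" using ab P'(2,4) by simp_all
          ultimately show ?thesis unfolding ap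
            by (intro product_lower(4)[OF _ _ less_imp_le[OF P(2)] less_imp_le[OF P(4)] conjunct2[OF b1]])
        qed
      next
        case M: 3
        \<comment> \<open>Decrease of the measure: it requires
          \<open>2 * (a * a + b * b) < 4 * (sqrt 2 * (a * b))\<close>, and the positive product
          gives this even with 3 instead of 4.\<close>
        have "0 < (sqrt 2 * b - a) * (sqrt 2 * a - b)" using M by simp
        then have "sqrt 2 * (a * a + b * b) < 3 * (a * b)" by (simp add: algebra_simps s2)
        then have "sqrt 2 * (sqrt 2 * (a * a + b * b)) < sqrt 2 * (3 * (a * b))" by (intro mult_strict_left_mono) auto
        then have "2 * (a * a + b * b) < 3 * (sqrt 2 * (a * b))" by (simp add: s2)
        moreover have "sqrt 2 * (a * b) > 0" using ab1 by (intro mult_pos_pos) auto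
        ultimately have "2 * (a * a + b * b) < 4 * (sqrt 2 * (a * b))" by linarith
        then have "(sqrt 2 * a - b)\<^sup>2 + (sqrt 2 * b - a)\<^sup>2 < a\<^sup>2 + b\<^sup>2"
          by (simp add: power2_eq_square algebra_simps s2)
        then show ?thesis using rec M unfolding c' by simp
      qed
    qed
  qed
qed

text \<open>A cusp within \<open>\<eta>\<close> of \<open>z\<close> lies between the end points of
  the edge at time \<open>M\<close>, so its coordinates are nonnegative and \<open>descent\<close>
  applies. For a cusp farther away \<open>appr\<close> is at least the squared denominator times
  \<open>\<eta>\<close>, which the choice of \<open>Q\<close> makes large enough.\<close>

lemma cusp_heights_le:
  assumes H: "H > 0" and bound: "\<And>n. n \<ge> N \<Longrightarrow> A n + B n \<le> H \<and> 1 / A n + 1 / B n \<le> H"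
    and irr: "z / sqrt 2 \<notin> \<rat>"
  shows "\<exists>Q. \<forall>\<gamma>\<in>G4. \<bar>m21 \<gamma>\<bar> \<ge> Q \<longrightarrow> 1 / appr z \<gamma> \<le> H"
proof -
  obtain N1 where "\<forall>n\<ge>N1. 1 \<le> q1 n \<and> 1 \<le> q4 n" using growth by blast
  then obtain M where M: "M \<ge> N" "\<And>n. n \<ge> M \<Longrightarrow> q1 n \<ge> 1" by (metis max.bounded_iff max.cobounded1)
  define \<mu> where "\<mu> = 1 / H"
  have bd: "q1 n * r1 n \<ge> \<mu> \<and> q4 n * r4 n \<ge> \<mu>" if "n \<ge> M" for n
  proof -
    have q: "q1 n > 0" using M(2)[OF that] by simp
    have "1 / (q1 n * r1 n) \<le> H" "1 / (q4 n * r4 n) \<le> H"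
      using bound[of n] height_v1[OF q] height_v4[OF q] that M(1) by auto
    moreover have "q1 n * r1 n > 0" "q4 n * r4 n > 0" using q pos[of n] by auto
    ultimately show ?thesis unfolding \<mu>_def using H by (simp add: field_simps)
  qed
  define \<eta> where "\<eta> = min (r1 M / q1 M) (r4 M / q4 M)"
  have qM: "q1 M > 0" using M(2)[of M] by simp
  have \<eta>: "\<eta> > 0" unfolding \<eta>_def using qM pos[of M] by simp
  define Q where "Q = max 1 (\<mu> / \<eta>)"
  have mu: "\<mu> > 0" using H by (simp add: \<mu>_def)
  have main: "appr z \<gamma> \<ge> \<mu>" if G: "\<gamma> \<in> G4" and q: "m21 \<gamma> \<ge> Q" for \<gamma>
  proof (rule ccontr)
    assume "\<not> appr z \<gamma> \<ge> \<mu>"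
    have q1: "m21 \<gamma> \<ge> 1" "m21 \<gamma> \<ge> \<mu> / \<eta>" using q by (auto simp: Q_def)
    define x where "x = m11 \<gamma> / m21 \<gamma>"
    have p: "m11 \<gamma> = x * m21 \<gamma>" using q1 by (simp add: x_def)
    have "m11 \<gamma> - m21 \<gamma> * z = m21 \<gamma> * (x - z)" by (simp add: p algebra_simps)
    then have "appr z \<gamma> = m21 \<gamma> * (m21 \<gamma> * \<bar>x - z\<bar>)" using q1 by (simp add: appr_def abs_mult)
    then have "m21 \<gamma> * (m21 \<gamma> * \<bar>x - z\<bar>) < \<mu>" using \<open>\<not> appr z \<gamma> \<ge> \<mu>\<close> by simp
    also have "\<mu> \<le> m21 \<gamma> * \<eta>" using q1(2) \<eta> by (simp add: field_simps)
    finally have "m21 \<gamma> * \<bar>x - z\<bar> < \<eta>" using q1 by simp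
    moreover have "\<bar>x - z\<bar> \<le> m21 \<gamma> * \<bar>x - z\<bar>" using mult_right_mono[OF q1(1), of "\<bar>x - z\<bar>"] by simp
    ultimately have xz: "\<bar>x - z\<bar> < \<eta>" by linarith
    have "appr z \<gamma> \<ge> \<mu>"
    proof (rule descent[OF bd order_refl G])
      have "\<bar>x - z\<bar> < r4 M / q4 M" using xz by (simp add: \<eta>_def)
      then have "x - z > - (r4 M / q4 M)" by linarith
      then have "q4 M * (x - z) > - r4 M" using pos(2)[of M] by (simp add: field_simps)
      then have "q4 M * x - m12 (g M) > 0" by (simp add: r4_def q4_def algebra_simps)
      then have "m21 \<gamma> * (q4 M * x - m12 (g M)) \<ge> 0" using q1 by simp
      then show "0 \<le> m11 (adj (g M) * \<gamma>)" by (simp add: p q4_def algebra_simps)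
      have "\<bar>x - z\<bar> < r1 M / q1 M" using xz by (simp add: \<eta>_def)
      then have "x - z < r1 M / q1 M" by linarith
      then have "q1 M * (x - z) < r1 M" using qM by (simp add: field_simps)
      then have "m11 (g M) - q1 M * x > 0" by (simp add: r1_def q1_def algebra_simps)
      then have "m21 \<gamma> * (m11 (g M) - q1 M * x) \<ge> 0" using q1 by simp
      then show "0 \<le> m21 (adj (g M) * \<gamma>)" by (simp add: p q1_def algebra_simps)
    qed
    then show False using \<open>\<not> appr z \<gamma> \<ge> \<mu>\<close> by simp
  qed
  have "1 / appr z \<gamma> \<le> H" if G: "\<gamma> \<in> G4" and q: "\<bar>m21 \<gamma>\<bar> \<ge> Q" for \<gamma>
  proof -
    have "appr z \<gamma> \<ge> \<mu>"
    proof (cases "m21 \<gamma> \<ge> 0")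
      case True then show ?thesis using main[OF G] q by simp
    next
      case False
      have "appr z (neg \<gamma>) = \<bar>(- m21 \<gamma>) * - (m11 \<gamma> - m21 \<gamma> * z)\<bar>" by (simp add: appr_def)
      then have "appr z (neg \<gamma>) = appr z \<gamma>" by (simp only: appr_def minus_mult_minus)
      then show ?thesis using main[OF neg_G4[OF G]] q False by simp
    qed
    then have p: "appr z \<gamma> > 0" using mu by linarith
    have "1 \<le> H * appr z \<gamma>" using \<open>appr z \<gamma> \<ge> \<mu>\<close> H by (simp add: \<mu>_def field_simps)
    then show ?thesis using p by (simp add: divide_le_eq)
  qed
  then show ?thesis by blast
qed

end

text \<open>The parity of the reduced denominator selects the coset: \<open>G1\<close> for an odd
  one, \<open>G0\<close> for an even one. Bezout coefficients form the second column.\<close>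

lemma cusp_exists:
  fixes k l :: int assumes "l \<noteq> 0"
  shows "\<exists>g\<in>G4. m21 g \<noteq> 0 \<and> m11 g / m21 g = sqrt 2 * (of_int k / of_int l)"
proof -
  have g0: "gcd k l \<noteq> 0" using assms by simp
  obtain k' l' where kl: "k = k' * gcd k l" "l = l' * gcd k l" "coprime k' l'" using gcd_coprime_exists[OF g0] by blast
  have l': "l' \<noteq> 0" using kl(2) assms by auto
  have "real_of_int k = of_int k' * of_int (gcd k l)" "real_of_int l = of_int l' * of_int (gcd k l)"
    using kl(1,2) by (metis of_int_mult)+
  then have e: "real_of_int k / of_int l = of_int k' / of_int l'" using g0 by simp
  show ?thesis
  proof (cases "odd l'")
    case True
    then have "coprime (2 * k') l'" using kl(3) by (simp add: coprime_mult_left_iff)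
    then obtain u v where uv: "u * (2 * k') + v * l' = 1" using bezout_int[of "2 * k'" l'] by (metis coprime_iff_gcd_eq_1)
    define g where "g = Mat (of_int k' * sqrt 2) (of_int (- v)) (of_int l') (of_int u * sqrt 2)"
    have "det2 g = of_int (u * (2 * k') + v * l')" by (simp add: g_def det2_def mult_sqrt2 algebra_simps)
    then have "g \<in> G1" unfolding g_def by (intro G1_intro[OF _ refl]) (simp add: uv)
    moreover have "m11 g / m21 g = sqrt 2 * (of_int k / of_int l)" unfolding e by (simp add: g_def)
    ultimately show ?thesis using l' unfolding G4_def by (intro bexI[of _ g]) (auto simp: g_def)
  next
    case False
    then obtain j where j: "l' = 2 * j" by blast
    then obtain u v where uv: "u * k' + v * (2 * j) = 1" using bezout_int[of k' "2 * j"] kl(3) by (metis coprime_iff_gcd_eq_1)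
    define g where "g = Mat (of_int k') (of_int (- v) * sqrt 2) (of_int j * sqrt 2) (of_int u)"
    have "det2 g = of_int (u * k' + v * (2 * j))" by (simp add: g_def det2_def mult_sqrt2 algebra_simps)
    then have "g \<in> G0" unfolding g_def by (intro G0_intro[OF _ refl]) (simp add: uv)
    moreover have "m11 g / m21 g = sqrt 2 * (of_int k / of_int l)"
      unfolding e using l' by (simp add: g_def j field_simps)
    ultimately show ?thesis using l' j unfolding G4_def by (intro bexI[of _ g]) (auto simp: g_def)
  qed
qed

section \<open>Fixed points of Christoffel matrices\<close>

lemma formval_form: "formval T g = m21 T * (m11 g)\<^sup>2 + (m22 T - m11 T) * m11 g * m21 g - m12 T * (m21 g)\<^sup>2"
  by (simp add: formval_def algebra_simps power2_eq_square)

text \<open>Otherwise \<open>z\<close> would be a cusp fixed by \<open>T\<close>. Moving it to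
  infinity gives a conjugate of \<open>T\<close> with vanishing lower left entry, against
  \<open>trace_gt_2_m21\<close>.\<close>

lemma fixed_irrational:
  assumes T: "T \<in> G4" "\<bar>tr2 T\<bar> > 2" and fix_z: "m21 T * z\<^sup>2 + (m22 T - m11 T) * z - m12 T = 0"
  shows "z / sqrt 2 \<notin> \<rat>"
proof
  assume "z / sqrt 2 \<in> \<rat>"
  then obtain k l :: int where kl: "l > 0" "z / sqrt 2 = of_int k / of_int l" by (metis Rats_cases')
  then have "z = sqrt 2 * (of_int k / of_int l)" by (simp add: field_simps)
  then obtain g where g: "g \<in> G4" "m21 g \<noteq> 0" "m11 g / m21 g = z" using cusp_exists[of l k] kl(1) by auto
  then have p: "m11 g = z * m21 g" by (simp add: field_simps)
  have "formval T g = (m21 T * z\<^sup>2 + (m22 T - m11 T) * z - m12 T) * (m21 g)\<^sup>2"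
    unfolding formval_form p by (simp add: algebra_simps power2_eq_square)
  then have "m21 (adj g * T * g) = 0" unfolding fix_z by (simp add: formval_def)
  moreover have "tr2 (adj g * T * g) = tr2 T" using tr2_conj[of "adj g" T] G_det(3)[OF g(1)] by simp
  ultimately show False
    using trace_gt_2_m21[OF G4_times[OF G4_times[OF G_adj(3)[OF g(1)] T(1)] g(1)]] T(2) by simp
qed

text \<open>The inverse of \<open>T\<close> also fixes \<open>z\<close>, with the negative form.
  This makes \<open>not_approx_bound\<close> applicable to whichever of the two matrices shrinks
  \<open>lin\<close>.\<close>

lemma (in fixed_point) dual: "fixed_point (adj T) z m g0"
proof
  show "adj T \<in> G0 \<or> adj T \<in> G1" using T G_adj by blast
  show "tr2 (adj T) = 2 * sqrt 2 * m" using tr by (simp add: tr2_def)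
  have "adj g0 * adj T * g0 = adj (adj g0 * T * g0)" by (simp add: adj_mult mult.assoc)
  then have "formval (adj T) g0 = - formval T g0" by (simp only: formval_def adj_sel)
  then show "\<bar>formval (adj T) g0\<bar> = m" using g0 by simp
  show "m21 (adj T) * z\<^sup>2 + (m22 (adj T) - m11 (adj T)) * z - m12 (adj T) = 0"
    using fix_z by (simp add: algebra_simps)
qed (use m1 g0 irr in auto)

lemma (in fixed_point) not_approx_bound_less:
  assumes L: "0 \<le> L" "L < Lval" shows "\<not> approx_bound z L"
proof (cases "\<bar>m11 T - m21 T * z\<bar> < 1")
  case True then show ?thesis by (rule not_approx_bound[OF _ L])
next
  case False
  \<comment> \<open>The two eigenvalues: their product is 1 and their sum exceeds 2, so one of them
    is below 1 in absolute value.\<close>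
  define a b where "a = m11 T - m21 T * z" and "b = m22 T + m21 T * z"
  have "a * b = m11 T * m22 T - (m21 T * z\<^sup>2 + (m22 T - m11 T) * z) * m21 T"
    unfolding a_def b_def by (simp add: algebra_simps power2_eq_square)
  then have ab: "a * b = 1" unfolding b_eq[symmetric] using detT by (simp add: mult.commute)
  have sum: "a + b > 2" using tr_gt by (simp add: a_def b_def tr2_def)
  have "\<bar>b\<bar> < 1"
  proof (rule ccontr)
    assume "\<not> \<bar>b\<bar> < 1"
    then have g: "\<bar>a\<bar> \<ge> 1" "\<bar>b\<bar> \<ge> 1" using False by (simp_all add: a_def)
    have "0 \<le> (\<bar>a\<bar> - 1) * (\<bar>b\<bar> - 1)" using g by simp
    moreover have "\<bar>a\<bar> * \<bar>b\<bar> = 1" using ab by (metis abs_mult abs_one)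
    ultimately have "\<bar>a\<bar> + \<bar>b\<bar> \<le> 2" by (simp add: algebra_simps)
    then show False using sum by linarith
  qed
  then have "\<bar>m11 (adj T) - m21 (adj T) * z\<bar> < 1" by (simp add: b_def)
  then show ?thesis by (rule fixed_point.not_approx_bound[OF dual _ L])
qed

lemma fixed_point_christoffel:
  assumes c: "christoffel_word c" and E: "E \<in> G4" and T: "T = E * word_mat c * adj E"
    and fix_z: "m21 T * z\<^sup>2 + (m22 T - m11 T) * z - m12 T = 0"
  shows "fixed_point T z (mval c) (E * adj (letter False))"
proof -
  have dE: "det2 E = 1" by (rule G_det(3)[OF E])
  have par: "word_mat c \<in> G0 \<or> word_mat c \<in> G1" using word_mat_parity[of c] by (auto split: if_splits)
  have TG: "T \<in> G0 \<or> T \<in> G1"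
    using par G0_conj[OF G_adj(3)[OF E], of "word_mat c"] G1_conj[OF G_adj(3)[OF E], of "word_mat c"] by (auto simp: T)
  have tr: "tr2 T = 2 * sqrt 2 * mval c" unfolding T tr2_conj[OF dE] by (rule tr2_mval)
  have "2 * 1 < 2 * sqrt 2 * (1::real)" by simp
  also have "\<dots> \<le> 2 * sqrt 2 * mval c" using christoffel_word_props(2)[OF c] by (intro mult_left_mono) auto
  finally have tr2: "\<bar>tr2 T\<bar> > 2" unfolding tr by simp
  have lG: "letter False \<in> G4" using letter_G1 by (simp add: G4_def)
  show ?thesis
  proof
    show "T \<in> G0 \<or> T \<in> G1" by (rule TG)
    show "tr2 T = 2 * sqrt 2 * mval c" by (rule tr)
    show "1 \<le> mval c" by (rule christoffel_word_props(2)[OF c])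
    show "E * adj (letter False) \<in> G4" using E lG by (intro G4_times G_adj)
    have "formval T (E * adj (letter False)) = formval (word_mat c) (adj (letter False))"
      unfolding T by (rule formval_conj[OF dE])
    also have "\<dots> = mval c" using christoffel_word_props(1)[OF c] by (simp add: formval_def cusp_ok_def cuspval_def del: mat2_sel_times)
    finally show "\<bar>formval T (E * adj (letter False))\<bar> = mval c" using christoffel_word_props(2)[OF c] by simp
    show "z / sqrt 2 \<notin> \<rat>" using TG by (intro fixed_irrational[OF _ tr2 fix_z]) (auto simp: G4_def)
    show "m21 T * z\<^sup>2 + (m22 T - m11 T) * z - m12 T = 0" by (rule fix_z)
  qed
qed

definition approx_exact :: "real \<Rightarrow> real \<Rightarrow> bool" where
  "approx_exact z L \<longleftrightarrow> approx_bound z L \<and> (\<forall>l. 0 \<le> l \<longrightarrow> l < L \<longrightarrow> \<not> approx_bound z l)"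

lemma approx_bound_mono: "approx_bound z L \<Longrightarrow> L \<le> L' \<Longrightarrow> approx_bound z L'"
  unfolding approx_bound_def by (meson add_right_mono order_trans)

lemma (in fixed_point) approx_exact_fixed: "approx_bound z 2 \<Longrightarrow> approx_exact z (sqrt (4 - 2 / m\<^sup>2))"
  unfolding approx_exact_def using approx_bound_Lval not_approx_bound_less by blast

lemma stake_Suc': "stake (Suc n) w = stake n w @ [w !! n]"
  by (rule stake_Suc)

lemma (in coded) frame_word:
  assumes "\<And>n. h (N + n) = m + of_bool (w !! n)"
  shows "g (N + n) * frame (w !! n) = g N * frame (w !! 0) * word_mat (stake n w)"
proof (induction n)
  case 0 then show ?case by (simp add: word_mat_def)
next
  case (Suc n)
  have "t (N + n) = of_bool (w !! Suc n) - of_bool (w !! n)"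
    using assms[of n] assms[of "Suc n"] by (simp add: t_def del: snth.simps(2))
  then have "g (N + Suc n) * frame (w !! Suc n) = g (N + n) * (turn (of_bool (w !! Suc n) - of_bool (w !! n)) * frame (w !! Suc n))"
    using gSuc[of "N + n"] by (simp add: mult.assoc del: snth.simps(2))
  also have "\<dots> = g (N + n) * frame (w !! n) * letter (w !! n)" unfolding turn_frame by (simp add: mult.assoc)
  also have "\<dots> = g N * frame (w !! 0) * word_mat (stake (Suc n) w)"
    unfolding Suc stake_Suc' word_mat_append by (simp add: word_mat_def mult.assoc)
  finally show ?case .
qed

lemma snth_cycle_add: "c \<noteq> [] \<Longrightarrow> cycle c !! (length c + n) = cycle c !! n"
  using sdrop_snth[of "length c" "cycle c" n] by simp

lemma stake_cycle_length: "c \<noteq> [] \<Longrightarrow> stake (length c + n) (cycle c) = c @ stake n (cycle c)"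
  using stake_add[of "length c" "cycle c" n, symmetric] by simp

lemma det2_frame: "det2 (frame b) = 1"
  by (rule G_det(3)[OF frame_G4])

text \<open>Equal turns from \<open>N\<close> and from \<open>N + L\<close> on force
  \<open>B N = B (N + L)\<close>. So \<open>z\<close> has the same position with respect to both
  edges, and the matrix that carries one edge to the other fixes it.\<close>

lemma (in coded) periodic_fixed:
  assumes c: "c \<noteq> []" and code: "\<And>n. h (N + n) = m + of_bool (cycle c !! n)"
  defines "E \<equiv> g N * frame (cycle c !! 0)"
  shows "E \<in> G4" "\<And>T. T = E * word_mat c * adj E \<Longrightarrow> m21 T * z\<^sup>2 + (m22 T - m11 T) * z - m12 T = 0"
proof -
  show EG: "E \<in> G4" unfolding E_def by (intro G4_times codingD(1)[OF cod] frame_G4)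
  define L where "L = length c"
  define F where "F = frame (cycle c !! 0)"
  have per: "cycle c !! (L + n) = cycle c !! n" for n unfolding L_def by (rule snth_cycle_add[OF c])
  have hper: "h (N + (L + n)) = h (N + n)" for n using code[of n] code[of "L + n"] per[of n] by simp
  have "B (N + 0) = B (N + (L + 0))"
  proof (rule turn_act_unique[of "\<lambda>j. t (N + j)" "\<lambda>j. B (N + j)" "\<lambda>j. B (N + (L + j))"])
    fix j
    have tt: "t (N + (L + j)) = t (N + j)" using hper[of j] hper[of "Suc j"] by (simp add: t_def)
    have "B (N + (L + j)) = turn_act (t (N + j)) (B (N + (L + Suc j)))" using B_step[of "N + (L + j)"] tt by simp
    moreover have "B (N + j) = turn_act (t (N + j)) (B (N + Suc j))" using B_step[of "N + j"] by simp
    moreover have "\<bar>t (N + j)\<bar> \<le> 1" using t_cases[of "N + j"] by auto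
    ultimately show "\<bar>t (N + j)\<bar> \<le> 1 \<and> B (N + j) = turn_act (t (N + j)) (B (N + Suc j))
       \<and> B (N + (L + j)) = turn_act (t (N + j)) (B (N + (L + Suc j)))" by blast
    show "0 < B (N + j) \<and> 0 < B (N + (L + j))" using pos by (simp add: B_def)
  next
    \<comment> \<open>With only two levels there cannot be two steps up in a row.\<close>
    show "t (N + 0) \<noteq> 1 \<or> t (N + 1) \<noteq> 1"
      using code[of 0] code[of 1] code[of 2] by (simp add: t_def numeral_2_eq_2 of_bool_def split: if_splits)
  qed
  then have BB: "r4 N * r1 (N + L) = r4 (N + L) * r1 N" using pos(3)[of N] pos(3)[of "N + L"] by (simp add: B_def field_simps)
  fix T assume T: "T = E * word_mat c * adj E"
  have "g (N + L) * F = E * word_mat c"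
    using frame_word[of N m "cycle c" L, OF code] per[of 0] c unfolding E_def F_def L_def by simp
  then have "T = (g (N + L) * F) * (adj F * adj (g N))" unfolding T E_def F_def adj_mult by simp
  also have "\<dots> = g (N + L) * adj (g N)"
    using adj_cancel(1)[OF det2_frame, of "cycle c !! 0" "adj (g N)"] unfolding F_def by (simp only: mult.assoc)
  finally have Te: "T = g (N + L) * adj (g N)" .
  have "m21 T * z\<^sup>2 + (m22 T - m11 T) * z - m12 T = r1 N * r4 (N + L) - r4 N * r1 (N + L)"
    unfolding Te by (simp add: r1_def r4_def algebra_simps power2_eq_square)
  then show "m21 T * z\<^sup>2 + (m22 T - m11 T) * z - m12 T = 0" using BB by (simp add: mult.commute)
qed

theorem approx_bound_less_2:
  assumes irr: "z / sqrt 2 \<notin> \<rat>" and approx_bound: "approx_bound z L" and L2: "L < 2"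
  shows "\<exists>c. christoffel_word c \<and> approx_exact z (sqrt (4 - 2 / (mval c)\<^sup>2))"
proof -
  obtain g h where "coding z g h" using coding_exists[OF irr] by blast
  then interpret coded z g h by unfold_locales
  \<comment> \<open>Half of the gap \<open>2 - L\<close> is spent on the error allowed by
    \<open>approx_bound\<close>; the other half remains as the gap of the heights.\<close>
  define \<delta> where "\<delta> = sqrt 2 * ((2 - L) / 2)"
  have \<delta>: "\<delta> > 0" using L2 by (simp add: \<delta>_def)
  have bnd: "sqrt 2 * (L + (2 - L) / 2) = 2 * sqrt 2 - \<delta>" by (simp add: \<delta>_def algebra_simps)
  have "(2 - L) / 2 > 0" using L2 by simp
  from approx_bound_heights[OF approx_bound this] obtain N where
    N: "\<And>n. n \<ge> N \<Longrightarrow> q1 n > 0 \<and> A n + B n \<le> 2 * sqrt 2 - \<delta> \<and> 1 / A n + 1 / B n \<le> 2 * sqrt 2 - \<delta>"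
    unfolding bnd by blast
  have "low_heights (\<lambda>n. A (N + n)) (\<lambda>n. B (N + n))"
    unfolding low_heights_def
  proof (intro allI conjI)
    fix n
    have "A (N + n) + B (N + n) \<le> 2 * sqrt 2 - \<delta>" "1 / A (N + n) + 1 / B (N + n) \<le> 2 * sqrt 2 - \<delta>" using N[of "N + n"] by simp_all
    then show "A (N + n) + B (N + n) \<le> 2 * sqrt 2" "1 / A (N + n) + 1 / B (N + n) \<le> 2 * sqrt 2" using \<delta> by linarith+
  qed
  from two_valued[OF height_walk_tail this] N[of N] obtain m M where
    m: "\<And>n. n \<ge> M \<Longrightarrow> h (N + n) = m \<or> h (N + n) = m + 1" by blast
  define K where "K = N + M"
  define w where "w = smap (\<lambda>n. h (K + n) = m + 1) nats"
  have hw: "h (K + n) = m + of_bool (w !! n)" for n using m[of "M + n"] by (auto simp: w_def K_def add.assoc)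
  have dynK: "height_walk (\<lambda>n. A (K + n)) (\<lambda>n. B (K + n)) (\<lambda>n. h (K + n))" by (rule height_walk_tail) (use N[of K] in \<open>simp add: K_def\<close>)
  have cK: "codes m w (\<lambda>n. h (K + n))" unfolding codes_def using hw by blast
  have "\<exists>k. markoff_set k (factors w)"
    by (rule height_walk_markoff_set[OF dynK cK \<delta>]) (use N[of "K + n" for n] in \<open>simp_all add: K_def\<close>)
  then obtain k where "markoff_set k (factors w)" by blast
  from markoff_stream_periodic[OF this] obtain p c where c: "christoffel_word c" "w = p @- cycle c" by blast
  have code: "h (K + length p + n) = m + of_bool (cycle c !! n)" for n
    using hw[of "length p + n"] c(2) by (simp add: add.assoc)
  define E where "E = g (K + length p) * frame (cycle c !! 0)"
  note fix1 = periodic_fixed[OF christoffel_word_ne[OF c(1)] code, folded E_def]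
  have "fixed_point (E * word_mat c * adj E) z (mval c) (E * adj (letter False))"
    by (rule fixed_point_christoffel[OF c(1) fix1(1) refl fix1(2)[OF refl]])
  then have "approx_exact z (sqrt (4 - 2 / (mval c)\<^sup>2))"
    using fixed_point.approx_exact_fixed approx_bound_mono[OF approx_bound] L2 by (metis less_imp_le)
  then show ?thesis using c(1) by blast
qed

section \<open>Realization of Christoffel words\<close>

definition nonneg :: "mat2 \<Rightarrow> bool" where
  "nonneg g \<longleftrightarrow> m11 g \<ge> 0 \<and> m12 g \<ge> 0 \<and> m21 g \<ge> 0 \<and> m22 g \<ge> 0"

lemma nonneg_mult: "nonneg g \<Longrightarrow> nonneg h \<Longrightarrow> nonneg (g * h)"
  unfolding nonneg_def by simp

lemma nonneg_turn: "nonneg (turn t)"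
  by (simp add: nonneg_def turn_def)

lemma nonneg_one: "nonneg 1" by (simp add: nonneg_def)

lemma nonneg_top_pos:
  assumes "nonneg V" "det2 V = 1" "z > 0"
  shows "m11 V * z + m12 V > 0" "m21 V * z + m22 V > 0"
proof -
  have ne: "\<not> (m11 V = 0 \<and> m12 V = 0)" "\<not> (m21 V = 0 \<and> m22 V = 0)" using assms(2) by (auto simp: det2_def)
  show "m11 V * z + m12 V > 0"
    using assms ne(1) unfolding nonneg_def by (metis add.right_neutral add_nonneg_pos add_pos_nonneg less_eq_real_def mult_pos_pos mult_zero_left)
  show "m21 V * z + m22 V > 0"
    using assms ne(2) unfolding nonneg_def by (metis add.right_neutral add_nonneg_pos add_pos_nonneg less_eq_real_def mult_pos_pos mult_zero_left)
qed

text \<open>The path is prescribed by the periodic word and \<open>z\<close> is recovered as the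
  positive fixed point of the period matrix \<open>U\<close>. What has to be shown is that every
  edge of the path encloses this \<open>z\<close>; then the heights give the bound 2, and the form
  turns it into the exact constant.\<close>

theorem christoffel_realized:
  assumes c: "christoffel_word c"
  shows "\<exists>z. z / sqrt 2 \<notin> \<rat> \<and> approx_exact z (sqrt (4 - 2 / (mval c)\<^sup>2))"
proof -
  note cne = christoffel_word_ne[OF c]
  define w where "w = cycle c"
  define F where "F n = frame (w !! n)" for n
  \<comment> \<open>The product of the first \<open>n\<close> turns, computed from
    \<open>turn_frame\<close>; in particular \<open>g 0 = 1\<close>.\<close>
  define g where "g n = F 0 * word_mat (stake n w) * adj (F n)" for n
  define h where "h n = (of_bool (w !! n) :: int)" for n
  have dF: "det2 (F n) = 1" for n by (simp add: F_def det2_frame)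
  have gG: "g n \<in> G4" for n
  proof -
    have "word_mat (stake n w) \<in> G4" using word_mat_parity[of "stake n w"] by (auto simp: G4_def split: if_splits)
    then show ?thesis unfolding g_def F_def by (intro G4_times frame_G4 G_adj(3))
  qed
  have gS: "g (Suc n) = g n * turn (h (Suc n) - h n)" for n
  proof -
    have "turn (h (Suc n) - h n) * F (Suc n) = F n * letter (w !! n)"
      unfolding h_def F_def by (rule turn_frame)
    then have "turn (h (Suc n) - h n) * F (Suc n) * adj (F (Suc n)) = F n * letter (w !! n) * adj (F (Suc n))" by simp
    then have tu: "turn (h (Suc n) - h n) = F n * letter (w !! n) * adj (F (Suc n))"
      using adj_right[OF dF[of "Suc n"]] by (simp add: mult.assoc)
    have "g n * turn (h (Suc n) - h n) = F 0 * word_mat (stake n w) * (adj (F n) * (F n * (letter (w !! n) * adj (F (Suc n)))))"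
      unfolding tu g_def by (simp only: mult.assoc)
    also have "\<dots> = F 0 * word_mat (stake n w) * (letter (w !! n) * adj (F (Suc n)))"
      unfolding adj_cancel(2)[OF dF] ..
    also have "\<dots> = g (Suc n)" unfolding g_def stake_Suc' word_mat_append by (simp add: word_mat_def mult.assoc del: snth.simps(2))
    finally show ?thesis by simp
  qed
  have g0: "g 0 = 1" using adj_right[OF dF[of 0]] by (simp add: g_def word_mat_def)
  have nn: "nonneg (adj (g n) * g (n + k))" for n k
  proof (induction k)
    case 0 then show ?case using adj_left[OF G_det(3)[OF gG[of n]]] nonneg_one by simp
  next
    case (Suc k)
    have "adj (g n) * g (n + Suc k) = adj (g n) * g (n + k) * turn (h (Suc (n + k)) - h (n + k))" using gS[of "n + k"] by (simp add: mult.assoc)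
    then show ?case using nonneg_mult[OF Suc nonneg_turn] by simp
  qed
  have nng: "nonneg (g n)" for n
  proof -
    have "adj (g 0) = 1" unfolding g0 by (simp add: adj_def one_mat2_def)
    then show ?thesis using nn[of 0 n] by simp
  qed
  define L where "L = length c"
  define U where "U = g L"
  have per: "w !! (L + n) = w !! n" for n unfolding w_def L_def by (rule snth_cycle_add[OF cne])
  have FL: "F (L + n) = F n" for n unfolding F_def per ..
  have U: "U = F 0 * word_mat c * adj (F 0)"
    using FL[of 0] cne unfolding U_def g_def by (simp add: L_def w_def)
  have gL: "g (L + n) = U * g n" for n
  proof -
    have "U * g n = F 0 * word_mat c * (adj (F 0) * (F 0 * (word_mat (stake n w) * adj (F n))))"
      unfolding U g_def by (simp only: mult.assoc)
    also have "\<dots> = F 0 * word_mat c * (word_mat (stake n w) * adj (F n))" unfolding adj_cancel(2)[OF dF] ..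
    also have "\<dots> = g (L + n)"
      unfolding g_def FL unfolding w_def L_def stake_cycle_length[OF cne] word_mat_append by (simp only: mult.assoc)
    finally show ?thesis by simp
  qed
  have gpow: "g (k * L) = U ^ k" for k
  proof (induction k)
    case (Suc k) then show ?case using gL[of "k * L"] by simp
  qed (simp add: g0)
  have UG: "U \<in> G4" unfolding U_def by (rule gG)
  have trU: "tr2 U = 2 * sqrt 2 * mval c" unfolding U tr2_conj[OF dF] by (rule tr2_mval)
  have "2 * 1 < 2 * sqrt 2 * (1::real)" by simp
  also have "\<dots> \<le> 2 * sqrt 2 * mval c" using christoffel_word_props(2)[OF c] by (intro mult_left_mono) auto
  finally have tr2: "tr2 U > 2" unfolding trU by simp
  define a b e d where "a = m11 U" and "b = m12 U" and "e = m21 U" and "d = m22 U"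
  have nU: "a \<ge> 0" "b \<ge> 0" "e \<ge> 0" "d \<ge> 0" using nng[of L] by (simp_all add: nonneg_def U_def a_def b_def e_def d_def)
  have e0: "e > 0" using trace_gt_2_m21[OF UG] tr2 nU(3) by (simp add: e_def less_le)
  \<comment> \<open>Conjugation by \<open>Rot\<close> exchanges 0 and infinity and makes
    \<open>- b\<close> the lower left entry, so \<open>b \<noteq> 0\<close> follows as
    \<open>e \<noteq> 0\<close> did.\<close>
  have "m21 (adj Rot * U * Rot) \<noteq> 0"
  proof (rule trace_gt_2_m21)
    show "adj Rot * U * Rot \<in> G4" by (intro G4_times G_adj(3) Rot_G4 UG)
    have "tr2 (adj Rot * U * adj (adj Rot)) = tr2 U" by (rule tr2_conj) (simp add: Rot_def det2_def)
    then show "\<bar>tr2 (adj Rot * U * Rot)\<bar> > 2" using tr2 by simp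
  qed
  then have b0: "b > 0" using nU(2) by (simp add: Rot_def b_def less_le)
  define s where "s = sqrt ((a - d)\<^sup>2 + 4 * b * e)"
  define z where "z = (a - d + s) / (2 * e)"
  have "\<bar>a - d\<bar> < s" unfolding s_def using b0 e0 by (intro real_less_rsqrt) (simp add: mult_pos_pos)
  then have z0: "z > 0" unfolding z_def using e0 by (intro divide_pos_pos) auto
  have s2: "s\<^sup>2 = (a - d)\<^sup>2 + 4 * b * e" unfolding s_def using b0 e0 by (simp add: add_nonneg_nonneg)
  have sz: "s = 2 * e * z - (a - d)" unfolding z_def using e0 by simp
  have "4 * e * (e * z\<^sup>2 + (d - a) * z - b) = s\<^sup>2 - ((a - d)\<^sup>2 + 4 * b * e)"
    unfolding sz by (simp add: power2_eq_square algebra_simps)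
  then have fix_z: "e * z\<^sup>2 + (d - a) * z - b = 0" unfolding s2 using e0 by simp
  define l where "l = e * z + d"
  have l0: "l > 0" unfolding l_def using e0 z0 nU by (intro add_pos_nonneg) auto
  have top: "a * z + b = l * z" using fix_z by (simp add: l_def algebra_simps power2_eq_square)
  have pw: "m11 (U ^ k) * z + m12 (U ^ k) = l ^ k * z \<and> m21 (U ^ k) * z + m22 (U ^ k) = l ^ k" for k
  proof (induction k)
    case (Suc k)
    have "m11 (U ^ Suc k) * z + m12 (U ^ Suc k) = a * (m11 (U ^ k) * z + m12 (U ^ k)) + b * (m21 (U ^ k) * z + m22 (U ^ k))"
      "m21 (U ^ Suc k) * z + m22 (U ^ Suc k) = e * (m11 (U ^ k) * z + m12 (U ^ k)) + d * (m21 (U ^ k) * z + m22 (U ^ k))"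
      by (simp_all add: a_def b_def e_def d_def algebra_simps)
    moreover have "a * (l ^ k * z) + b * l ^ k = l ^ k * (a * z + b)" "e * (l ^ k * z) + d * l ^ k = l ^ k * l"
      by (simp_all add: l_def algebra_simps)
    ultimately show ?case using Suc top by simp
  qed simp
  \<comment> \<open>Further turns lead from \<open>g n\<close> to \<open>U ^ n\<close>, so
    \<open>V\<close> is nonnegative and maps the vector with entries \<open>z\<close> and 1 to a
    positive one. As \<open>U ^ n\<close> multiplies that vector by \<open>l ^ n\<close>, the image
    consists of the two remainders at time \<open>n\<close>, multiplied by
    \<open>l ^ n\<close>.\<close>
  have rpos: "m22 (g n) * z - m12 (g n) > 0" "m11 (g n) - m21 (g n) * z > 0" for n
  proof -
    have "L > 0" using cne by (simp add: L_def)
    then have "n \<le> n * L" by simp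
    then obtain k where k: "n * L = n + k" using le_Suc_ex by blast
    define V where "V = adj (g n) * U ^ n"
    have "V = adj (g n) * g (n + k)" unfolding V_def gpow[symmetric] k ..
    then have nV: "nonneg V" using nn by simp
    have dV: "det2 V = 1" unfolding V_def det2_mult det2_power using G_det(3)[OF gG] G_det(3)[OF UG] by simp
    have "m11 V * z + m12 V = m22 (g n) * (m11 (U ^ n) * z + m12 (U ^ n)) - m12 (g n) * (m21 (U ^ n) * z + m22 (U ^ n))"
      "m21 V * z + m22 V = m11 (g n) * (m21 (U ^ n) * z + m22 (U ^ n)) - m21 (g n) * (m11 (U ^ n) * z + m12 (U ^ n))"
      by (simp_all add: V_def algebra_simps)
    then have "m11 V * z + m12 V = l ^ n * (m22 (g n) * z - m12 (g n))"
      "m21 V * z + m22 V = l ^ n * (m11 (g n) - m21 (g n) * z)"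
      unfolding conjunct1[OF pw[of n]] conjunct2[OF pw[of n]] by (simp_all add: algebra_simps)
    then have "l ^ n * (m22 (g n) * z - m12 (g n)) > 0" "l ^ n * (m11 (g n) - m21 (g n) * z) > 0"
      using nonneg_top_pos[OF nV dV z0] by simp_all
    then show "m22 (g n) * z - m12 (g n) > 0" "m11 (g n) - m21 (g n) * z > 0"
      using zero_less_mult_pos[OF _ zero_less_power[OF l0, of n]] by blast+
  qed
  have cod: "coding z g h"
    unfolding coding_def
  proof (intro allI conjI)
    fix n
    show "g n \<in> G4" by (rule gG)
    show "\<bar>h (Suc n) - h n\<bar> \<le> 1" by (simp add: h_def of_bool_def)
    show "g (Suc n) = g n * turn (h (Suc n) - h n)" by (rule gS)
    show "0 \<le> m21 (g n)" using nng[of n] by (simp add: nonneg_def)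
    have "m22 (g n) \<noteq> 0"
    proof
      assume "m22 (g n) = 0"
      then have "- (m12 (g n) * m21 (g n)) = 1" using G_det(3)[OF gG[of n]] by (simp add: det2_def)
      moreover have "0 \<le> m12 (g n) * m21 (g n)" using nng[of n] by (simp add: nonneg_def)
      ultimately show False by linarith
    qed
    then show "0 < m22 (g n)" using nng[of n] by (simp add: nonneg_def)
    show "0 < m11 (g n) - m21 (g n) * z" "0 < m22 (g n) * z - m12 (g n)" using rpos by blast+
  qed
  have fp: "fixed_point U z (mval c) (F 0 * adj (letter False))"
    by (rule fixed_point_christoffel[OF c _ U]) (use fix_z in \<open>simp_all add: F_def frame_G4 a_def b_def e_def d_def\<close>)
  then have irr: "z / sqrt 2 \<notin> \<rat>" by (simp add: fixed_point_def)
  interpret coded z g h by unfold_locales (rule cod)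
  obtain N where N: "\<forall>n\<ge>N. 1 \<le> q1 n \<and> 1 \<le> q4 n" using growth by blast
  have dynN: "height_walk (\<lambda>n. A (N + n)) (\<lambda>n. B (N + n)) (\<lambda>n. h (N + n))" by (rule height_walk_tail) (use N in force)
  have cN: "codes 0 (sdrop N w) (\<lambda>n. h (N + n))" by (simp add: codes_def h_def sdrop_snth)
  have nb: "\<not> bad x" if "x \<in> factors (sdrop N w)" for x
    using no_bad_cycle[OF c] factors_sdrop that unfolding w_def by blast
  have "approx_bound z 2"
    unfolding approx_bound_def
  proof (intro allI impI)
    fix \<epsilon> :: real assume \<epsilon>: "\<epsilon> > 0"
    obtain K where K: "K \<noteq> 0" "inverse (real K) < \<epsilon>" using real_arch_inverse[of \<epsilon>] \<epsilon> by auto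
    define H where "H = 2 * sqrt 2 + 1 / real K"
    have "H > 0" unfolding H_def by (intro add_pos_nonneg) auto
    moreover have "A n + B n \<le> H \<and> 1 / A n + 1 / B n \<le> H" if "n \<ge> N + Suc K" for n
    proof -
      define j where "j = n - N"
      have j: "n = N + j" "j \<ge> Suc K" using that by (auto simp: j_def)
      show ?thesis unfolding H_def j(1) using height_walk_upper[OF dynN cN nb _ j(2)] K(1) by simp
    qed
    ultimately obtain Q where Q: "\<forall>\<gamma>\<in>G4. \<bar>m21 \<gamma>\<bar> \<ge> Q \<longrightarrow> 1 / appr z \<gamma> \<le> H"
      using cusp_heights_le[of H "N + Suc K"] irr by blast
    have "1 / (sqrt 2 * appr z \<gamma>) \<le> 2 + \<epsilon>" if "\<gamma> \<in> G4" "\<bar>m21 \<gamma>\<bar> \<ge> Q" for \<gamma>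
    proof -
      have "1 / (sqrt 2 * appr z \<gamma>) = (1 / appr z \<gamma>) / sqrt 2" by simp
      also have "\<dots> \<le> H / sqrt 2" using Q that by (intro divide_right_mono) auto
      also have "\<dots> = 2 + (1 / real K) / sqrt 2" unfolding H_def by (simp add: add_divide_distrib)
      also have "(1 / real K) / sqrt 2 \<le> (1 / real K) / 1" by (intro divide_left_mono) auto
      finally show ?thesis using K(2) by (simp add: inverse_eq_divide)
    qed
    then show "\<exists>Q. \<forall>g\<in>G4. Q \<le> \<bar>m21 g\<bar> \<longrightarrow> 1 / (sqrt 2 * appr z g) \<le> 2 + \<epsilon>" by blast
  qed
  then have "approx_exact z (sqrt (4 - 2 / (mval c)\<^sup>2))" by (rule fixed_point.approx_exact_fixed[OF fp])
  then show ?thesis using irr by blast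
qed

section \<open>Parametrization of the circle\<close>

text \<open>Inverse stereographic projection from \<open>(-1, 0)\<close>, the only point of the
  circle that it misses.\<close>

definition circle_point :: "real \<Rightarrow> real \<times> real" where
  "circle_point t = ((1 - t\<^sup>2) / (1 + t\<^sup>2), 2 * t / (1 + t\<^sup>2))"

lemma one_plus_square_pos: "1 + t\<^sup>2 > (0::real)"
  by (simp add: add_pos_nonneg)

lemma circle_point_in_circle: "circle_point t \<in> unit_circle"
proof -
  have "(1 - t\<^sup>2)\<^sup>2 + (2 * t)\<^sup>2 = (1 + t\<^sup>2)\<^sup>2" by (simp add: power2_eq_square algebra_simps)
  then have "((1 - t\<^sup>2) / (1 + t\<^sup>2))\<^sup>2 + (2 * t / (1 + t\<^sup>2))\<^sup>2 = 1"
    using one_plus_square_pos[of t] by (simp add: power_divide flip: add_divide_distrib)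
  then show ?thesis by (simp add: circle_point_def unit_circle_def)
qed

lemma circle_point_inverse: fixes t :: real shows "(2 * t / (1 + t\<^sup>2)) / (1 + (1 - t\<^sup>2) / (1 + t\<^sup>2)) = t"
proof -
  have "1 + (1 - t\<^sup>2) / (1 + t\<^sup>2) = 2 / (1 + t\<^sup>2)" using one_plus_square_pos[of t] by (simp add: field_simps)
  then show ?thesis using one_plus_square_pos[of t] by simp
qed

lemma unit_circle_eq_circle_point:
  assumes "X\<^sup>2 + Y\<^sup>2 = 1" "X \<noteq> -1"
  shows "(X, Y) = circle_point (Y / (1 + X))"
proof -
  have x: "1 + X \<noteq> 0" using assms(2) by linarith
  have y: "Y\<^sup>2 = (1 - X) * (1 + X)" using assms(1) by (simp add: power2_eq_square algebra_simps)
  have "(Y / (1 + X))\<^sup>2 = ((1 - X) * (1 + X)) / ((1 + X) * (1 + X))"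
    unfolding power_divide y power2_eq_square[of "1 + X"] ..
  then have t2: "(Y / (1 + X))\<^sup>2 = (1 - X) / (1 + X)" using x by simp
  have d: "1 + (1 - X) / (1 + X) = 2 / (1 + X)" "1 - (1 - X) / (1 + X) = 2 * X / (1 + X)" using x by (simp_all add: field_simps)
  show ?thesis unfolding circle_point_def t2 d using x by simp
qed

lemma circle_point_rational: "circle_point t \<in> rational_plane \<longleftrightarrow> t \<in> \<rat>"
proof
  assume "circle_point t \<in> rational_plane"
  then have r: "(1 - t\<^sup>2) / (1 + t\<^sup>2) \<in> \<rat>" "2 * t / (1 + t\<^sup>2) \<in> \<rat>" by (simp_all add: circle_point_def rational_plane_def)
  show "t \<in> \<rat>" using Rats_divide[OF r(2) Rats_add[OF Rats_1 r(1)]] unfolding circle_point_inverse .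
next
  assume "t \<in> \<rat>"
  then show "circle_point t \<in> rational_plane" unfolding circle_point_def rational_plane_def by (intro SigmaI Rats_divide Rats_diff Rats_add Rats_mult Rats_power) auto
qed

lemma dist_circle_point: "dist (circle_point t) (circle_point s) = 2 * \<bar>t - s\<bar> / (sqrt (1 + t\<^sup>2) * sqrt (1 + s\<^sup>2))"
proof -
  define a b where "a = 1 + t\<^sup>2" and "b = 1 + s\<^sup>2"
  have ab: "a > 0" "b > 0" using one_plus_square_pos by (auto simp: a_def b_def)
  have e1: "(1 - t\<^sup>2) / a - (1 - s\<^sup>2) / b = ((1 - t\<^sup>2) * b - (1 - s\<^sup>2) * a) / (a * b)" using ab by (simp add: diff_frac_eq)
  have e2: "2 * t / a - 2 * s / b = (2 * t * b - 2 * s * a) / (a * b)" using ab by (simp add: diff_frac_eq)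
  have num: "((1 - t\<^sup>2) * b - (1 - s\<^sup>2) * a)\<^sup>2 + (2 * t * b - 2 * s * a)\<^sup>2 = 4 * (t - s)\<^sup>2 * (a * b)"
    unfolding a_def b_def by (simp add: power2_eq_square algebra_simps)
  have "(dist (circle_point t) (circle_point s))\<^sup>2 = ((1 - t\<^sup>2) / a - (1 - s\<^sup>2) / b)\<^sup>2 + (2 * t / a - 2 * s / b)\<^sup>2"
    unfolding circle_point_def a_def b_def by (simp add: dist_Pair_Pair dist_real_def)
  also have "\<dots> = 4 * (t - s)\<^sup>2 * (a * b) / (a * b)\<^sup>2"
    unfolding e1 e2 power_divide num[symmetric] by (simp add: add_divide_distrib)
  also have "\<dots> = 4 * (t - s)\<^sup>2 / (a * b)" using ab by (simp add: power2_eq_square)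
  also have "\<dots> = (2 * \<bar>t - s\<bar> / (sqrt a * sqrt b))\<^sup>2" using ab by (simp add: power_divide power_mult_distrib)
  finally show ?thesis using ab unfolding a_def[symmetric] b_def[symmetric]
    by (metis (no_types, lifting) abs_ge_zero divide_nonneg_nonneg less_eq_real_def mult_nonneg_nonneg power2_eq_iff_nonneg real_sqrt_ge_zero zero_le_dist zero_le_numeral)
qed

lemma Gcd_triple_1:
  fixes A B C :: int
  assumes "\<And>d. d dvd A \<Longrightarrow> d dvd C \<Longrightarrow> d dvd 1"
  shows "Gcd {A, B, C} = 1"
proof -
  have "Gcd {A, B, C} dvd A" "Gcd {A, B, C} dvd C" by (rule Gcd_dvd, simp)+
  then have "Gcd {A, B, C} dvd 1" by (rule assms)
  then have "normalize (Gcd {A, B, C}) = 1" by (simp add: is_unit_normalize)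
  then show ?thesis by simp
qed

text \<open>Coprime parameters of opposite parity give a Pythagorean triple with hypotenuse the sum
  of their squares, two odd ones half of it. The shift by 1 aligns this with the cosets: in
  \<open>G0\<close> the entry \<open>a\<close> is odd, so \<open>c\<close> and \<open>a + c\<close>
  have opposite parity; in \<open>G1\<close> both \<open>c\<close> and \<open>2 * a + c\<close> are
  odd. The factor 2 is absorbed by \<open>(m21 g)\<^sup>2\<close>, which is
  \<open>2 * c\<^sup>2\<close> or \<open>c\<^sup>2\<close>.\<close>

lemma height_cusp:
  assumes g: "g \<in> G4" and q: "m21 g \<noteq> 0" and x: "x = m11 g / m21 g"
  shows "real_of_int (height (circle_point (sqrt 2 * x + 1))) = (m21 g)\<^sup>2 * (1 + (sqrt 2 * x + 1)\<^sup>2) / 2"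
proof -
  consider (G0) "g \<in> G0" | (G1) "g \<in> G1" using g by (auto simp: G4_def)
  then show ?thesis
  proof cases
    case G0
    then obtain a b c d :: int where ge: "g = Mat a (b * sqrt 2) (c * sqrt 2) d" and det: "det2 g = 1" by (auto simp: G0_def)
    have "real_of_int (a * d - 2 * b * c) = 1" using det by (simp add: ge det2_def mult_sqrt2 algebra_simps)
    then have dd: "a * d - 2 * b * c = 1" by linarith
    have c0: "c \<noteq> 0" using q by (simp add: ge)
    have t: "sqrt 2 * x + 1 = of_int (a + c) / of_int c" using c0 by (simp add: x ge field_simps)
    define C where "C = c\<^sup>2 + (a + c)\<^sup>2"
    have cop: "coprime c (a + c)"
    proof (rule coprimeI)
      fix e assume "e dvd c" "e dvd a + c"
      then have "e dvd a" using dvd_add_left_iff by blast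
      then have "e dvd a * d - 2 * b * c" using \<open>e dvd c\<close> by (intro dvd_diff dvd_mult2 dvd_mult) auto
      then show "is_unit e" unfolding dd .
    qed
    have odda: "odd a"
    proof
      assume "even a"
      then have "even (a * d - 2 * b * c)" by simp
      then show False unfolding dd by simp
    qed
    have oddC: "odd C" using odda unfolding C_def by auto
    have C0: "C > 0" unfolding C_def using c0 by (intro add_pos_nonneg) auto
    have red: "reduced_form (circle_point (sqrt 2 * x + 1)) (c\<^sup>2 - (a + c)\<^sup>2) (2 * (a + c) * c) C"
      unfolding reduced_form_def
    proof (intro conjI)
      have cc: "real_of_int c \<noteq> 0" using c0 by simp
      have CC: "real_of_int C = (of_int c)\<^sup>2 + (of_int (a + c))\<^sup>2" by (simp add: C_def)
      have n: "1 + (of_int (a + c) / real_of_int c)\<^sup>2 = of_int C / (of_int c)\<^sup>2"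
        "1 - (of_int (a + c) / real_of_int c)\<^sup>2 = of_int (c\<^sup>2 - (a + c)\<^sup>2) / (of_int c)\<^sup>2"
        "2 * (of_int (a + c) / real_of_int c) = of_int (2 * (a + c) * c) / (of_int c)\<^sup>2"
        unfolding CC using cc by (simp_all add: power_divide field_simps power2_eq_square)
      show "circle_point (sqrt 2 * x + 1) = (of_int (c\<^sup>2 - (a + c)\<^sup>2) / of_int C, of_int (2 * (a + c) * c) / of_int C)"
        unfolding t circle_point_def n using cc by simp
      show "Gcd {c\<^sup>2 - (a + c)\<^sup>2, 2 * (a + c) * c, C} = 1"
      proof (rule Gcd_triple_1)
        fix e assume e: "e dvd c\<^sup>2 - (a + c)\<^sup>2" "e dvd C"
        have "e dvd C + (c\<^sup>2 - (a + c)\<^sup>2)" "e dvd C - (c\<^sup>2 - (a + c)\<^sup>2)" using e by (auto intro: dvd_add dvd_diff)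
        then have ee: "e dvd 2 * c\<^sup>2" "e dvd 2 * (a + c)\<^sup>2" by (simp_all add: C_def)
        have "odd e" using e(2) oddC by (meson dvd_trans)
        then have "coprime e 2" by (simp add: coprime_right_2_iff_odd)
        then have "e dvd c\<^sup>2" "e dvd (a + c)\<^sup>2" using ee by (simp_all add: coprime_dvd_mult_right_iff)
        moreover have "coprime (c\<^sup>2) ((a + c)\<^sup>2)" using cop by simp
        ultimately show "e dvd 1" using coprime_common_divisor by blast
      qed
    qed (rule C0)
    have "real_of_int C = (m21 g)\<^sup>2 * (1 + (sqrt 2 * x + 1)\<^sup>2) / 2"
      unfolding t using c0 by (simp add: C_def ge power_mult_distrib power_divide field_simps)
    then show ?thesis unfolding height_eq[OF red] .
  next
    case G1
    then obtain a b c d :: int where ge: "g = Mat (a * sqrt 2) b c (d * sqrt 2)" and det: "det2 g = 1" by (auto simp: G1_def)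
    have "real_of_int (2 * a * d - b * c) = 1" using det by (simp add: ge det2_def mult_sqrt2 algebra_simps)
    then have dd: "2 * a * d - b * c = 1" by linarith
    have c0: "c \<noteq> 0" using q by (simp add: ge)
    have t: "sqrt 2 * x + 1 = of_int (2 * a + c) / of_int c" using c0 by (simp add: x ge field_simps)
    define C where "C = 2 * a\<^sup>2 + 2 * a * c + c\<^sup>2"
    define A where "A = - 2 * a\<^sup>2 - 2 * a * c"
    have CA: "C + A = c\<^sup>2" "C - A = (2 * a + c)\<^sup>2" by (simp_all add: C_def A_def power2_eq_square algebra_simps)
    have C2: "2 * C = c\<^sup>2 + (2 * a + c)\<^sup>2" "2 * A = c\<^sup>2 - (2 * a + c)\<^sup>2" by (simp_all add: C_def A_def power2_eq_square algebra_simps)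
    have cop: "coprime c (2 * a + c)"
    proof (rule coprimeI)
      fix e assume "e dvd c" "e dvd 2 * a + c"
      then have "e dvd 2 * a" using dvd_add_left_iff by blast
      then have "e dvd 2 * a * d" by (rule dvd_mult2)
      moreover have "e dvd b * c" using \<open>e dvd c\<close> by (rule dvd_mult)
      ultimately have "e dvd 2 * a * d - b * c" by (rule dvd_diff)
      then show "is_unit e" unfolding dd .
    qed
    have "0 < 2 * C" unfolding C2 using c0 by (intro add_pos_nonneg) auto
    then have C0: "C > 0" by simp
    have red: "reduced_form (circle_point (sqrt 2 * x + 1)) A ((2 * a + c) * c) C"
      unfolding reduced_form_def
    proof (intro conjI)
      have cc: "real_of_int c \<noteq> 0" using c0 by simp
      have CC: "2 * real_of_int C = (of_int c)\<^sup>2 + (of_int (2 * a + c))\<^sup>2" "2 * real_of_int A = (of_int c)\<^sup>2 - (of_int (2 * a + c))\<^sup>2"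
        using arg_cong[OF C2(1), of real_of_int] arg_cong[OF C2(2), of real_of_int] by simp_all
      have n: "1 + (of_int (2 * a + c) / real_of_int c)\<^sup>2 = 2 * of_int C / (of_int c)\<^sup>2"
        "1 - (of_int (2 * a + c) / real_of_int c)\<^sup>2 = 2 * of_int A / (of_int c)\<^sup>2"
        "2 * (of_int (2 * a + c) / real_of_int c) = 2 * of_int ((2 * a + c) * c) / (of_int c)\<^sup>2"
        unfolding CC using cc by (simp_all add: power_divide field_simps power2_eq_square)
      show "circle_point (sqrt 2 * x + 1) = (of_int A / of_int C, of_int ((2 * a + c) * c) / of_int C)"
        unfolding t circle_point_def n using cc by simp
      show "Gcd {A, (2 * a + c) * c, C} = 1"
      proof (rule Gcd_triple_1)
        fix e assume e: "e dvd A" "e dvd C"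
        have "e dvd C + A" "e dvd C - A" using e by (auto intro: dvd_add dvd_diff)
        then have "e dvd c\<^sup>2" "e dvd (2 * a + c)\<^sup>2" unfolding CA .
        moreover have "coprime (c\<^sup>2) ((2 * a + c)\<^sup>2)" using cop by simp
        ultimately show "e dvd 1" using coprime_common_divisor by blast
      qed
    qed (rule C0)
    have "2 * real_of_int C = (of_int c)\<^sup>2 + (of_int (2 * a + c))\<^sup>2" using arg_cong[OF C2(1), of real_of_int] by simp
    also have "\<dots> = (m21 g)\<^sup>2 * (1 + (sqrt 2 * x + 1)\<^sup>2)"
      unfolding t using c0 by (simp add: ge power_divide field_simps)
    finally show ?thesis unfolding height_eq[OF red] by simp
  qed
qed

lemma height_minus_one: "height (-1, 0) = 1"
proof (rule height_eq)
  show "reduced_form (-1, 0) (-1) 0 1" by (simp add: reduced_form_def)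
qed

text \<open>The distortion that remains when height times distance on the circle is compared with
  \<open>appr\<close>; it tends to 1 as \<open>x\<close> tends to \<open>z\<close>.\<close>

definition ratio :: "real \<Rightarrow> real \<Rightarrow> real" where
  "ratio z x = sqrt (1 + (sqrt 2 * x + 1)\<^sup>2) / sqrt (1 + (sqrt 2 * z + 1)\<^sup>2)"

lemma ratio_pos: "ratio z x > 0"
  unfolding ratio_def using one_plus_square_pos by simp

lemma height_dist:
  assumes g: "g \<in> G4" and q: "m21 g \<noteq> 0" and x: "x = m11 g / m21 g"
  shows "of_int (height (circle_point (sqrt 2 * x + 1))) * dist (circle_point (sqrt 2 * z + 1)) (circle_point (sqrt 2 * x + 1)) = sqrt 2 * appr z g * ratio z x"
proof -
  define u v where "u = sqrt (1 + (sqrt 2 * x + 1)\<^sup>2)" and "v = sqrt (1 + (sqrt 2 * z + 1)\<^sup>2)"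
  have uv: "u > 0" "v > 0" using one_plus_square_pos by (auto simp: u_def v_def)
  have u2: "1 + (sqrt 2 * x + 1)\<^sup>2 = u * u" unfolding u_def using one_plus_square_pos[of "sqrt 2 * x + 1"] by simp
  have ap: "appr z g = (m21 g)\<^sup>2 * \<bar>z - x\<bar>"
  proof -
    have "m11 g - m21 g * z = m21 g * (x - z)" using q by (simp add: x field_simps)
    then show ?thesis by (simp add: appr_def abs_mult power2_eq_square abs_minus_commute)
  qed
  have d: "sqrt 2 * z + 1 - (sqrt 2 * x + 1) = sqrt 2 * (z - x)" by (simp add: algebra_simps)
  have H: "real_of_int (height (circle_point (sqrt 2 * x + 1))) = (m21 g)\<^sup>2 * (u * u) / 2"
    unfolding height_cusp[OF g q x] u2 ..
  have D: "dist (circle_point (sqrt 2 * z + 1)) (circle_point (sqrt 2 * x + 1)) = 2 * (sqrt 2 * \<bar>z - x\<bar>) / (v * u)"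
    unfolding dist_circle_point d u_def v_def by (simp only: abs_mult) simp
  have R: "ratio z x = u / v" unfolding ratio_def u_def v_def ..
  show ?thesis unfolding H D R ap using uv by (simp add: field_simps)
qed

section \<open>Lagrange numbers as approximation constants\<close>

lemma isCont_near:
  fixes f :: "real \<Rightarrow> real"
  assumes "isCont f z" "f z < y"
  shows "\<exists>\<eta>>0. \<forall>x. \<bar>x - z\<bar> < \<eta> \<longrightarrow> f x < y"
proof -
  have "(f \<longlongrightarrow> f z) (nhds z)" using assms(1) by (simp add: isCont_def tendsto_at_iff_tendsto_nhds)
  then have "\<forall>\<^sub>F x in nhds z. f x < y" using assms(2) by (rule order_tendstoD(2))
  then show ?thesis by (simp add: eventually_nhds_metric dist_real_def)
qed

lemma isCont_ratio: "isCont (ratio z) x"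
  unfolding ratio_def using one_plus_square_pos[of "sqrt 2 * z + 1"] by (intro continuous_intros) auto

lemma ratio_self [simp]: "ratio z z = 1"
  unfolding ratio_def using one_plus_square_pos[of "sqrt 2 * z + 1"] by simp

lemma eventually_height:
  "eventually P (inf (filtercomap height at_top) (principal S)) \<longleftrightarrow> (\<exists>B. \<forall>Z\<in>S. height Z \<ge> B \<longrightarrow> P Z)"
  unfolding eventually_inf_principal eventually_filtercomap_at_top_linorder by blast

text \<open>Near \<open>z\<close> the \<open>ratio\<close> is close to 1, so the two constants
  nearly agree. A cusp at distance at least \<open>\<eta>\<close> has \<open>appr\<close> at least
  \<open>\<bar>m21 g\<bar> * \<eta>\<close>, and for large denominators its constant falls below
  \<open>\<epsilon>\<close>.\<close>

lemma lagrange_le_approx_bound: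
  assumes irr: "z / sqrt 2 \<notin> \<rat>" and L: "0 \<le> L"
    and le: "lagrange_number (circle_point (sqrt 2 * z + 1)) \<le> ereal L"
  shows "approx_bound z L"
  unfolding approx_bound_def
proof (intro allI impI)
  fix \<epsilon> :: real assume \<epsilon>: "\<epsilon> > 0"
  define P where "P = circle_point (sqrt 2 * z + 1)"
  have "ereal L < ereal (L + \<epsilon> / 2)" using \<epsilon> by simp
  then have "eventually (\<lambda>Z. ereal (1 / (of_int (height Z) * dist P Z)) < ereal (L + \<epsilon> / 2))
     (inf (filtercomap height at_top) (principal (unit_circle \<inter> rational_plane)))"
    using le unfolding lagrange_number_def P_def[symmetric] Limsup_le_iff by blast
  then obtain Bd where Bd: "\<And>Z. Z \<in> unit_circle \<inter> rational_plane \<Longrightarrow> height Z \<ge> Bd \<Longrightarrow> 1 / (of_int (height Z) * dist P Z) < L + \<epsilon> / 2"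
    unfolding eventually_height by auto
  have "isCont (\<lambda>x. (L + \<epsilon> / 2) * ratio z x) z" by (intro continuous_intros isCont_ratio)
  then obtain \<eta> where \<eta>: "\<eta> > 0" "\<And>x. \<bar>x - z\<bar> < \<eta> \<Longrightarrow> (L + \<epsilon> / 2) * ratio z x < L + \<epsilon>"
    using isCont_near[where f = "\<lambda>x. (L + \<epsilon> / 2) * ratio z x" and y = "L + \<epsilon>" and z = z] \<epsilon> by auto
  \<comment> \<open>The entries ensure, in turn, that the square of the denominator dominates it,
    that the height is at least \<open>Bd\<close>, and that cusps away from \<open>z\<close> are
    harmless.\<close>
  define Q where "Q = max 1 (max (2 * \<bar>real_of_int Bd\<bar>) (1 / (\<eta> * \<epsilon>)))"
  show "\<exists>Q. \<forall>g\<in>G4. Q \<le> \<bar>m21 g\<bar> \<longrightarrow> 1 / (sqrt 2 * appr z g) \<le> L + \<epsilon>"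
  proof (intro exI[of _ Q] ballI impI)
    fix g assume g: "g \<in> G4" and q: "Q \<le> \<bar>m21 g\<bar>"
    have q3: "\<bar>m21 g\<bar> \<ge> 1" "\<bar>m21 g\<bar> \<ge> 2 * \<bar>real_of_int Bd\<bar>" "\<bar>m21 g\<bar> \<ge> 1 / (\<eta> * \<epsilon>)" using q by (auto simp: Q_def)
    have q0: "m21 g \<noteq> 0" using q3 by auto
    have qq: "(m21 g)\<^sup>2 \<ge> \<bar>m21 g\<bar>" using mult_left_mono[OF q3(1), of "\<bar>m21 g\<bar>"] by (simp add: power2_eq_square)
    define x where "x = m11 g / m21 g"
    have ap: "appr z g = (m21 g)\<^sup>2 * \<bar>x - z\<bar>"
    proof -
      have "m11 g - m21 g * z = m21 g * (x - z)" using q0 by (simp add: x_def field_simps)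
      then show ?thesis by (simp add: appr_def abs_mult power2_eq_square)
    qed
    have ap0: "appr z g > 0" by (rule appr_pos[OF g irr q0])
    show "1 / (sqrt 2 * appr z g) \<le> L + \<epsilon>"
    proof (cases "\<bar>x - z\<bar> < \<eta>")
      case True
      define Z where "Z = circle_point (sqrt 2 * x + 1)"
      have "x / sqrt 2 \<in> \<rat>" 
      proof -
        consider "g \<in> G0" | "g \<in> G1" using g by (auto simp: G4_def)
        then show ?thesis
        proof cases
          case 1
          then obtain a b c d :: int where "g = Mat a (b * sqrt 2) (c * sqrt 2) d" by (auto simp: G0_def)
          then have "x / sqrt 2 = of_int a / (of_int (2 * c))" by (simp add: x_def)
          then show ?thesis by simp
        next
          case 2
          then obtain a b c d :: int where "g = Mat (a * sqrt 2) b c (d * sqrt 2)" by (auto simp: G1_def)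
          then have "x / sqrt 2 = of_int a / of_int c" by (simp add: x_def)
          then show ?thesis by simp
        qed
      qed
      then have "2 * (x / sqrt 2) + 1 \<in> \<rat>" by (intro Rats_add Rats_mult) auto
      moreover have "2 * (x / sqrt 2) + 1 = sqrt 2 * x + 1" by (simp add: field_simps)
      ultimately have ZS: "Z \<in> unit_circle \<inter> rational_plane" unfolding Z_def using circle_point_in_circle circle_point_rational by auto
      have "1 + (sqrt 2 * x + 1)\<^sup>2 \<ge> 1" by simp
      then have "(m21 g)\<^sup>2 * 1 \<le> (m21 g)\<^sup>2 * (1 + (sqrt 2 * x + 1)\<^sup>2)" by (intro mult_left_mono) auto
      then have "real_of_int (height Z) \<ge> \<bar>real_of_int Bd\<bar>" unfolding Z_def height_cusp[OF g q0 x_def] using qq q3(2) by linarith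
      then have "height Z \<ge> Bd" by linarith
      then have b: "1 / (of_int (height Z) * dist P Z) < L + \<epsilon> / 2" by (rule Bd[OF ZS])
      have hd: "of_int (height Z) * dist P Z = sqrt 2 * appr z g * ratio z x"
        unfolding Z_def P_def by (rule height_dist[OF g q0 x_def])
      have "1 / (sqrt 2 * appr z g) = (1 / (sqrt 2 * appr z g * ratio z x)) * ratio z x" using ratio_pos[of z x] by simp
      also have "\<dots> \<le> (L + \<epsilon> / 2) * ratio z x" using b ratio_pos[of z x] unfolding hd by (intro mult_right_mono) auto
      also have "\<dots> \<le> L + \<epsilon>" using \<eta>(2)[OF True] by simp
      finally show ?thesis .
    next
      case False
      then have "\<bar>m21 g\<bar> * \<eta> \<le> (m21 g)\<^sup>2 * \<bar>x - z\<bar>" using qq \<eta>(1) by (intro mult_mono) auto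
      moreover have "1 / \<epsilon> \<le> \<bar>m21 g\<bar> * \<eta>" using q3(3) \<eta>(1) \<epsilon> by (simp add: field_simps)
      ultimately have a1: "1 / \<epsilon> \<le> appr z g" unfolding ap by linarith
      have "1 * appr z g \<le> sqrt 2 * appr z g" using ap0 by (intro mult_right_mono) auto
      then have "1 / \<epsilon> \<le> sqrt 2 * appr z g" using a1 by linarith
      then have "1 / (sqrt 2 * appr z g) \<le> \<epsilon>" using ap0 \<epsilon> by (simp add: field_simps)
      then show ?thesis using L by simp
    qed
  qed
qed

text \<open>The same split, now by height. Near \<open>z\<close> a large height means a large
  denominator; away from \<open>z\<close> the distance on the circle is at least
  \<open>\<delta>\<close>, although \<open>x\<close> ranges over an unbounded set. The missing point
  \<open>(-1, 0)\<close> has height 1 and is discarded.\<close>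

lemma approx_bound_lagrange_le:
  assumes irr: "z / sqrt 2 \<notin> \<rat>" and L: "0 \<le> L" and approx_bound: "approx_bound z L"
    and cusp: "\<And>r. r \<in> \<rat> \<Longrightarrow> \<exists>g\<in>G4. m21 g \<noteq> 0 \<and> m11 g / m21 g = sqrt 2 * r"
  shows "lagrange_number (circle_point (sqrt 2 * z + 1)) \<le> ereal L"
  unfolding lagrange_number_def Limsup_le_iff
proof (intro allI impI)
  define P where "P = circle_point (sqrt 2 * z + 1)"
  fix y' assume y': "ereal L < y'"
  obtain y where y: "ereal y \<le> y'" "L < y"
    using y' by (cases y') (auto intro: that[of "L + 1"])
  define \<epsilon> where "\<epsilon> = (y - L) / 2"
  have \<epsilon>: "\<epsilon> > 0" "L + \<epsilon> < y" using y by (auto simp: \<epsilon>_def field_simps)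
  obtain Q where Q: "\<And>g. g \<in> G4 \<Longrightarrow> Q \<le> \<bar>m21 g\<bar> \<Longrightarrow> 1 / (sqrt 2 * appr z g) \<le> L + \<epsilon>"
    using approx_bound \<epsilon>(1) unfolding approx_bound_def by blast
  have "isCont (\<lambda>x. (L + \<epsilon>) / ratio z x) z" using ratio_pos[of z z] by (intro continuous_intros isCont_ratio) auto
  then obtain \<eta> where \<eta>: "\<eta> > 0" "\<And>x. \<bar>x - z\<bar> < \<eta> \<Longrightarrow> (L + \<epsilon>) / ratio z x < y"
    using isCont_near[where f = "\<lambda>x. (L + \<epsilon>) / ratio z x" and y = y and z = z] \<epsilon> by auto
  define t where "t = sqrt 2 * z + 1"
  \<comment> \<open>Chosen such that \<open>sqrt (1 + s\<^sup>2) \<le> k * \<bar>x - z\<bar>\<close>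
    whenever \<open>\<bar>x - z\<bar> \<ge> \<eta>\<close>; then \<open>\<bar>x - z\<bar>\<close>
    cancels in the lower bound of the distance.\<close>
  define k where "k = (1 + \<bar>t\<bar>) / \<eta> + sqrt 2"
  have k0: "k > 0" unfolding k_def using \<eta>(1) by (intro add_nonneg_pos divide_nonneg_pos) auto
  define \<delta> where "\<delta> = 2 * sqrt 2 / (sqrt (1 + t\<^sup>2) * k)"
  have \<delta>: "\<delta> > 0" unfolding \<delta>_def using k0 one_plus_square_pos[of t] by simp
  define C where "C = (1 + (\<bar>t\<bar> + sqrt 2 * \<eta>)\<^sup>2) / 2"
  have C0: "C > 0" unfolding C_def using one_plus_square_pos by simp
  \<comment> \<open>The three bounds exclude \<open>(-1, 0)\<close>, keep the quotient at most
    \<open>y / 2\<close> away from \<open>z\<close>, and force \<open>\<bar>m21 g\<bar> > Q\<close>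
    near \<open>z\<close>.\<close>
  obtain Bd :: int where Bd: "max 2 (max (2 / (\<delta> * y)) (C * (\<bar>Q\<bar> + 1)\<^sup>2)) \<le> of_int Bd" using ex_le_of_int by blast
  have y0: "y > 0" using y L by simp
  have "1 / (of_int (height Z) * dist P Z) < y" if Z: "Z \<in> unit_circle \<inter> rational_plane" "height Z \<ge> Bd" for Z
  proof -
    have h: "real_of_int (height Z) \<ge> 2" "real_of_int (height Z) \<ge> 2 / (\<delta> * y)" "real_of_int (height Z) \<ge> C * (\<bar>Q\<bar> + 1)\<^sup>2"
      using Bd Z(2) by (auto intro: order_trans[OF _ of_int_le_iff[THEN iffD2]])
    obtain X Y where XY: "Z = (X, Y)" "X\<^sup>2 + Y\<^sup>2 = 1" using Z(1) by (auto simp: unit_circle_def)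
    have "X \<noteq> -1"
    proof
      assume "X = -1"
      then have "Z = (-1, 0)" using XY by simp
      then show False using h(1) height_minus_one by simp
    qed
    define s where "s = Y / (1 + X)"
    have Zs: "Z = circle_point s" unfolding XY(1) s_def by (rule unit_circle_eq_circle_point[OF XY(2) \<open>X \<noteq> -1\<close>])
    have "s \<in> \<rat>" using Z(1) circle_point_rational unfolding Zs by blast
    then have "(s - 1) / 2 \<in> \<rat>" by (intro Rats_divide Rats_diff) auto
    then obtain g where g: "g \<in> G4" "m21 g \<noteq> 0" "m11 g / m21 g = sqrt 2 * ((s - 1) / 2)" using cusp by blast
    define x where "x = m11 g / m21 g"
    have "sqrt 2 * (sqrt 2 * ((s - 1) / 2)) = s - 1" unfolding sqrt2_mult by simp
    then have sx: "s = sqrt 2 * x + 1" unfolding x_def g(3) by linarith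
    note hd = height_dist[OF g(1,2) x_def, of z, folded sx, folded Zs P_def]
    note hc = height_cusp[OF g(1,2) x_def, folded sx, folded Zs]
    show ?thesis
    proof (cases "\<bar>x - z\<bar> < \<eta>")
      case True
      have "\<bar>s\<bar> \<le> \<bar>t\<bar> + sqrt 2 * \<eta>"
      proof -
        have "s = t + sqrt 2 * (x - z)" by (simp add: sx t_def algebra_simps)
        moreover have "\<bar>sqrt 2 * (x - z)\<bar> \<le> sqrt 2 * \<eta>" using True by (simp add: abs_mult)
        ultimately show ?thesis by linarith
      qed
      then have "s\<^sup>2 \<le> (\<bar>t\<bar> + sqrt 2 * \<eta>)\<^sup>2" by (metis abs_ge_zero power2_abs power_mono)
      then have "(1 + s\<^sup>2) / 2 \<le> C" by (simp add: C_def)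
      then have "(m21 g)\<^sup>2 * ((1 + s\<^sup>2) / 2) \<le> (m21 g)\<^sup>2 * C" by (intro mult_left_mono) auto
      then have "C * (\<bar>Q\<bar> + 1)\<^sup>2 \<le> C * (m21 g)\<^sup>2" using h(3) unfolding hc by (simp add: mult.commute)
      then have "(\<bar>Q\<bar> + 1)\<^sup>2 \<le> (m21 g)\<^sup>2" using C0 by simp
      then have "\<bar>Q\<bar> + 1 \<le> \<bar>m21 g\<bar>" by (metis abs_ge_zero power2_abs power2_le_imp_le)
      then have "1 / (sqrt 2 * appr z g) \<le> L + \<epsilon>" using Q[OF g(1)] by simp
      then have "(1 / (sqrt 2 * appr z g)) / ratio z x \<le> (L + \<epsilon>) / ratio z x"
        using ratio_pos[of z x] by (intro divide_right_mono) auto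
      also have "\<dots> < y" by (rule \<eta>(2)[OF True])
      finally show ?thesis unfolding hd by simp
    next
      case False
      then have xz: "\<bar>x - z\<bar> \<ge> \<eta>" by simp
      have ts: "t - s = sqrt 2 * (z - x)" by (simp add: sx t_def algebra_simps)
      have "sqrt (1 + s\<^sup>2) \<le> 1 + \<bar>s\<bar>"
        by (rule real_le_lsqrt) (simp_all add: power2_eq_square algebra_simps)
      also have "\<bar>s\<bar> \<le> \<bar>t\<bar> + sqrt 2 * \<bar>x - z\<bar>"
      proof -
        have "\<bar>t - s\<bar> = sqrt 2 * \<bar>x - z\<bar>" unfolding ts by (simp add: abs_mult abs_minus_commute)
        then show ?thesis by linarith
      qed
      also have "1 + (\<bar>t\<bar> + sqrt 2 * \<bar>x - z\<bar>) \<le> k * \<bar>x - z\<bar>"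
      proof -
        have "(1 + \<bar>t\<bar>) / \<eta> * \<eta> \<le> (1 + \<bar>t\<bar>) / \<eta> * \<bar>x - z\<bar>" using xz \<eta>(1) by (intro mult_left_mono) auto
        moreover have "(1 + \<bar>t\<bar>) / \<eta> * \<eta> = 1 + \<bar>t\<bar>" using \<eta>(1) by simp
        moreover have "k * \<bar>x - z\<bar> = (1 + \<bar>t\<bar>) / \<eta> * \<bar>x - z\<bar> + sqrt 2 * \<bar>x - z\<bar>"
          unfolding k_def by (rule distrib_right)
        ultimately show ?thesis by linarith
      qed
      finally have sq: "sqrt (1 + s\<^sup>2) \<le> k * \<bar>x - z\<bar>" by simp
      have "dist P Z = 2 * (sqrt 2 * \<bar>x - z\<bar>) / (sqrt (1 + t\<^sup>2) * sqrt (1 + s\<^sup>2))"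
        unfolding P_def t_def[symmetric] Zs dist_circle_point ts by (simp add: abs_mult abs_minus_commute)
      moreover have "\<delta> = 2 * (sqrt 2 * \<bar>x - z\<bar>) / (sqrt (1 + t\<^sup>2) * (k * \<bar>x - z\<bar>))"
        using xz \<eta>(1) by (simp add: \<delta>_def)
      moreover have "2 * (sqrt 2 * \<bar>x - z\<bar>) / (sqrt (1 + t\<^sup>2) * (k * \<bar>x - z\<bar>))
          \<le> 2 * (sqrt 2 * \<bar>x - z\<bar>) / (sqrt (1 + t\<^sup>2) * sqrt (1 + s\<^sup>2))"
      proof (rule divide_left_mono)
        have p: "sqrt (1 + t\<^sup>2) > 0" "sqrt (1 + s\<^sup>2) > 0" using one_plus_square_pos[of t] one_plus_square_pos[of s] by simp_all
        show "sqrt (1 + t\<^sup>2) * sqrt (1 + s\<^sup>2) \<le> sqrt (1 + t\<^sup>2) * (k * \<bar>x - z\<bar>)"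
          using sq p(1) by (intro mult_left_mono) auto
        have "k * \<bar>x - z\<bar> > 0" using p(2) sq by linarith
        then show "0 < sqrt (1 + t\<^sup>2) * (k * \<bar>x - z\<bar>) * (sqrt (1 + t\<^sup>2) * sqrt (1 + s\<^sup>2))"
          using p by (simp only: mult_pos_pos)
      qed simp
      ultimately have d: "\<delta> \<le> dist P Z" by simp
      have "2 / y \<le> real_of_int (height Z) * \<delta>" using h(2) \<delta> y0 by (simp add: field_simps)
      also have "\<dots> \<le> real_of_int (height Z) * dist P Z" using d h(1) by (intro mult_left_mono) auto
      finally have "2 / y \<le> real_of_int (height Z) * dist P Z" .
      moreover have "0 < 2 / y" using y0 by simp
      ultimately have "1 / (real_of_int (height Z) * dist P Z) \<le> inverse (2 / y)"
        unfolding divide_inverse[of 1] mult_1 by (rule le_imp_inverse_le)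
      then show ?thesis using y0 by simp
    qed
  qed
  then have "ereal (1 / (of_int (height Z) * dist P Z)) < y'" if "Z \<in> unit_circle \<inter> rational_plane" "height Z \<ge> Bd" for Z
    using that y(1) by (meson ereal_less(1) less_ereal.simps(1) order_less_le_trans)
  then show "\<forall>\<^sub>F Z in inf (filtercomap height at_top) (principal (unit_circle \<inter> rational_plane)).
      ereal (1 / (of_int (height Z) * dist (circle_point (sqrt 2 * z + 1)) Z)) < y'"
    unfolding eventually_height P_def by blast
qed

lemma lagrange_number_exact:
  assumes irr: "z / sqrt 2 \<notin> \<rat>" and exact: "approx_exact z L" and L: "L > 0"
  shows "lagrange_number (circle_point (sqrt 2 * z + 1)) = ereal L"
proof (rule antisym)
  have cusp: "\<exists>g\<in>G4. m21 g \<noteq> 0 \<and> m11 g / m21 g = sqrt 2 * r" if r: "r \<in> \<rat>" for r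
  proof -
    obtain k l :: int where kl: "l > 0" "r = of_int k / of_int l" using r by (blast elim: Rats_cases')
    show ?thesis unfolding kl(2) by (rule cusp_exists) (use kl(1) in simp)
  qed
  show "lagrange_number (circle_point (sqrt 2 * z + 1)) \<le> ereal L"
  proof (rule approx_bound_lagrange_le[OF irr less_imp_le[OF L] _ cusp])
    show "approx_bound z L" using exact unfolding approx_exact_def by blast
  qed
  show "ereal L \<le> lagrange_number (circle_point (sqrt 2 * z + 1))"
  proof (rule ccontr)
    assume "\<not> ?thesis"
    then have lt: "lagrange_number (circle_point (sqrt 2 * z + 1)) < ereal L" by simp
    then obtain y where y: "lagrange_number (circle_point (sqrt 2 * z + 1)) < ereal y" "ereal y < ereal L"
      using ereal_dense2 by blast
    \<comment> \<open>\<open>y\<close> may be negative, while \<open>approx_exact\<close> and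
      \<open>lagrange_le_approx_bound\<close> speak of nonnegative bounds only.\<close>
    define l where "l = max 0 y"
    have "lagrange_number (circle_point (sqrt 2 * z + 1)) \<le> ereal l"
      using y(1) by (metis ereal_less_eq(3) l_def less_imp_le max.cobounded2 order_trans)
    then have "approx_bound z l" by (intro lagrange_le_approx_bound[OF irr]) (simp_all add: l_def)
    moreover have "0 \<le> l" "l < L" using y(2) L by (simp_all add: l_def)
    ultimately show False using exact unfolding approx_exact_def by blast
  qed
qed

lemma unit_circle_irrational_circle_point:
  assumes "P \<in> unit_circle - rational_plane"
  obtains z where "z / sqrt 2 \<notin> \<rat>" "P = circle_point (sqrt 2 * z + 1)"
proof -
  obtain X Y where XY: "P = (X, Y)" "X\<^sup>2 + Y\<^sup>2 = 1" "P \<notin> rational_plane"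
    using assms by (auto simp: unit_circle_def)
  have "X \<noteq> -1"
  proof
    assume "X = -1"
    then have "P = (-1, 0)" using XY by simp
    then show False using XY(3) by (simp add: rational_plane_def)
  qed
  define t where "t = Y / (1 + X)"
  have P: "P = circle_point t" unfolding XY(1) t_def by (rule unit_circle_eq_circle_point[OF XY(2) \<open>X \<noteq> -1\<close>])
  define z where "z = (t - 1) / sqrt 2"
  have tz: "sqrt 2 * z + 1 = t" by (simp add: z_def)
  have z2: "t = 2 * (z / sqrt 2) + 1" by (simp add: z_def field_simps)
  have "z / sqrt 2 \<notin> \<rat>"
  proof
    assume "z / sqrt 2 \<in> \<rat>"
    then have "t \<in> \<rat>" unfolding z2 by (intro Rats_add Rats_mult) auto
    then show False using XY(3) circle_point_rational unfolding P by blast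
  qed
  then show thesis using that P tz by simp
qed

lemma circle_point_irrational:
  assumes "z / sqrt 2 \<notin> \<rat>"
  shows "circle_point (sqrt 2 * z + 1) \<in> unit_circle - rational_plane"
proof -
  have "z / sqrt 2 = (sqrt 2 * z + 1 - 1) / 2" by (simp add: field_simps)
  then have "sqrt 2 * z + 1 \<notin> \<rat>" using assms by (metis Rats_1 Rats_diff Rats_divide Rats_number_of)
  then show ?thesis using circle_point_in_circle circle_point_rational by blast
qed

lemma mval_bounds:
  assumes "christoffel_word c"
  shows "0 < sqrt (4 - 2 / (mval c)\<^sup>2)" "sqrt (4 - 2 / (mval c)\<^sup>2) < 2"
proof -
  have m: "1 \<le> (mval c)\<^sup>2" "0 < (mval c)\<^sup>2" using christoffel_word_props(2)[OF assms] by simp_all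
  then have m2: "2 / (mval c)\<^sup>2 \<le> 2" "0 < 2 / (mval c)\<^sup>2" by (simp_all add: divide_simps)
  then show "0 < sqrt (4 - 2 / (mval c)\<^sup>2)" by simp
  have "sqrt (4 - 2 / (mval c)\<^sup>2) < sqrt (2\<^sup>2)" using m2 by (intro real_sqrt_less_mono) simp
  then show "sqrt (4 - 2 / (mval c)\<^sup>2) < 2" by simp
qed

text \<open>A value \<open>r < 2\<close> of the spectrum is itself an approximation bound below 2.
  The classification of such bounds returns an exact constant for the same point, which must be
  \<open>r\<close>.\<close>

lemma spectrum_words:
  "lagrange_spectrum \<inter> {0..<2} = {sqrt (4 - 2 / (mval c)\<^sup>2) | c. christoffel_word c}"
proof (intro set_eqI iffI)
  fix r assume r: "r \<in> lagrange_spectrum \<inter> {0..<2}"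
  then obtain P where P: "P \<in> unit_circle - rational_plane" "lagrange_number P < \<infinity>" "r = real_of_ereal (lagrange_number P)"
    unfolding lagrange_spectrum_def by blast
  obtain z where z: "z / sqrt 2 \<notin> \<rat>" "P = circle_point (sqrt 2 * z + 1)" using unit_circle_irrational_circle_point[OF P(1)] by blast
  have "lagrange_number P \<le> ereal r" using P(2,3) by (cases "lagrange_number P") auto
  then have "approx_bound z r" using r unfolding z(2) by (intro lagrange_le_approx_bound[OF z(1)]) auto
  then obtain c where c: "christoffel_word c" "approx_exact z (sqrt (4 - 2 / (mval c)\<^sup>2))"
    using approx_bound_less_2[OF z(1)] r by auto
  have "lagrange_number P = ereal (sqrt (4 - 2 / (mval c)\<^sup>2))"
    unfolding z(2) by (rule lagrange_number_exact[OF z(1) c(2) mval_bounds(1)[OF c(1)]])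
  then have "r = sqrt (4 - 2 / (mval c)\<^sup>2)" using P(3) by simp
  then show "r \<in> {sqrt (4 - 2 / (mval c)\<^sup>2) | c. christoffel_word c}" using c(1) by blast
next
  fix r assume "r \<in> {sqrt (4 - 2 / (mval c)\<^sup>2) | c. christoffel_word c}"
  then obtain c where c: "christoffel_word c" "r = sqrt (4 - 2 / (mval c)\<^sup>2)" by blast
  obtain z where z: "z / sqrt 2 \<notin> \<rat>" "approx_exact z r" using christoffel_realized[OF c(1)] unfolding c(2) by blast
  have rb: "0 < r" "r < 2" using mval_bounds[OF c(1)] unfolding c(2) by blast+
  have e: "lagrange_number (circle_point (sqrt 2 * z + 1)) = ereal r" by (rule lagrange_number_exact[OF z rb(1)])
  have "r \<in> lagrange_spectrum"
    unfolding lagrange_spectrum_def using circle_point_irrational[OF z(1)] e by (intro CollectI exI[of _ "circle_point (sqrt 2 * z + 1)"]) simp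
  then show "r \<in> lagrange_spectrum \<inter> {0..<2}" using rb by simp
qed

theorem theorem1p3:
  shows "lagrange_spectrum \<inter> {0..<2} =
    {sqrt (4 - 1 / (of_int x)\<^sup>2) | x. x \<in> markoff_x} \<union>
    {sqrt (4 - 2 / (of_int y)\<^sup>2) | y. y \<in> markoff_y}"
proof -
  have mx: "2 / (of_int x * sqrt 2)\<^sup>2 = 1 / (real_of_int x)\<^sup>2" for x by (simp add: power_mult_distrib)
  show ?thesis
    unfolding spectrum_words
  proof (intro set_eqI iffI)
    fix r assume "r \<in> {sqrt (4 - 2 / (mval c)\<^sup>2) | c. christoffel_word c}"
    then obtain c where c: "christoffel_word c" "r = sqrt (4 - 2 / (mval c)\<^sup>2)" by blast
    from christoffel_word_props(3)[OF c(1)]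
    show "r \<in> {sqrt (4 - 1 / (of_int x)\<^sup>2) | x. x \<in> markoff_x} \<union> {sqrt (4 - 2 / (of_int y)\<^sup>2) | y. y \<in> markoff_y}"
    proof
      assume "\<exists>x \<in> markoff_x. mval c = of_int x * sqrt 2"
      then obtain x where "x \<in> markoff_x" "mval c = of_int x * sqrt 2" by blast
      then have "x \<in> markoff_x" "r = sqrt (4 - 1 / (of_int x)\<^sup>2)" using mx[of x] c(2) by simp_all
      then show ?thesis by blast
    next
      assume "\<exists>y \<in> markoff_y. mval c = of_int y"
      then show ?thesis using c(2) by auto
    qed
  next
    fix r assume "r \<in> {sqrt (4 - 1 / (of_int x)\<^sup>2) | x. x \<in> markoff_x} \<union> {sqrt (4 - 2 / (of_int y)\<^sup>2) | y. y \<in> markoff_y}"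
    then show "r \<in> {sqrt (4 - 2 / (mval c)\<^sup>2) | c. christoffel_word c}"
    proof
      assume "r \<in> {sqrt (4 - 1 / (of_int x)\<^sup>2) | x. x \<in> markoff_x}"
      then obtain x where x: "x \<in> markoff_x" "r = sqrt (4 - 1 / (of_int x)\<^sup>2)" by blast
      obtain c where c: "christoffel_word c" "mval c = of_int x * sqrt 2" using markoff_x_word[OF x(1)] by blast
      have "r = sqrt (4 - 2 / (mval c)\<^sup>2)" unfolding c(2) mx x(2) ..
      then show ?thesis using c(1) by blast
    next
      assume "r \<in> {sqrt (4 - 2 / (of_int y)\<^sup>2) | y. y \<in> markoff_y}"
      then obtain y where y: "y \<in> markoff_y" "r = sqrt (4 - 2 / (of_int y)\<^sup>2)" by blast
      obtain c where c: "christoffel_word c" "mval c = of_int y" using markoff_y_word[OF y(1)] by blast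
      have "r = sqrt (4 - 2 / (mval c)\<^sup>2)" unfolding c(2) y(2) ..
      then show ?thesis using c(1) by blast
    qed
  qed
qed

end
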